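(* Let $\mu$ be a positive Borel measure on $\mathbb T$, singular with respect to $m$, with $\mu(\mathbb T)=1$; let $U_\mu$ be multiplication by the independent variable on $L^2(\mu)$; let $\theta$ and $J_{\theta,1}^{-1}\in\mathcal L(L^2(\mu),\mathcal K_\theta)$ be associated with $\mu$ as described in the context. Let $\omega\in H^\infty$ be inner, $g\in H^2$, and suppose $X\in\mathcal L(\mathcal K_\theta,\mathcal K_\omega)$ acts by $Xf=gf$, $f\in\mathcal K_\theta$, and $X\mathcal K_\theta$ is dense in $\mathcal K_\omega$. Let $T\in\mathcal L(\mathcal K_\omega)$ be invertible with $XJ_{\theta,1}^{-1}U_\mu=TXJ_{\theta,1}^{-1}$. Then $$\sup_{n\geq0}\|T^{-n}\|\leq\Bigl(\sup_{n\geq0}\|T^n\|\Bigr)^5 .$$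
   Context: $m$ is normalized Lebesgue measure on the unit circle $\mathbb T$; $H^2$ is the Hardy space of the unit disk $\mathbb D$, identified with a subspace of $L^2(m)$; for inner $\theta$, $\mathcal K_\theta=H^2\ominus\theta H^2$. Given a positive singular Borel measure $\mu$ on $\mathbb T$ with $\mu(\mathbb T)=1$, $\theta$ is the function on $\mathbb D$ defined by $\frac{1}{1-\theta(z)}=\int_{\mathbb T}\frac{d\mu(\zeta)}{1-z\overline\zeta}$; it is inner with $\theta(0)=0$, and the operator $J_{\theta,1}^{-1}$ defined by $(J_{\theta,1}^{-1}\gamma)(z)=(1-\theta(z))\int_{\mathbb T}\frac{\gamma(\zeta)}{1-z\overline\zeta}d\mu(\zeta)$, $z\in\mathbb D$, $\gamma\in L^2(\mu)$, is a unitary operator from $L^2(\mu)$ onto $\mathcal K_\theta$ (Clark). *)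

theory Defs
  imports "HOL-Analysis.Analysis"
begin

definition circle_m :: "complex measure" where
  "circle_m = distr (density lborel (\<lambda>t. ennreal (indicator {0..2*pi} t / (2*pi))))
                     borel (\<lambda>t. cis t)"

text \<open>Functions on the disk are represented by functions complex => complex which
  vanish outside the open unit disk (canonical representatives).\<close>

definition h2_mean :: "(complex \<Rightarrow> complex) \<Rightarrow> real \<Rightarrow> real" where
  "h2_mean f r = (1 / (2*pi)) * integral {0..2*pi} (\<lambda>t. (cmod (f (of_real r * cis t)))\<^sup>2)"

definition H2 :: "(complex \<Rightarrow> complex) set" where
  "H2 = {f. f holomorphic_on ball 0 1 \<and> (\<forall>z. z \<notin> ball 0 1 \<longrightarrow> f z = 0)
            \<and> bdd_above (h2_mean f ` {0..<1})}"

definition h2_inner :: "(complex \<Rightarrow> complex) \<Rightarrow> (complex \<Rightarrow> complex) \<Rightarrow> complex" where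
  "h2_inner f g = Lim (at_left (1::real))
     (\<lambda>r. (1 / (2*pi)) * integral {0..2*pi} (\<lambda>t. f (of_real r * cis t) * cnj (g (of_real r * cis t))))"

definition h2_norm :: "(complex \<Rightarrow> complex) \<Rightarrow> real" where
  "h2_norm f = sqrt (Re (h2_inner f f))"

definition inner_fun :: "(complex \<Rightarrow> complex) \<Rightarrow> bool" where
  "inner_fun w \<longleftrightarrow> w holomorphic_on ball 0 1 \<and> bounded (w ` ball 0 1) \<and>
     (AE \<zeta> in circle_m. \<exists>l. ((\<lambda>r::real. w (of_real r * \<zeta>)) \<longlongrightarrow> l) (at_left 1) \<and> cmod l = 1)"

definition model_space :: "(complex \<Rightarrow> complex) \<Rightarrow> (complex \<Rightarrow> complex) set" where
  "model_space w = {f \<in> H2. \<forall>h \<in> H2. h2_inner f (\<lambda>z. w z * h z) = 0}"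

definition clark_theta :: "complex measure \<Rightarrow> complex \<Rightarrow> complex" where
  "clark_theta \<mu> z = (if z \<in> ball 0 1
     then 1 - 1 / integral\<^sup>L \<mu> (\<lambda>\<zeta>. 1 / (1 - z * cnj \<zeta>)) else 0)"

definition clark_Jinv :: "complex measure \<Rightarrow> (complex \<Rightarrow> complex) \<Rightarrow> complex \<Rightarrow> complex" where
  "clark_Jinv \<mu> \<gamma> z = (if z \<in> ball 0 1
     then (1 - clark_theta \<mu> z) * integral\<^sup>L \<mu> (\<lambda>\<zeta>. \<gamma> \<zeta> / (1 - z * cnj \<zeta>)) else 0)"

definition L2 :: "complex measure \<Rightarrow> (complex \<Rightarrow> complex) set" where
  "L2 \<mu> = {\<gamma>. \<gamma> \<in> borel_measurable \<mu> \<and> integrable \<mu> (\<lambda>\<zeta>. (cmod (\<gamma> \<zeta>))\<^sup>2)}"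

definition bounded_op_on ::
  "(complex \<Rightarrow> complex) set \<Rightarrow> (complex \<Rightarrow> complex) set \<Rightarrow>
   ((complex \<Rightarrow> complex) \<Rightarrow> (complex \<Rightarrow> complex)) \<Rightarrow> bool" where
  "bounded_op_on K L T \<longleftrightarrow> (\<forall>f\<in>K. T f \<in> L) \<and>
     (\<forall>f\<in>K. \<forall>h\<in>K. T (\<lambda>z. f z + h z) = (\<lambda>z. T f z + T h z)) \<and>
     (\<forall>f\<in>K. \<forall>c. T (\<lambda>z. c * f z) = (\<lambda>z. c * T f z)) \<and>
     (\<exists>C. \<forall>f\<in>K. h2_norm (T f) \<le> C * h2_norm f)"

definition op_norm ::
  "(complex \<Rightarrow> complex) set \<Rightarrow> ((complex \<Rightarrow> complex) \<Rightarrow> (complex \<Rightarrow> complex)) \<Rightarrow> ennreal" where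
  "op_norm K T = (SUP f\<in>{f\<in>K. h2_norm f \<le> 1}. ennreal (h2_norm (T f)))"

end

theory Submission
  imports Defs "HOL-Complex_Analysis.Complex_Analysis"
begin

text \<open>
  For \<open>\<gamma>\<close> in \<open>L2 \<mu>\<close> put \<open>f = clark_Jinv \<mu> \<gamma>\<close> and let \<open>f'\<close> be the image of
  \<open>\<gamma>' = cnj (\<zeta> \<gamma>)\<close>. The Cauchy integrals satisfy
  \<open>cauchy \<gamma>' z + cnj z * cnj (cauchy \<gamma> z) = P[\<gamma>' \<mu>](z)\<close>, a Poisson integral, which tends to 0
  in measure at the circle because \<open>\<mu>\<close> is singular. Hence \<open>f\<close> and \<open>f'\<close> have the same modulus
  on the circle, and \<open>g f\<close> and \<open>g f'\<close> have the same norm. The reflection \<open>\<gamma> \<mapsto> \<gamma>'\<close> conjugates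
  multiplication by \<open>\<zeta>\<close> to multiplication by \<open>cnj \<zeta>\<close>, so with \<open>Y \<gamma> = g f\<close>
  \<open>\<parallel>T^-n Y \<gamma>\<parallel> = \<parallel>Y (cnj \<zeta>^n \<gamma>)\<parallel> = \<parallel>Y (\<zeta>^n \<gamma>')\<parallel> = \<parallel>T^n Y \<gamma>'\<parallel> \<le> \<parallel>T^n\<parallel> \<parallel>Y \<gamma>'\<parallel> = \<parallel>T^n\<parallel> \<parallel>Y \<gamma>\<parallel>\<close>.
  By density \<open>\<parallel>T^-n\<parallel> \<le> sup \<parallel>T^n\<parallel>\<close>, and this supremum is at least 1 on a nonzero space.
  It suffices to use trigonometric polynomials \<open>\<gamma>\<close>: the images of analytic ones
  are the projections of polynomials to the model space and therefore dense in it.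
\<close>

text \<open>The argument forms no boundary values. Every statement about the circle is replaced by a
  limit of integrals over circles of radius r as r tends to 1 from the left, and membership in
  \<open>H2\<close> is read off Taylor coefficients. The obstacle is that g is only square
  integrable, while singularity of \<mu> gives no more than convergence in measure: the mean of the
  Poisson integral over every circle is 1. Two facts together overcome this. The squared moduli of g
  on these circles are uniformly integrable, because a Taylor polynomial absorbs all but a small
  part of the norm; and the discrepancies to be estimated, 1 - |\<theta>|^2 and the difference of
  |f'|^2 and |f|^2, are bounded. The second boundedness is why trigonometric polynomials are
  preferred to general \<gamma>: their images are bounded functions, which is proved by algebra with
  the moments of \<mu>.\<close>

section \<open>Integration against normalized arc length\<close>

definition angle_measure :: "real measure" where
  "angle_measure = density lborel (\<lambda>t. ennreal (indicator {0..2*pi} t / (2*pi)))"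

lemma circle_m_angle: "circle_m = distr angle_measure borel cis"
  by (simp add: circle_m_def angle_measure_def)

lemma sets_angle [measurable_cong]: "sets angle_measure = sets borel"
  by (simp add: angle_measure_def)

lemma space_angle [simp]: "space angle_measure = UNIV"
  by (simp add: angle_measure_def)

lemma integral_angle:
  fixes f :: "real \<Rightarrow> 'b::euclidean_space"
  assumes "continuous_on UNIV f"
  shows "integrable angle_measure f" and "integral\<^sup>L angle_measure f = (1 / (2*pi)) *\<^sub>R integral {0..2*pi} f"
proof -
  have f: "f \<in> borel_measurable lborel"
    using assms by (simp add: borel_measurable_continuous_onI)
  have int: "set_integrable lborel {0..2*pi} f"
    unfolding set_integrable_def
    by (intro borel_integrable_compact) (auto intro: continuous_on_subset[OF assms])
  have eq: "(\<lambda>t. (indicator {0..2*pi} t / (2*pi)) *\<^sub>R f t) = (\<lambda>t. (1/(2*pi)) *\<^sub>R (indicator {0..2*pi} t *\<^sub>R f t))"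
    by auto
  have m: "(\<lambda>t. indicator {0..2*pi} t / (2*pi) :: real) \<in> borel_measurable lborel"
    by measurable
  have "integrable angle_measure f \<longleftrightarrow> integrable lborel (\<lambda>t. (indicator {0..2*pi} t / (2*pi)) *\<^sub>R f t)"
    unfolding angle_measure_def by (rule integrable_density[OF f m]) simp
  then show "integrable angle_measure f"
    unfolding eq using int by (simp only: set_integrable_def integrable_scaleR_right)
  have "integral\<^sup>L angle_measure f = (LINT t|lborel. (indicator {0..2*pi} t / (2*pi)) *\<^sub>R f t)"
    unfolding angle_measure_def by (rule integral_density[OF f m]) simp
  then have "integral\<^sup>L angle_measure f = (1/(2*pi)) *\<^sub>R (LINT t : {0..2*pi} | lborel. f t)"
    unfolding eq by (simp only: set_lebesgue_integral_def integral_scaleR_right)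
  then show "integral\<^sup>L angle_measure f = (1 / (2*pi)) *\<^sub>R integral {0..2*pi} f"
    using set_borel_integral_eq_integral(2)[OF int] by simp
qed

lemma emeasure_angle_UNIV: "emeasure angle_measure UNIV = 1"
proof -
  have "emeasure angle_measure UNIV = (\<integral>\<^sup>+ t. ennreal (1/(2*pi)) * indicator {0..2*pi} t \<partial>lborel)"
    unfolding angle_measure_def
    by (subst emeasure_density) (auto intro!: nn_integral_cong split: split_indicator)
  also have "\<dots> = ennreal (1/(2*pi)) * ennreal (2*pi)"
    by (subst nn_integral_cmult_indicator) auto
  also have "\<dots> = 1"
    by (simp flip: ennreal_mult)
  finally show ?thesis .
qed

interpretation angle_measure: finite_measure angle_measure
  by standard (simp add: emeasure_angle_UNIV)

lemma measure_angle_UNIV [simp]: "measure angle_measure UNIV = 1"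
  by (simp add: measure_def emeasure_angle_UNIV)

lemma integral_angle_cis_int:
  "(LINT t|angle_measure. cis (of_int m * t)) = (if m = 0 then 1 else 0)"
proof (cases "m = 0")
  case True
  have "(LINT t|angle_measure. (1::complex)) = 1"
    by simp
  then show ?thesis using True by simp
next
  case False
  let ?F = "\<lambda>t. cis (of_int m * t) / (\<i> * of_int m)"
  have d: "(?F has_vector_derivative cis (of_int m * t)) (at t within {0..2*pi})" for t
  proof -
    have "((\<lambda>t. exp (\<i> * (of_int m * of_real t)) / (\<i> * of_int m)) has_vector_derivative exp (\<i> * (of_int m * of_real t))) (at t within {0..2*pi})"
      using False
      by (auto intro!: derivative_eq_intros has_vector_derivative_real_field simp: mult_ac)
    then show ?thesis
      by (simp add: cis_conv_exp)
  qed
  have "((\<lambda>t. cis (of_int m * t)) has_integral ?F (2*pi) - ?F 0) {0..2*pi}"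
    by (rule fundamental_theorem_of_calculus) (use d in auto)
  moreover have "cis (of_int m * (2*pi)) = 1"
    using cis_multiple_2pi[of "of_int m"] by (simp add: mult.commute mult.left_commute)
  ultimately have "integral {0..2*pi} (\<lambda>t. cis (of_int m * t)) = 0"
    by (auto simp: integral_unique)
  then show ?thesis using False
    by (subst integral_angle(2)) (auto intro!: continuous_intros)
qed

lemma integral_angle_cis_power:
  "(LINT t|angle_measure. cis t ^ k * cnj (cis t) ^ n) = (if k = n then 1 else 0)"
proof -
  have "cis t ^ k * cnj (cis t) ^ n = cis (of_int (int k - int n) * t)" for t
    by (simp add: Complex.DeMoivre cis_cnj cis_mult algebra_simps)
  then have "(LINT t|angle_measure. cis t ^ k * cnj (cis t) ^ n) = (LINT t|angle_measure. cis (of_int (int k - int n) * t))"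
    by presburger
  then show ?thesis
    by (subst (asm) integral_angle_cis_int) simp
qed

text \<open>A Weierstrass majorant suffices for termwise integration because the total mass is 1, so
  that \<open>A n\<close> also bounds the integral of the n-th norm.\<close>

lemma integral_angle_sums:
  fixes f :: "nat \<Rightarrow> real \<Rightarrow> complex"
  assumes c: "\<And>n. continuous_on UNIV (f n)" and b: "\<And>n t. norm (f n t) \<le> A n" and A: "summable A"
  shows "(\<lambda>n. LINT t|angle_measure. f n t) sums (LINT t|angle_measure. (\<Sum>n. f n t))"
proof (rule sums_integral)
  show int: "integrable angle_measure (f n)" for n
    by (rule integral_angle(1)[OF c])
  have s: "summable (\<lambda>n. norm (f n t))" for t
    by (rule summable_comparison_test'[OF A]) (use b in auto)
  then show "AE x in angle_measure. summable (\<lambda>i. norm (f i x))"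
    by auto
  have "(LINT t|angle_measure. norm (f n t)) \<le> A n" for n
  proof -
    have "(LINT t|angle_measure. norm (f n t)) \<le> (LINT t|angle_measure. A n)"
      by (intro integral_mono integrable_norm int b) auto
    then show ?thesis by simp
  qed
  then show "summable (\<lambda>i. LINT x|angle_measure. norm (f i x))"
    by (intro summable_comparison_test'[OF A, of 0]) (auto simp: abs_of_nonneg)
qed

section \<open>Taylor coefficients and Parseval's identity\<close>

definition coef :: "(complex \<Rightarrow> complex) \<Rightarrow> nat \<Rightarrow> complex" where
  "coef f n = (deriv ^^ n) f 0 / fact n"

lemma coef_sums:
  assumes "f holomorphic_on ball 0 1" "norm z < 1"
  shows "(\<lambda>n. coef f n * z ^ n) sums f z"
  using holomorphic_power_series[OF assms(1), of z] assms(2) by (simp add: coef_def)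

lemma power_series_summable_norm:
  fixes a :: "nat \<Rightarrow> complex"
  assumes "\<And>z. norm z < 1 \<Longrightarrow> (\<lambda>n. a n * z ^ n) sums f z" "0 \<le> r" "r < 1"
  shows "summable (\<lambda>n. norm (a n) * r ^ n)"
proof -
  \<comment> \<open>Convergence at any radius strictly between r and 1 forces absolute convergence
    at r; the midpoint serves.\<close>
  define s where "s = (r + 1) / 2"
  have s: "r < s" "s < 1" "0 < s" using assms by (auto simp: s_def)
  have "(\<lambda>n. a n * of_real s ^ n) sums f (of_real s)"
    using assms(1)[of "of_real s"] s by simp
  then have "summable (\<lambda>n. norm (a n * of_real r ^ n))"
    using powser_insidea[of a "of_real s" "of_real r"] s assms by (auto simp: sums_iff)
  then show ?thesis
    using assms by (simp add: norm_mult norm_power)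
qed

text \<open>Termwise integration turns orthogonality of the exponentials into Cauchy's coefficient
  formula. The hypothesis is a power series, not holomorphy, so that the formula also applies to
  coefficients not yet known to be \<open>coef f\<close>.\<close>

lemma integral_angle_power_series:
  fixes a :: "nat \<Rightarrow> complex"
  assumes a: "\<And>z. norm z < 1 \<Longrightarrow> (\<lambda>n. a n * z ^ n) sums f z" and r: "0 \<le> r" "r < 1"
  shows "(LINT t|angle_measure. f (of_real r * cis t) * cnj (cis t) ^ n) = a n * of_real r ^ n"
proof -
  have "(\<lambda>k. LINT t|angle_measure. a k * of_real r ^ k * (cis t ^ k * cnj (cis t) ^ n))
          sums (LINT t|angle_measure. (\<Sum>k. a k * of_real r ^ k * (cis t ^ k * cnj (cis t) ^ n)))"
    by (rule integral_angle_sums[OF _ _ power_series_summable_norm[OF a r]])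
       (use r in \<open>auto simp: norm_mult norm_power intro!: continuous_intros\<close>)
  moreover have "(\<Sum>k. a k * of_real r ^ k * (cis t ^ k * cnj (cis t) ^ n)) = f (of_real r * cis t) * cnj (cis t) ^ n" for t
  proof -
    have "(\<lambda>k. a k * (of_real r * cis t) ^ k * cnj (cis t) ^ n) sums (f (of_real r * cis t) * cnj (cis t) ^ n)"
      using r by (intro sums_mult2 a) (auto simp: norm_mult)
    then show ?thesis
      by (simp add: sums_iff power_mult_distrib mult_ac)
  qed
  moreover have "(LINT t|angle_measure. a k * of_real r ^ k * (cis t ^ k * cnj (cis t) ^ n)) = (if k = n then a n * of_real r ^ n else 0)" for k
    by (simp add: integral_angle_cis_power)
  ultimately have "(\<lambda>k. if k = n then a n * of_real r ^ n else 0) sums (LINT t|angle_measure. f (of_real r * cis t) * cnj (cis t) ^ n)"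
    by simp
  from sums_unique2[OF this sums_single] show ?thesis by simp
qed

text \<open>The given coefficients and those of \<open>coef f\<close> are recovered by the same
  integral over the circle of radius 1/2, so they agree.\<close>

lemma coef_unique:
  assumes "\<And>z. norm z < 1 \<Longrightarrow> (\<lambda>n. a n * z ^ n) sums f z"
  shows "coef f n = a n"
proof -
  have "f holomorphic_on ball 0 1"
    by (rule power_series_holomorphic[where a = a]) (use assms in auto)
  note s = coef_sums[OF this]
  show ?thesis
    using integral_angle_power_series[OF s, of "1/2" n] integral_angle_power_series[OF assms, of "1/2" n]
    by simp
qed

text \<open>Derivatives at 0 see only a neighbourhood of 0. This makes everything defined through
  coefficients insensitive to values off the disk.\<close>

lemma coef_cong:
  assumes "\<And>z. norm z < 1 \<Longrightarrow> f z = g z"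
  shows "coef f = coef g"
proof -
  have "eventually (\<lambda>z. f z = g z) (nhds 0)"
    by (rule eventually_nhds_in_open[of "ball 0 1", THEN eventually_mono]) (use assms in auto)
  from higher_deriv_cong_ev[OF this refl] show ?thesis
    by (auto simp: coef_def fun_eq_iff)
qed

lemma coef_add:
  assumes "f holomorphic_on ball 0 1" "g holomorphic_on ball 0 1"
  shows "coef (\<lambda>z. f z + g z) n = coef f n + coef g n"
proof (rule coef_unique)
  fix z :: complex
  assume z: "norm z < 1"
  show "(\<lambda>n. (coef f n + coef g n) * z ^ n) sums (f z + g z)"
    using sums_add[OF coef_sums[OF assms(1) z] coef_sums[OF assms(2) z]]
    by (simp only: distrib_right)
qed

lemma coef_cmult:
  assumes "f holomorphic_on ball 0 1"
  shows "coef (\<lambda>z. c * f z) n = c * coef f n"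
proof (rule coef_unique)
  fix z :: complex
  assume z: "norm z < 1"
  show "(\<lambda>n. c * coef f n * z ^ n) sums (c * f z)"
    using sums_mult[OF coef_sums[OF assms z], of c] by (simp only: mult.assoc)
qed

lemma coef_power: "coef (\<lambda>z. z ^ k) n = (if n = k then 1 else 0)"
proof (rule coef_unique)
  fix z :: complex
  have eq: "(\<lambda>n. (if n = k then 1 else 0) * z ^ n) = (\<lambda>n. if n = k then z ^ n else 0)"
    by (auto simp: fun_eq_iff)
  show "(\<lambda>n. (if n = k then 1 else 0) * z ^ n) sums (z ^ k)"
    unfolding eq by (rule sums_single)
qed

lemma coef_const: "coef (\<lambda>z. c) n = (if n = 0 then c else 0)"
proof (rule coef_unique)
  fix z :: complex
  have eq: "(\<lambda>n. (if n = 0 then c else 0) * z ^ n) = (\<lambda>n. if n = 0 then c else 0)"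
    by (auto simp: fun_eq_iff)
  show "(\<lambda>n. (if n = 0 then c else 0) * z ^ n) sums c"
    unfolding eq by (rule sums_single)
qed

lemma coef_0: "coef f 0 = f 0"
  by (simp add: coef_def)

lemma coef_mult:
  assumes "f holomorphic_on ball 0 1" "g holomorphic_on ball 0 1"
  shows "coef (\<lambda>z. f z * g z) n = (\<Sum>i\<le>n. coef f i * coef g (n - i))"
proof -
  have "of_nat (n choose i) / fact n = 1 / (fact i * fact (n - i) :: complex)" if "i \<le> n" for i
    using that by (simp add: binomial_fact field_simps)
  then have "of_nat (n choose i) * (deriv ^^ i) f 0 * (deriv ^^ (n-i)) g 0 / fact n = coef f i * coef g (n - i)" if "i \<le> n" for i
    using that by (simp add: coef_def binomial_fact field_simps)
  then show ?thesis
    unfolding coef_def[of "\<lambda>z. f z * g z"]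
    by (subst higher_deriv_mult[OF assms]) (auto simp: sum_divide_distrib atLeast0AtMost)
qed

lemma circle_continuous:
  assumes "f holomorphic_on ball 0 1" "0 \<le> r" "r < 1"
  shows "continuous_on UNIV (\<lambda>t. f (of_real r * cis t))"
  by (rule continuous_on_compose2[OF holomorphic_on_imp_continuous_on[OF assms(1)]])
     (use assms in \<open>auto intro!: continuous_intros simp: norm_mult\<close>)

text \<open>Only g is expanded in a series; f stays bounded on the circle of radius r and acts as a
  fixed factor. Each term is then a coefficient integral of f, and no double series has to be
  rearranged.\<close>

lemma parseval:
  assumes f: "f holomorphic_on ball 0 1" and g: "g holomorphic_on ball 0 1" and r: "0 \<le> r" "r < 1"
  shows "(\<lambda>n. coef f n * cnj (coef g n) * of_real r ^ (2*n))
           sums (LINT t|angle_measure. f (of_real r * cis t) * cnj (g (of_real r * cis t)))"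
proof -
  have cf: "continuous_on UNIV (\<lambda>t. f (of_real r * cis t))"
    by (rule circle_continuous[OF f r])
  have "compact ((\<lambda>z. f z) ` cball 0 r)"
    by (intro compact_continuous_image continuous_on_subset[OF holomorphic_on_imp_continuous_on[OF f]])
       (use r in auto)
  then obtain B where B: "\<And>z. z \<in> cball 0 r \<Longrightarrow> norm (f z) \<le> B"
    by (force dest!: compact_imp_bounded simp: bounded_iff)
  let ?c = "\<lambda>n. cnj (coef g n) * of_real r ^ n"
  have "(\<lambda>n. LINT t|angle_measure. ?c n * (f (of_real r * cis t) * cnj (cis t) ^ n))
     sums (LINT t|angle_measure. (\<Sum>n. ?c n * (f (of_real r * cis t) * cnj (cis t) ^ n)))"
  proof (rule integral_angle_sums)
    show "continuous_on UNIV (\<lambda>t. ?c n * (f (of_real r * cis t) * cnj (cis t) ^ n))" for n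
      by (intro continuous_intros cf)
    show "summable (\<lambda>n. norm (coef g n) * r ^ n * B)"
      by (intro summable_mult2 power_series_summable_norm[OF coef_sums[OF g] r])
    fix n t
    have "norm (f (of_real r * cis t)) \<le> B"
      using r by (intro B) (auto simp: norm_mult)
    then show "norm (?c n * (f (of_real r * cis t) * cnj (cis t) ^ n)) \<le> norm (coef g n) * r ^ n * B"
      using r by (auto simp: norm_mult norm_power intro!: mult_left_mono)
  qed
  moreover have "(LINT t|angle_measure. ?c n * (f (of_real r * cis t) * cnj (cis t) ^ n)) = coef f n * cnj (coef g n) * of_real r ^ (2*n)" for n
    by (simp add: integral_angle_power_series[OF coef_sums[OF f] r] mult_2 power_add)
  moreover have "(\<Sum>n. ?c n * (f (of_real r * cis t) * cnj (cis t) ^ n)) = f (of_real r * cis t) * cnj (g (of_real r * cis t))" for t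
  proof -
    have "(\<lambda>n. cnj (coef g n * (of_real r * cis t) ^ n)) sums cnj (g (of_real r * cis t))"
      unfolding sums_cnj using r by (intro coef_sums[OF g]) (auto simp: norm_mult)
    from sums_mult[OF this, of "f (of_real r * cis t)"] show ?thesis
      by (simp add: sums_iff power_mult_distrib mult_ac)
  qed
  ultimately show ?thesis by (simp only:)
qed

section \<open>The Hardy space\<close>

text \<open>Unlike in \<open>H2\<close>, values off the disk are not constrained, so that polynomials qualify;
  \<open>h2_inner\<close> and \<open>h2_norm\<close> do not see these values.\<close>

definition hardy :: "(complex \<Rightarrow> complex) \<Rightarrow> bool" where
  "hardy f \<longleftrightarrow> f holomorphic_on ball 0 1 \<and> summable (\<lambda>n. (cmod (coef f n))\<^sup>2)"

definition nsq :: "(complex \<Rightarrow> complex) \<Rightarrow> real" where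
  "nsq f = (\<Sum>n. (cmod (coef f n))\<^sup>2)"

text \<open>For holomorphic f and radii below 1 this is \<open>h2_mean\<close>, written as a
  Lebesgue integral so that it can be combined with the integral estimates over
  \<open>angle_measure\<close>.\<close>

definition mean2 :: "(complex \<Rightarrow> complex) \<Rightarrow> real \<Rightarrow> real" where
  "mean2 f r = (LINT t|angle_measure. (cmod (f (of_real r * cis t)))\<^sup>2)"

lemma integral_angle_mono:
  fixes f g :: "real \<Rightarrow> real"
  assumes "continuous_on UNIV f" "continuous_on UNIV g" "\<And>t. f t \<le> g t"
  shows "integral\<^sup>L angle_measure f \<le> integral\<^sup>L angle_measure g"
  by (intro integral_mono integral_angle assms)

lemma h2_mean_eq:
  assumes "f holomorphic_on ball 0 1" "0 \<le> r" "r < 1"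
  shows "h2_mean f r = mean2 f r"
  unfolding h2_mean_def mean2_def
  by (subst integral_angle(2)) (auto intro!: continuous_intros circle_continuous assms)

lemma mean2_sums:
  assumes f: "f holomorphic_on ball 0 1" and r: "0 \<le> r" "r < 1"
  shows "(\<lambda>n. (cmod (coef f n))\<^sup>2 * r ^ (2*n)) sums mean2 f r"
proof -
  have "(\<lambda>n. of_real ((cmod (coef f n))\<^sup>2 * r ^ (2*n))) sums
      (LINT t|angle_measure. complex_of_real ((cmod (f (of_real r * cis t)))\<^sup>2))"
    using parseval[OF f f r] by (simp only: flip: complex_norm_square of_real_mult of_real_power)
  then show ?thesis
    unfolding mean2_def integral_complex_of_real sums_of_real_iff .
qed

lemma mean2_nonneg: "0 \<le> mean2 f r"
  by (simp add: mean2_def)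

lemma nsq_nonneg: "hardy f \<Longrightarrow> 0 \<le> nsq f"
  by (auto simp: nsq_def hardy_def intro!: suminf_nonneg)

lemma mean2_le_nsq:
  assumes "hardy f" "0 \<le> r" "r < 1"
  shows "mean2 f r \<le> nsq f"
  unfolding nsq_def
proof (rule sums_le[OF _ mean2_sums summable_sums])
  show "(cmod (coef f n))\<^sup>2 * r ^ (2 * n) \<le> (cmod (coef f n))\<^sup>2" for n
    using assms by (intro mult_left_le power_le_one) auto
qed (use assms in \<open>auto simp: hardy_def\<close>)

text \<open>Each partial sum is a polynomial in r that stays below B for r < 1. Letting r tend to 1
  in the finite sum alone bounds all partial sums of the series at r = 1.\<close>

lemma hardyI:
  assumes f: "f holomorphic_on ball 0 1" and b: "\<And>r. 0 < r \<Longrightarrow> r < 1 \<Longrightarrow> mean2 f r \<le> B"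
  shows "hardy f"
proof -
  have "summable (\<lambda>n. (cmod (coef f n))\<^sup>2)"
  proof (rule summableI_nonneg_bounded)
    fix N
    have "(\<Sum>n<N. (cmod (coef f n))\<^sup>2 * r ^ (2*n)) \<le> B" if "0 < r" "r < 1" for r
    proof -
      have "(\<Sum>n<N. (cmod (coef f n))\<^sup>2 * r ^ (2*n)) \<le> mean2 f r"
        using sum_le_suminf[OF sums_summable[OF mean2_sums[OF f, of r]], of "{..<N}"]
          sums_unique[OF mean2_sums[OF f, of r]] that
        by simp
      then show ?thesis using b[OF that] by simp
    qed
    then have "eventually (\<lambda>r. (\<Sum>n<N. (cmod (coef f n))\<^sup>2 * r ^ (2*n)) \<le> B) (at_left 1)"
      by (rule eventually_at_left_1)
    moreover have "((\<lambda>r. \<Sum>n<N. (cmod (coef f n))\<^sup>2 * r ^ (2*n)) \<longlongrightarrow> (\<Sum>n<N. (cmod (coef f n))\<^sup>2 * 1 ^ (2*n))) (at_left 1)"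
      by (intro tendsto_intros)
    ultimately have "(\<Sum>n<N. (cmod (coef f n))\<^sup>2 * 1 ^ (2*n)) \<le> B"
      by (intro tendsto_upperbound) auto
    then show "(\<Sum>n<N. (cmod (coef f n))\<^sup>2) \<le> B" by simp
  qed simp
  then show ?thesis using f by (simp add: hardy_def)
qed

lemma hardy_holo: "hardy f \<Longrightarrow> f holomorphic_on ball 0 1"
  by (simp add: hardy_def)

text \<open>From here on square summable coefficients are the working notion. Bounded means lead to
  them by \<open>hardyI\<close>; conversely \<open>nsq f\<close> bounds all means.\<close>

lemma H2_iff: "f \<in> H2 \<longleftrightarrow> hardy f \<and> (\<forall>z. z \<notin> ball 0 1 \<longrightarrow> f z = 0)"
proof
  assume f: "f \<in> H2"
  then have h: "f holomorphic_on ball 0 1" and "bdd_above (h2_mean f ` {0..<1})"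
    by (auto simp: H2_def)
  then obtain B where B: "\<And>r. r \<in> {0..<1} \<Longrightarrow> h2_mean f r \<le> B"
    by (force simp: bdd_above_def)
  have "hardy f"
    by (rule hardyI[OF h, of B]) (use B h2_mean_eq[OF h] in force)
  with f show "hardy f \<and> (\<forall>z. z \<notin> ball 0 1 \<longrightarrow> f z = 0)"
    by (auto simp: H2_def)
next
  assume f: "hardy f \<and> (\<forall>z. z \<notin> ball 0 1 \<longrightarrow> f z = 0)"
  then have "bdd_above (h2_mean f ` {0..<1})"
    by (intro bdd_aboveI2[of _ _ "nsq f"]) (use h2_mean_eq hardy_holo mean2_le_nsq in force)
  with f show "f \<in> H2"
    by (auto simp: H2_def hardy_def)
qed

lemma hardy_H2: "f \<in> H2 \<Longrightarrow> hardy f"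
  by (simp add: H2_iff)

lemma hardy_cong:
  assumes "\<And>z. norm z < 1 \<Longrightarrow> f z = g z" "hardy f"
  shows "hardy g"
  using assms coef_cong[of f g] holomorphic_cong[of "ball 0 1" "ball 0 1" f g]
  by (simp add: hardy_def)

lemma hardy_add:
  assumes "hardy f" "hardy g"
  shows "hardy (\<lambda>z. f z + g z)"
proof -
  have "summable (\<lambda>n. (cmod (coef f n + coef g n))\<^sup>2)"
  proof (rule summable_comparison_test')
    show "summable (\<lambda>n. 2 * (cmod (coef f n))\<^sup>2 + 2 * (cmod (coef g n))\<^sup>2)"
      using assms by (intro summable_add summable_mult) (auto simp: hardy_def)
    fix n
    have "(cmod (coef f n + coef g n))\<^sup>2 \<le> (cmod (coef f n) + cmod (coef g n))\<^sup>2"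
      by (intro power_mono norm_triangle_ineq) auto
    also have "\<dots> \<le> 2 * (cmod (coef f n))\<^sup>2 + 2 * (cmod (coef g n))\<^sup>2"
      using sum_squares_bound[of "cmod (coef f n)" "cmod (coef g n)"]
      by (simp add: power2_sum)
    finally show "norm ((cmod (coef f n + coef g n))\<^sup>2) \<le> 2 * (cmod (coef f n))\<^sup>2 + 2 * (cmod (coef g n))\<^sup>2"
      by simp
  qed
  then show ?thesis
    using assms by (auto simp: hardy_def coef_add intro!: holomorphic_intros)
qed

lemma hardy_cmult:
  assumes "hardy f"
  shows "hardy (\<lambda>z. c * f z)"
  using assms
  by (auto simp: hardy_def coef_cmult norm_mult power_mult_distrib intro!: holomorphic_on_mult summable_mult)

lemma mean2_mult_le:
  assumes u: "u holomorphic_on ball 0 1" and b: "\<And>z. norm z < 1 \<Longrightarrow> norm (u z) \<le> B"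
    and h: "h holomorphic_on ball 0 1" and r: "0 \<le> r" "r < 1"
  shows "mean2 (\<lambda>z. u z * h z) r \<le> B\<^sup>2 * mean2 h r"
proof -
  have "mean2 (\<lambda>z. u z * h z) r \<le> (LINT t|angle_measure. B\<^sup>2 * (cmod (h (of_real r * cis t)))\<^sup>2)"
    unfolding mean2_def
  proof (rule integral_angle_mono)
    fix t
    have "cmod (u (of_real r * cis t)) \<le> B"
      using r by (intro b) (auto simp: norm_mult)
    then show "(cmod (u (of_real r * cis t) * h (of_real r * cis t)))\<^sup>2 \<le> B\<^sup>2 * (cmod (h (of_real r * cis t)))\<^sup>2"
      by (auto simp: norm_mult power_mult_distrib intro!: mult_right_mono power_mono)
  qed (auto intro!: continuous_intros circle_continuous u h r)
  then show ?thesis by (simp add: mean2_def)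
qed

lemma hardy_mult:
  assumes u: "u holomorphic_on ball 0 1" and b: "\<And>z. norm z < 1 \<Longrightarrow> norm (u z) \<le> B" and h: "hardy h"
  shows "hardy (\<lambda>z. u z * h z)"
proof -
  have "mean2 (\<lambda>z. u z * h z) r \<le> B\<^sup>2 * nsq h" if r: "0 < r" "r < 1" for r
  proof -
    have "mean2 (\<lambda>z. u z * h z) r \<le> B\<^sup>2 * mean2 h r"
      using r by (intro mean2_mult_le u b hardy_holo[OF h]) auto
    also have "\<dots> \<le> B\<^sup>2 * nsq h"
      using r by (intro mult_left_mono mean2_le_nsq h) auto
    finally show ?thesis .
  qed
  then show ?thesis
    by (rule hardyI[OF holomorphic_on_mult[OF u hardy_holo[OF h]]])
qed

lemma hardy_const: "hardy (\<lambda>z. c)"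
proof -
  have "summable (\<lambda>n. (cmod (coef (\<lambda>z. c) n))\<^sup>2)"
    by (rule summable_finite[of "{0}"]) (auto simp: coef_const)
  then show ?thesis by (simp add: hardy_def)
qed

lemma hardy_bounded:
  assumes "u holomorphic_on ball 0 1" "\<And>z. norm z < 1 \<Longrightarrow> norm (u z) \<le> B"
  shows "hardy u"
  using hardy_mult[OF assms hardy_const[of 1]] by simp

lemma hardy_power_mult: "hardy h \<Longrightarrow> hardy (\<lambda>z. z ^ n * h z)"
  by (rule hardy_mult[of _ 1])
     (auto simp: norm_power power_le_one intro: holomorphic_on_power[OF holomorphic_on_ident])

lemma hardy_id_mult: "hardy h \<Longrightarrow> hardy (\<lambda>z. z * h z)"
  using hardy_power_mult[of h 1] by simp

lemma hardy_sum: "(\<And>i. i \<in> A \<Longrightarrow> hardy (f i)) \<Longrightarrow> hardy (\<lambda>z. \<Sum>i\<in>A. f i z)"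
  by (induction A rule: infinite_finite_induct) (auto intro: hardy_const hardy_add)

lemma summable_hardy_inner:
  assumes "hardy f" "hardy g"
  shows "summable (\<lambda>n. cmod (coef f n) * cmod (coef g n))"
proof (rule summable_comparison_test')
  show "summable (\<lambda>n. (cmod (coef f n))\<^sup>2 + (cmod (coef g n))\<^sup>2)"
    using assms by (intro summable_add) (auto simp: hardy_def)
  fix n
  have nn: "0 \<le> cmod (coef f n) * cmod (coef g n)" by simp
  show "norm (cmod (coef f n) * cmod (coef g n)) \<le> (cmod (coef f n))\<^sup>2 + (cmod (coef g n))\<^sup>2"
    unfolding real_norm_def abs_of_nonneg[OF nn]
    using sum_squares_bound[of "cmod (coef f n)" "cmod (coef g n)"] nn by linarith
qed

text \<open>Tannery's theorem applies with the product of the moduli of the coefficients as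
  majorant: it does not depend on r, and it is summable by
  \<open>summable_hardy_inner\<close>.\<close>

lemma hardy_inner_tendsto:
  assumes f: "hardy f" and g: "hardy g"
  shows "((\<lambda>r. LINT t|angle_measure. f (of_real r * cis t) * cnj (g (of_real r * cis t)))
      \<longlongrightarrow> (\<Sum>n. coef f n * cnj (coef g n))) (at_left 1)"
proof -
  have ev: "eventually (\<lambda>r::real. 0 < r \<and> r < 1) (at_left 1)"
    by (rule eventually_at_left_1) auto
  have "((\<lambda>r::real. \<Sum>n. coef f n * cnj (coef g n) * of_real r ^ (2*n)) \<longlongrightarrow> (\<Sum>n. coef f n * cnj (coef g n))) (at_left 1)"
  proof (rule tannerys_theorem[THEN conjunct2, THEN conjunct2])
    show "summable (\<lambda>n. cmod (coef f n) * cmod (coef g n))"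
      by (rule summable_hardy_inner[OF f g])
    show "((\<lambda>r::real. coef f n * cnj (coef g n) * of_real r ^ (2*n)) \<longlongrightarrow> coef f n * cnj (coef g n)) (at_left 1)" for n
      by (rule tendsto_eq_intros refl | simp)+
    have "\<forall>\<^sub>F x in at_top \<times>\<^sub>F at_left (1::real). 0 < snd x \<and> snd x < 1"
      using ev unfolding eventually_prod_filter
      by (intro exI[of _ "\<lambda>_. True"] exI[of _ "\<lambda>r. 0 < r \<and> r < 1"]) auto
    then show "\<forall>\<^sub>F (n, r) in at_top \<times>\<^sub>F at_left (1::real). cmod (coef f n * cnj (coef g n) * of_real r ^ (2 * n))
        \<le> cmod (coef f n) * cmod (coef g n)"
    proof eventually_elim
      case (elim x)
      then show ?case
        by (cases x) (auto simp: norm_mult norm_power intro!: mult_left_le power_le_one)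
    qed
  qed auto
  then show ?thesis
  proof (rule Lim_transform_eventually)
    show "\<forall>\<^sub>F r in at_left 1. (\<Sum>n. coef f n * cnj (coef g n) * of_real r ^ (2*n))
       = (LINT t|angle_measure. f (of_real r * cis t) * cnj (g (of_real r * cis t)))"
      using ev
    proof eventually_elim
      case (elim r)
      then show ?case
        using parseval[OF hardy_holo[OF f] hardy_holo[OF g], of r] by (simp add: sums_iff)
    qed
  qed
qed

lemma h2_inner_eq:
  assumes f: "hardy f" and g: "hardy g"
  shows "h2_inner f g = (\<Sum>n. coef f n * cnj (coef g n))"
proof -
  have "\<forall>\<^sub>F r in at_left 1. (LINT t|angle_measure. f (of_real r * cis t) * cnj (g (of_real r * cis t)))
     = 1 / (2*pi) * integral {0..2*pi} (\<lambda>t. f (of_real r * cis t) * cnj (g (of_real r * cis t)))"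
  proof (rule eventually_at_left_1)
    fix r :: real assume "0 < r" "r < 1"
    then show "(LINT t|angle_measure. f (of_real r * cis t) * cnj (g (of_real r * cis t)))
     = 1 / (2*pi) * integral {0..2*pi} (\<lambda>t. f (of_real r * cis t) * cnj (g (of_real r * cis t)))"
      by (subst integral_angle(2))
         (auto intro!: continuous_intros circle_continuous hardy_holo f g simp: scaleR_conv_of_real)
  qed
  from Lim_transform_eventually[OF hardy_inner_tendsto[OF f g] this]
  show ?thesis
    unfolding h2_inner_def by (intro tendsto_Lim) auto
qed

lemma h2_inner_tendsto:
  assumes "hardy f" "hardy g"
  shows "((\<lambda>r. LINT t|angle_measure. f (of_real r * cis t) * cnj (g (of_real r * cis t)))
      \<longlongrightarrow> h2_inner f g) (at_left 1)"
  using hardy_inner_tendsto[OF assms] by (simp add: h2_inner_eq[OF assms])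

lemma h2_inner_sums:
  assumes f: "hardy f" and g: "hardy g"
  shows "(\<lambda>n. coef f n * cnj (coef g n)) sums h2_inner f g"
  unfolding h2_inner_eq[OF f g]
  by (intro summable_sums summable_norm_cancel[where f = "\<lambda>n. coef f n * cnj (coef g n)"])
     (use summable_hardy_inner[OF f g] in \<open>simp add: norm_mult\<close>)

lemma h2_norm_eq:
  assumes "hardy f"
  shows "h2_norm f = sqrt (nsq f)"
proof -
  have "(\<lambda>n. complex_of_real ((cmod (coef f n))\<^sup>2)) sums h2_inner f f"
    using h2_inner_sums[OF assms assms] by (simp only: complex_norm_square)
  moreover have "(\<lambda>n. complex_of_real ((cmod (coef f n))\<^sup>2)) sums of_real (nsq f)"
    unfolding sums_of_real_iff nsq_def using assms by (auto simp: hardy_def)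
  ultimately have "h2_inner f f = of_real (nsq f)"
    by (rule sums_unique2)
  then show ?thesis by (simp add: h2_norm_def)
qed

lemma h2_norm_nonneg: "hardy f \<Longrightarrow> 0 \<le> h2_norm f"
  by (simp add: h2_norm_eq nsq_nonneg)

lemma h2_norm_tendsto:
  assumes "hardy f"
  shows "((\<lambda>r. mean2 f r) \<longlongrightarrow> (h2_norm f)\<^sup>2) (at_left 1)"
proof -
  have "((\<lambda>r. complex_of_real (mean2 f r)) \<longlongrightarrow> h2_inner f f) (at_left 1)"
    using h2_inner_tendsto[OF assms assms]
    by (simp only: mean2_def complex_norm_square flip: integral_complex_of_real)
  from tendsto_Re[OF this] have t: "((\<lambda>r. mean2 f r) \<longlongrightarrow> Re (h2_inner f f)) (at_left 1)"
    by simp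
  have "0 \<le> Re (h2_inner f f)"
    by (rule tendsto_lowerbound[OF t]) (auto simp: mean2_nonneg)
  then show ?thesis using t by (simp add: h2_norm_def)
qed

lemma h2_inner_add:
  assumes "hardy f" "hardy g" "hardy h"
  shows "h2_inner (\<lambda>z. f z + g z) h = h2_inner f h + h2_inner g h"
proof (rule sums_unique2[OF h2_inner_sums])
  show "(\<lambda>n. coef (\<lambda>z. f z + g z) n * cnj (coef h n)) sums (h2_inner f h + h2_inner g h)"
    using sums_add[OF h2_inner_sums[OF assms(1,3)] h2_inner_sums[OF assms(2,3)]]
    by (simp only: coef_add hardy_holo assms distrib_right)
qed (intro assms hardy_add)+

lemma h2_inner_cmult:
  assumes "hardy f" "hardy h"
  shows "h2_inner (\<lambda>z. c * f z) h = c * h2_inner f h"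
proof (rule sums_unique2[OF h2_inner_sums])
  show "(\<lambda>n. coef (\<lambda>z. c * f z) n * cnj (coef h n)) sums (c * h2_inner f h)"
    using sums_mult[OF h2_inner_sums[OF assms], of c]
    by (simp only: coef_cmult hardy_holo assms mult.assoc)
qed (intro assms hardy_cmult)+

lemma h2_inner_sum:
  assumes "\<And>i. i \<in> A \<Longrightarrow> hardy (f i)" "hardy h"
  shows "h2_inner (\<lambda>z. \<Sum>i\<in>A. f i z) h = (\<Sum>i\<in>A. h2_inner (f i) h)"
  using assms
proof (induction A rule: infinite_finite_induct)
  case (insert x A)
  then show ?case
    by (simp add: h2_inner_add hardy_sum)
qed (use h2_inner_cmult[of "\<lambda>_. 0" h 0] in \<open>auto simp: hardy_const\<close>)

lemma h2_inner_cong: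
  assumes "\<And>z. norm z < 1 \<Longrightarrow> f z = f' z" "hardy f" "\<And>z. norm z < 1 \<Longrightarrow> h z = h' z" "hardy h"
  shows "h2_inner f h = h2_inner f' h'"
  using h2_inner_eq[OF assms(2,4)] h2_inner_eq[OF hardy_cong[OF assms(1,2)] hardy_cong[OF assms(3,4)]]
    coef_cong[OF assms(1)] coef_cong[OF assms(3)] by simp

lemma h2_inner_power:
  assumes "hardy h"
  shows "h2_inner (\<lambda>z. z ^ n) h = cnj (coef h n)"
proof (rule sums_unique2[OF h2_inner_sums])
  have "(\<lambda>k. if k = n then cnj (coef h k) else 0) sums cnj (coef h n)"
    by (rule sums_single)
  then show "(\<lambda>k. coef (\<lambda>z. z ^ n) k * cnj (coef h k)) sums cnj (coef h n)"
    by (simp add: coef_power if_distrib[of "\<lambda>x. x * _"] cong: if_cong)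
qed (use assms hardy_power_mult[OF hardy_const[of 1]] in auto)

text \<open>Minkowski's inequality holds for finite sections, and its right side is bounded by the
  full norms before the limit is taken.\<close>

lemma h2_norm_triangle:
  assumes f: "hardy f" and g: "hardy g"
  shows "h2_norm (\<lambda>z. f z + g z) \<le> h2_norm f + h2_norm g"
proof -
  have sf: "(\<Sum>n<N. (cmod (coef f n))\<^sup>2) \<le> nsq f" and sg: "(\<Sum>n<N. (cmod (coef g n))\<^sup>2) \<le> nsq g" for N
    using f g unfolding nsq_def hardy_def by (auto intro!: sum_le_suminf)
  have "nsq (\<lambda>z. f z + g z) \<le> (sqrt (nsq f) + sqrt (nsq g))\<^sup>2"
    unfolding nsq_def[of "\<lambda>z. f z + g z"]
  proof (rule suminf_le_const)
    show "summable (\<lambda>n. (cmod (coef (\<lambda>z. f z + g z) n))\<^sup>2)"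
      using hardy_add[OF f g] by (simp add: hardy_def)
    fix N
    have "L2_set (\<lambda>n. cmod (coef f n + coef g n)) {..<N} \<le> L2_set (\<lambda>n. cmod (coef f n) + cmod (coef g n)) {..<N}"
      by (intro L2_set_mono norm_triangle_ineq) auto
    also have "\<dots> \<le> L2_set (\<lambda>n. cmod (coef f n)) {..<N} + L2_set (\<lambda>n. cmod (coef g n)) {..<N}"
      by (rule L2_set_triangle_ineq)
    also have "\<dots> \<le> sqrt (nsq f) + sqrt (nsq g)"
      unfolding L2_set_def using sf sg by (intro add_mono) auto
    finally have "(L2_set (\<lambda>n. cmod (coef f n + coef g n)) {..<N})\<^sup>2 \<le> (sqrt (nsq f) + sqrt (nsq g))\<^sup>2"
      by (intro power_mono) (auto simp: L2_set_nonneg)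
    then show "(\<Sum>n<N. (cmod (coef (\<lambda>z. f z + g z) n))\<^sup>2) \<le> (sqrt (nsq f) + sqrt (nsq g))\<^sup>2"
      by (simp add: L2_set_def coef_add hardy_holo f g sum_nonneg)
  qed
  then show ?thesis
    using f g hardy_add[OF f g] nsq_nonneg[OF f] nsq_nonneg[OF g]
    by (simp add: h2_norm_eq real_le_lsqrt)
qed

lemma h2_norm_cmult:
  assumes "hardy f"
  shows "h2_norm (\<lambda>z. c * f z) = cmod c * h2_norm f"
proof -
  have "nsq (\<lambda>z. c * f z) = (cmod c)\<^sup>2 * nsq f"
    using assms by (simp add: nsq_def hardy_def coef_cmult norm_mult power_mult_distrib suminf_mult)
  then show ?thesis
    using assms by (simp add: h2_norm_eq hardy_cmult real_sqrt_mult)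
qed

lemma h2_norm_cong:
  assumes "\<And>z. norm z < 1 \<Longrightarrow> f z = f' z" "hardy f"
  shows "h2_norm f = h2_norm f'"
  using h2_inner_cong[OF assms assms] by (simp add: h2_norm_def)

lemma h2_cauchy_schwarz:
  assumes f: "hardy f" and g: "hardy g"
  shows "cmod (h2_inner f g) \<le> h2_norm f * h2_norm g"
proof -
  have sf: "(\<Sum>n<N. (cmod (coef f n))\<^sup>2) \<le> nsq f" and sg: "(\<Sum>n<N. (cmod (coef g n))\<^sup>2) \<le> nsq g" for N
    using f g unfolding nsq_def hardy_def by (auto intro!: sum_le_suminf)
  have "cmod (\<Sum>n<N. coef f n * cnj (coef g n)) \<le> h2_norm f * h2_norm g" for N
  proof -
    have "cmod (\<Sum>n<N. coef f n * cnj (coef g n)) \<le> (\<Sum>n<N. \<bar>cmod (coef f n)\<bar> * \<bar>cmod (coef g n)\<bar>)"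
      by (rule sum_norm_le) (simp add: norm_mult)
    also have "\<dots> \<le> L2_set (\<lambda>n. cmod (coef f n)) {..<N} * L2_set (\<lambda>n. cmod (coef g n)) {..<N}"
      by (rule L2_set_mult_ineq)
    also have "\<dots> \<le> sqrt (nsq f) * sqrt (nsq g)"
      unfolding L2_set_def using sf sg by (intro mult_mono) (auto intro!: sum_nonneg nsq_nonneg f)
    finally show ?thesis by (simp add: h2_norm_eq f g)
  qed
  moreover have "(\<lambda>N. cmod (\<Sum>n<N. coef f n * cnj (coef g n))) \<longlonglongrightarrow> cmod (h2_inner f g)"
    using h2_inner_sums[OF f g] unfolding sums_def by (rule tendsto_norm)
  ultimately show ?thesis
    by (intro tendsto_upperbound) auto
qed

section \<open>Taylor truncations\<close>

definition taylor :: "(complex \<Rightarrow> complex) \<Rightarrow> nat \<Rightarrow> complex \<Rightarrow> complex" where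
  "taylor f N z = (\<Sum>n<N. coef f n * z ^ n)"

lemma taylor_holo: "taylor f N holomorphic_on S"
  unfolding taylor_def by (intro holomorphic_intros)

lemma taylor_bound:
  assumes "norm z < 1"
  shows "norm (taylor f N z) \<le> (\<Sum>n<N. norm (coef f n))"
  unfolding taylor_def
  by (rule sum_norm_le) (use assms in \<open>auto simp: norm_mult norm_power intro!: mult_left_le power_le_one\<close>)

lemma hardy_taylor: "hardy (taylor f N)"
  by (rule hardy_bounded[OF taylor_holo taylor_bound])

lemma coef_sum:
  assumes "\<And>i. i \<in> A \<Longrightarrow> f i holomorphic_on ball 0 1"
  shows "coef (\<lambda>z. \<Sum>i\<in>A. f i z) n = (\<Sum>i\<in>A. coef (f i) n)"
  using assms
proof (induction A rule: infinite_finite_induct)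
  case (insert x A)
  then show ?case by (simp add: coef_add holomorphic_intros)
qed (auto simp: coef_const)

lemma coef_taylor: "coef (taylor f N) n = (if n < N then coef f n else 0)"
proof -
  have "coef (taylor f N) n = (\<Sum>i<N. coef (\<lambda>z. coef f i * z ^ i) n)"
    unfolding taylor_def[abs_def] by (intro coef_sum holomorphic_intros)
  also have "\<dots> = (\<Sum>i<N. if n = i then coef f i else 0)"
    by (intro sum.cong refl) (auto simp: coef_cmult coef_power holomorphic_intros)
  finally show ?thesis by simp
qed

text \<open>The squared norm of the remainder is a tail of a convergent series.\<close>

lemma taylor_tendsto:
  assumes f: "hardy f"
  shows "(\<lambda>N. h2_norm (\<lambda>z. f z - taylor f N z)) \<longlonglongrightarrow> 0"
proof -
  have h: "hardy (\<lambda>z. f z - taylor f N z)" for N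
    using hardy_add[OF f hardy_cmult[OF hardy_taylor, of "-1"]] by simp
  have "coef (\<lambda>z. f z - taylor f N z) n = (if n < N then 0 else coef f n)" for n N
    using coef_add[of f "\<lambda>z. -1 * taylor f N z" n] coef_cmult[OF taylor_holo, of "-1" f N n]
      hardy_holo[OF f] taylor_holo
    by (auto simp: coef_taylor holomorphic_intros)
  then have "nsq (\<lambda>z. f z - taylor f N z) = (\<Sum>n. if n < N then 0 else (cmod (coef f n))\<^sup>2)" for N
    unfolding nsq_def by (auto intro!: suminf_cong)
  also have "(\<Sum>n. if n < N then 0 else (cmod (coef f n))\<^sup>2) = (\<Sum>n. (cmod (coef f (n + N)))\<^sup>2)" for N
  proof -
    have "summable (\<lambda>n. if n < N then 0 else (cmod (coef f n))\<^sup>2)"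
      by (rule summable_comparison_test'[of "\<lambda>n. (cmod (coef f n))\<^sup>2"]) (use f in \<open>auto simp: hardy_def\<close>)
    from suminf_minus_initial_segment[OF this, of N] show ?thesis by simp
  qed
  finally have "nsq (\<lambda>z. f z - taylor f N z) = (\<Sum>n. (cmod (coef f (n + N)))\<^sup>2)" for N .
  moreover have "(\<lambda>N. \<Sum>n. (cmod (coef f (n + N)))\<^sup>2) \<longlonglongrightarrow> 0"
    using f by (intro suminf_exist_split2) (auto simp: hardy_def)
  ultimately have "(\<lambda>N. sqrt (nsq (\<lambda>z. f z - taylor f N z))) \<longlonglongrightarrow> sqrt 0"
    by (intro tendsto_real_sqrt) simp
  then show ?thesis by (simp add: h2_norm_eq h)
qed

text \<open>Split g = u + w with u a Taylor polynomial. Since u is bounded, its contribution is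
  controlled by the mean of d, which vanishes in the limit; the contribution of w is at most 2 C
  times its squared norm, uniformly in r.\<close>

lemma uniformly_integrable_dilates:
  assumes g: "hardy g"
    and c: "\<And>r. 0 < r \<Longrightarrow> r < 1 \<Longrightarrow> continuous_on UNIV (d r)"
    and b: "\<And>r t. 0 < r \<Longrightarrow> r < 1 \<Longrightarrow> 0 \<le> d r t \<and> d r t \<le> C"
    and lim: "((\<lambda>r. LINT t|angle_measure. d r t) \<longlongrightarrow> 0) (at_left 1)"
  shows "((\<lambda>r. LINT t|angle_measure. (cmod (g (of_real r * cis t)))\<^sup>2 * d r t) \<longlongrightarrow> 0) (at_left 1)"
proof (rule tendstoI)
  fix e :: real assume e: "e > 0"
  have C: "C \<ge> 0" using b[of "1/2" 0] by auto
  \<comment> \<open>Chosen so that the contribution of w costs at most e / 2; C + 1 keeps the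
    quotient meaningful when C = 0.\<close>
  define e' where "e' = sqrt (e / (4 * (C + 1)))"
  have e': "e' > 0" "2 * C * e'\<^sup>2 \<le> e / 2"
    using e C by (auto simp: e'_def field_simps)
  have "eventually (\<lambda>N. h2_norm (\<lambda>z. g z - taylor g N z) < e') sequentially"
    by (rule order_tendstoD(2)[OF taylor_tendsto[OF g]]) (use e' in auto)
  then obtain N where N: "h2_norm (\<lambda>z. g z - taylor g N z) < e'"
    by (auto simp: eventually_sequentially)
  define u where "u = taylor g N"
  define w where "w = (\<lambda>z. g z - u z)"
  define B where "B = (\<Sum>n<N. norm (coef g n))"
  have hw: "hardy w"
    using hardy_add[OF g hardy_cmult[OF hardy_taylor, of "-1" g N]] by (simp add: w_def u_def)
  have "sqrt (nsq w) \<le> e'"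
    using N h2_norm_eq[OF hw] by (simp add: w_def u_def)
  then have w: "nsq w \<le> e'\<^sup>2"
    using e' by (simp add: real_sqrt_le_iff sqrt_le_D)
  have main: "(LINT t|angle_measure. (cmod (g (of_real r * cis t)))\<^sup>2 * d r t) \<le> 2 * B\<^sup>2 * (LINT t|angle_measure. d r t) + e / 2"
    if r: "0 < r" "r < 1" for r
  proof -
    have cont: "continuous_on UNIV (\<lambda>t. g (of_real r * cis t))" "continuous_on UNIV (\<lambda>t. w (of_real r * cis t))"
      using r by (auto intro!: circle_continuous hardy_holo g hw)
    have "(LINT t|angle_measure. (cmod (g (of_real r * cis t)))\<^sup>2 * d r t)
        \<le> (LINT t|angle_measure. 2 * B\<^sup>2 * d r t + 2 * C * (cmod (w (of_real r * cis t)))\<^sup>2)"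
    proof (rule integral_angle_mono)
      fix t
      let ?z = "of_real r * cis t"
      have "norm ?z < 1" using r by (simp add: norm_mult)
      then have u: "norm (u ?z) \<le> B"
        unfolding u_def B_def by (rule taylor_bound)
      have "g ?z = u ?z + w ?z" by (simp add: w_def)
      then have "(cmod (g ?z))\<^sup>2 \<le> (cmod (u ?z) + cmod (w ?z))\<^sup>2"
        by (metis norm_ge_zero norm_triangle_ineq power_mono)
      also have "\<dots> \<le> 2 * (cmod (u ?z))\<^sup>2 + 2 * (cmod (w ?z))\<^sup>2"
        using sum_squares_bound[of "cmod (u ?z)" "cmod (w ?z)"] by (simp add: power2_sum)
      also have "\<dots> \<le> 2 * B\<^sup>2 + 2 * (cmod (w ?z))\<^sup>2"
        using u by (auto intro!: power_mono)
      finally have "(cmod (g ?z))\<^sup>2 * d r t \<le> (2 * B\<^sup>2 + 2 * (cmod (w ?z))\<^sup>2) * d r t"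
        using b[OF r] by (intro mult_right_mono) auto
      also have "\<dots> = 2 * B\<^sup>2 * d r t + 2 * (cmod (w ?z))\<^sup>2 * d r t"
        by (simp add: algebra_simps)
      also have "2 * (cmod (w ?z))\<^sup>2 * d r t \<le> 2 * (cmod (w ?z))\<^sup>2 * C"
        using b[OF r] by (intro mult_left_mono) auto
      finally show "(cmod (g ?z))\<^sup>2 * d r t \<le> 2 * B\<^sup>2 * d r t + 2 * C * (cmod (w ?z))\<^sup>2"
        by (simp add: mult_ac)
    qed (auto intro!: continuous_intros cont c r)
    also have "\<dots> = 2 * B\<^sup>2 * (LINT t|angle_measure. d r t) + 2 * C * mean2 w r"
      unfolding mean2_def
      by (subst Bochner_Integration.integral_add) (auto intro!: integral_angle(1) continuous_intros cont c r)
    also have "2 * C * mean2 w r \<le> 2 * C * e'\<^sup>2"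
      using mean2_le_nsq[OF hw, of r] r w C by (intro mult_left_mono) auto
    finally show ?thesis using e' by simp
  qed
  have "((\<lambda>r. 2 * B\<^sup>2 * (LINT t|angle_measure. d r t) + e / 2) \<longlongrightarrow> 2 * B\<^sup>2 * 0 + e / 2) (at_left 1)"
    by (intro tendsto_intros lim)
  then have "eventually (\<lambda>r. 2 * B\<^sup>2 * (LINT t|angle_measure. d r t) + e / 2 < e) (at_left 1)"
    by (rule order_tendstoD) (use e in auto)
  moreover have "eventually (\<lambda>r::real. 0 < r \<and> r < 1) (at_left 1)"
    by (rule eventually_at_left_1) auto
  ultimately show "\<forall>\<^sub>F r in at_left 1. dist (LINT t|angle_measure. (cmod (g (of_real r * cis t)))\<^sup>2 * d r t) 0 < e"
  proof eventually_elim
    case (elim r)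
    have "0 \<le> (LINT t|angle_measure. (cmod (g (of_real r * cis t)))\<^sup>2 * d r t)"
      using b elim by (intro integral_nonneg_AE AE_I2) auto
    then show ?case using main[of r] elim by simp
  qed
qed

section \<open>Cauchy and Poisson integrals of a singular measure\<close>

lemma borel_measurable_cnj [measurable]: "cnj \<in> borel_measurable borel"
  by (intro borel_measurable_continuous_onI continuous_intros)

locale clark =
  fixes \<mu> :: "complex measure"
  assumes mu_borel [measurable_cong]: "sets \<mu> = sets borel"
    and mu_on_circle: "emeasure \<mu> (UNIV - sphere 0 1) = 0"
    and mu_prob: "emeasure \<mu> (sphere 0 1) = 1"
    and mu_singular: "\<exists>A \<in> sets borel. emeasure circle_m A = 0 \<and> emeasure \<mu> (UNIV - A) = 0"
begin

lemma space_mu [simp]: "space \<mu> = UNIV"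
  using sets_eq_imp_space_eq[OF mu_borel] by simp

lemma AE_circle: "AE \<zeta> in \<mu>. norm \<zeta> = 1"
proof (rule AE_I[of _ _ "UNIV - sphere 0 1"])
  show "UNIV - sphere 0 1 \<in> sets \<mu>"
    unfolding mu_borel by (intro sets.Diff borel_closed closed_sphere) auto
qed (auto simp: mu_on_circle)

lemma AE_circleI: "(\<And>\<zeta>. norm \<zeta> = 1 \<Longrightarrow> P \<zeta>) \<Longrightarrow> AE \<zeta> in \<mu>. P \<zeta>"
  using AE_circle by eventually_elim

lemma emeasure_mu_UNIV: "emeasure \<mu> UNIV = 1"
proof -
  have "emeasure \<mu> UNIV = emeasure \<mu> (sphere 0 1)"
    by (rule emeasure_eq_AE) (use AE_circle in \<open>auto simp: mu_borel intro: borel_closed\<close>)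
  then show ?thesis by (simp add: mu_prob)
qed

sublocale finite_measure \<mu>
  by standard (simp add: emeasure_mu_UNIV)

lemma measure_mu_UNIV [simp]: "measure \<mu> UNIV = 1"
  by (simp add: measure_def emeasure_mu_UNIV)

text \<open>Boundedness is asked only on the circle, which carries \<mu>. Thus trigonometric
  polynomials qualify although they are written with \<open>\<zeta>\<close> and
  \<open>cnj \<zeta>\<close> on the whole plane, where they are unbounded.\<close>

definition bdm :: "(complex \<Rightarrow> complex) \<Rightarrow> bool" where
  "bdm \<gamma> \<longleftrightarrow> \<gamma> \<in> borel_measurable borel \<and> (\<exists>B. \<forall>\<zeta>. norm \<zeta> = 1 \<longrightarrow> norm (\<gamma> \<zeta>) \<le> B)"

lemma bdm_measurable [measurable_dest]: "bdm \<gamma> \<Longrightarrow> \<gamma> \<in> borel_measurable borel"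
  by (simp add: bdm_def)

lemma bdmE:
  assumes "bdm \<gamma>"
  obtains B where "B \<ge> 0" "\<And>\<zeta>. norm \<zeta> = 1 \<Longrightarrow> norm (\<gamma> \<zeta>) \<le> B"
proof -
  from assms obtain B where B: "\<And>\<zeta>. norm \<zeta> = 1 \<Longrightarrow> norm (\<gamma> \<zeta>) \<le> B"
    by (auto simp: bdm_def)
  have "0 \<le> B" using B[of 1] by (metis norm_ge_zero norm_one order_trans)
  then show ?thesis using B that by blast
qed

lemma bdm_integrable:
  assumes "bdm \<gamma>"
  shows "integrable \<mu> \<gamma>"
proof -
  from bdmE[OF assms] obtain B where "\<And>\<zeta>. norm \<zeta> = 1 \<Longrightarrow> norm (\<gamma> \<zeta>) \<le> B" by metis
  then show ?thesis
    by (intro integrable_const_bound[of _ B] AE_circleI) (use assms in \<open>auto simp: bdm_measurable\<close>)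
qed

lemma bdm_continuous:
  assumes "continuous_on UNIV \<gamma>"
  shows "bdm \<gamma>"
proof -
  have "compact (\<gamma> ` sphere 0 1)"
    by (intro compact_continuous_image continuous_on_subset[OF assms]) auto
  then have "\<exists>B. \<forall>\<zeta>. norm \<zeta> = 1 \<longrightarrow> norm (\<gamma> \<zeta>) \<le> B"
    by (force dest!: compact_imp_bounded simp: bounded_iff)
  then show ?thesis
    using assms by (simp add: bdm_def borel_measurable_continuous_onI)
qed

lemma bdm_mult:
  assumes "bdm \<gamma>" "bdm \<delta>"
  shows "bdm (\<lambda>\<zeta>. \<gamma> \<zeta> * \<delta> \<zeta>)"
proof -
  obtain B where B: "B \<ge> 0" "\<And>\<zeta>. norm \<zeta> = 1 \<Longrightarrow> norm (\<gamma> \<zeta>) \<le> B" using bdmE[OF assms(1)] by metis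
  obtain C where C: "C \<ge> 0" "\<And>\<zeta>. norm \<zeta> = 1 \<Longrightarrow> norm (\<delta> \<zeta>) \<le> C" using bdmE[OF assms(2)] by metis
  have "norm \<zeta> = 1 \<longrightarrow> norm (\<gamma> \<zeta> * \<delta> \<zeta>) \<le> B * C" for \<zeta>
    using B C by (auto simp: norm_mult intro!: mult_mono)
  then show ?thesis
    using assms by (auto simp: bdm_def)
qed

lemma bdm_add:
  assumes "bdm \<gamma>" "bdm \<delta>"
  shows "bdm (\<lambda>\<zeta>. \<gamma> \<zeta> + \<delta> \<zeta>)"
proof -
  obtain B where B: "B \<ge> 0" "\<And>\<zeta>. norm \<zeta> = 1 \<Longrightarrow> norm (\<gamma> \<zeta>) \<le> B" using bdmE[OF assms(1)] by metis
  obtain C where C: "C \<ge> 0" "\<And>\<zeta>. norm \<zeta> = 1 \<Longrightarrow> norm (\<delta> \<zeta>) \<le> C" using bdmE[OF assms(2)] by metis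
  have "norm \<zeta> = 1 \<longrightarrow> norm (\<gamma> \<zeta> + \<delta> \<zeta>) \<le> B + C" for \<zeta>
    using B(2)[of \<zeta>] C(2)[of \<zeta>] norm_triangle_ineq[of "\<gamma> \<zeta>" "\<delta> \<zeta>"] by auto
  then show ?thesis
    using assms by (auto simp: bdm_def)
qed

lemma bdm_cnj: "bdm \<gamma> \<Longrightarrow> bdm (\<lambda>\<zeta>. cnj (\<gamma> \<zeta>))"
  using measurable_compose[OF _ borel_measurable_cnj] by (auto simp: bdm_def)

definition cauchy :: "(complex \<Rightarrow> complex) \<Rightarrow> complex \<Rightarrow> complex" where
  "cauchy \<gamma> z = (LINT \<zeta>|\<mu>. \<gamma> \<zeta> / (1 - z * cnj \<zeta>))"

lemma denom_bound:
  assumes "norm \<zeta> = 1"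
  shows "1 - norm z \<le> norm (1 - z * cnj \<zeta>)"
  using norm_triangle_ineq2[of 1 "z * cnj \<zeta>"] assms by (simp add: norm_mult)

lemma denom_nz: "norm \<zeta> = 1 \<Longrightarrow> norm z < 1 \<Longrightarrow> 1 - z * cnj \<zeta> \<noteq> 0"
  using denom_bound[of \<zeta> z] by auto

lemma bdm_kernel:
  assumes "bdm \<gamma>" "norm z < 1"
  shows "bdm (\<lambda>\<zeta>. \<gamma> \<zeta> / (1 - z * cnj \<zeta>))"
proof -
  obtain B where B: "B \<ge> 0" "\<And>\<zeta>. norm \<zeta> = 1 \<Longrightarrow> norm (\<gamma> \<zeta>) \<le> B" using bdmE[OF assms(1)] by metis
  have "norm \<zeta> = 1 \<longrightarrow> norm (\<gamma> \<zeta> / (1 - z * cnj \<zeta>)) \<le> B / (1 - norm z)" for \<zeta>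
    using B denom_bound[of \<zeta> z] assms by (auto simp: norm_divide intro!: frac_le)
  then show ?thesis
    using assms by (auto simp: bdm_def)
qed

lemmas kernel_integrable = bdm_integrable[OF bdm_kernel]

text \<open>The kernel is expanded geometrically: the Taylor coefficients of a Cauchy integral are
  moments against the powers of \<open>cnj \<zeta>\<close>. Holomorphy follows from the expansion as
  well.\<close>

lemma cauchy_sums:
  assumes \<gamma>: "bdm \<gamma>" and z: "norm z < 1"
  shows "(\<lambda>n. (LINT \<zeta>|\<mu>. \<gamma> \<zeta> * cnj \<zeta> ^ n) * z ^ n) sums cauchy \<gamma> z"
proof -
  obtain B where B: "B \<ge> 0" "\<And>\<zeta>. norm \<zeta> = 1 \<Longrightarrow> norm (\<gamma> \<zeta>) \<le> B" using bdmE[OF \<gamma>] by metis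
  note [measurable] = bdm_measurable[OF \<gamma>]
  let ?f = "\<lambda>n \<zeta>. \<gamma> \<zeta> * cnj \<zeta> ^ n * z ^ n"
  have bd: "norm (?f n \<zeta>) \<le> B * norm z ^ n" if "norm \<zeta> = 1" for n \<zeta>
    using B that by (auto simp: norm_mult norm_power intro!: mult_right_mono)
  have geo: "summable (\<lambda>n. B * norm z ^ n)"
    using z by (intro summable_mult summable_geometric) auto
  have int: "integrable \<mu> (?f n)" for n
  proof -
    have "bdm (\<lambda>\<zeta>. cnj \<zeta> ^ n * z ^ n)"
      by (intro bdm_continuous continuous_intros)
    from bdm_integrable[OF bdm_mult[OF \<gamma> this]] show ?thesis
      by (simp only: mult.assoc)
  qed
  have "(\<lambda>n. LINT \<zeta>|\<mu>. ?f n \<zeta>) sums (LINT \<zeta>|\<mu>. (\<Sum>n. ?f n \<zeta>))"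
  proof (rule sums_integral[OF int])
    show "AE \<zeta> in \<mu>. summable (\<lambda>n. norm (?f n \<zeta>))"
      using AE_circle
    proof eventually_elim
      case (elim \<zeta>)
      show ?case by (rule summable_comparison_test'[OF geo]) (use bd[OF elim] in auto)
    qed
    show "summable (\<lambda>n. LINT \<zeta>|\<mu>. norm (?f n \<zeta>))"
    proof (rule summable_comparison_test'[OF geo])
      fix n
      have "(LINT \<zeta>|\<mu>. norm (?f n \<zeta>)) \<le> (LINT \<zeta>|\<mu>. B * norm z ^ n)"
        by (intro integral_mono_AE integrable_norm int AE_circleI) (use bd in auto)
      then show "norm (LINT \<zeta>|\<mu>. norm (?f n \<zeta>)) \<le> B * norm z ^ n"
        by simp
    qed
  qed
  moreover have "(LINT \<zeta>|\<mu>. (\<Sum>n. ?f n \<zeta>)) = cauchy \<gamma> z"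
    unfolding cauchy_def
  proof (rule integral_cong_AE)
    show "AE \<zeta> in \<mu>. (\<Sum>n. ?f n \<zeta>) = \<gamma> \<zeta> / (1 - z * cnj \<zeta>)"
      using AE_circle
    proof eventually_elim
      case (elim \<zeta>)
      have "(\<lambda>n. \<gamma> \<zeta> * (z * cnj \<zeta>) ^ n) sums (\<gamma> \<zeta> * (1 / (1 - z * cnj \<zeta>)))"
        by (intro sums_mult geometric_sums) (use z elim in \<open>auto simp: norm_mult\<close>)
      then show ?case
        by (simp add: sums_iff power_mult_distrib mult_ac)
    qed
  qed measurable
  ultimately show ?thesis by simp
qed

lemma cauchy_holo: "bdm \<gamma> \<Longrightarrow> cauchy \<gamma> holomorphic_on ball 0 1"
  by (rule power_series_holomorphic[where a = "\<lambda>n. LINT \<zeta>|\<mu>. \<gamma> \<zeta> * cnj \<zeta> ^ n"])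
     (use cauchy_sums[of \<gamma>] in auto)

lemma coef_cauchy: "bdm \<gamma> \<Longrightarrow> coef (cauchy \<gamma>) n = (LINT \<zeta>|\<mu>. \<gamma> \<zeta> * cnj \<zeta> ^ n)"
  by (rule coef_unique) (rule cauchy_sums)

lemma cauchy_bound:
  assumes "\<And>\<zeta>. norm \<zeta> = 1 \<Longrightarrow> norm (\<gamma> \<zeta>) \<le> B" "bdm \<gamma>" "norm z < 1"
  shows "norm (cauchy \<gamma> z) \<le> B / (1 - norm z)"
proof -
  have "B \<ge> 0" using assms(1)[of 1] by (metis norm_ge_zero norm_one order_trans)
  have "norm (cauchy \<gamma> z) \<le> (LINT \<zeta>|\<mu>. norm (\<gamma> \<zeta> / (1 - z * cnj \<zeta>)))"
    unfolding cauchy_def by (rule integral_norm_bound)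
  also have "\<dots> \<le> (LINT \<zeta>|\<mu>. B / (1 - norm z))"
  proof (intro integral_mono_AE integrable_norm kernel_integrable assms AE_circleI)
    fix \<zeta> :: complex assume "norm \<zeta> = 1"
    then show "norm (\<gamma> \<zeta> / (1 - z * cnj \<zeta>)) \<le> B / (1 - norm z)"
      using denom_bound[of \<zeta> z] assms(3) assms(1)[of \<zeta>] \<open>B \<ge> 0\<close> by (auto simp: norm_divide intro!: frac_le)
  qed auto
  finally show ?thesis by simp
qed

section \<open>The Poisson kernel and the Poisson integral of \<mu>\<close>

definition pk :: "complex \<Rightarrow> complex \<Rightarrow> real" where
  "pk z \<zeta> = (1 - (norm z)\<^sup>2) / (norm (1 - z * cnj \<zeta>))\<^sup>2"

definition pois :: "complex \<Rightarrow> real" where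
  "pois z = (LINT \<zeta>|\<mu>. pk z \<zeta>)"

lemma pk_nonneg: "norm z < 1 \<Longrightarrow> 0 \<le> pk z \<zeta>"
  by (auto simp: pk_def power_le_one intro!: divide_nonneg_nonneg)

text \<open>With w = z \<open>cnj \<zeta>\<close>, the kernel is the real part of (1 + w) / (1 - w)
  = 2 / (1 - w) - 1. Integration then expresses the Poisson integral of \<mu> by the Cauchy integral
  of 1.\<close>

lemma pk_Re:
  assumes "norm \<zeta> = 1" "norm z < 1"
  shows "pk z \<zeta> = 2 * Re (1 / (1 - z * cnj \<zeta>)) - 1"
proof -
  define w where "w = z * cnj \<zeta>"
  have "norm w = norm z" using assms by (simp add: w_def norm_mult)
  moreover have "w \<noteq> 1" using denom_nz[OF assms] by (auto simp: w_def)
  then have "(1 - (norm w)\<^sup>2) / (norm (1 - w))\<^sup>2 = 2 * Re (1 / (1 - w)) - 1"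
    by (auto simp: Re_divide cmod_power2 complex_eq_iff divide_simps)
       (auto simp: power2_eq_square algebra_simps)
  ultimately show ?thesis by (simp add: pk_def w_def)
qed

lemma pk_measurable [measurable]: "pk z \<in> borel_measurable borel"
  unfolding pk_def by measurable

lemma pk_integrable:
  assumes "norm z < 1"
  shows "integrable \<mu> (pk z)"
proof (rule Bochner_Integration.integrable_bound)
  show "integrable \<mu> (\<lambda>\<zeta>. 2 * Re (1 / (1 - z * cnj \<zeta>)) - 1)"
    using kernel_integrable[of "\<lambda>_. 1" z] assms
    by (intro Bochner_Integration.integrable_diff integrable_mult_right integrable_Re)
       (auto simp: bdm_continuous)
  show "AE \<zeta> in \<mu>. norm (pk z \<zeta>) \<le> norm (2 * Re (1 / (1 - z * cnj \<zeta>)) - 1)"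
    using AE_circle by eventually_elim (simp add: pk_Re assms)
qed measurable

abbreviation "\<Phi> \<equiv> cauchy (\<lambda>_. 1)"

lemma bdm_const [simp]: "bdm (\<lambda>_. c)"
  by (simp add: bdm_continuous)

lemma pois_eq:
  assumes "norm z < 1"
  shows "pois z = 2 * Re (\<Phi> z) - 1"
proof -
  have "pois z = (LINT \<zeta>|\<mu>. 2 * Re (1 / (1 - z * cnj \<zeta>)) - 1)"
    unfolding pois_def
    by (intro integral_cong_AE AE_circleI) (auto simp: pk_Re assms)
  also have "\<dots> = 2 * Re (\<Phi> z) - 1"
    using kernel_integrable[of "\<lambda>_. 1" z] assms
    by (subst Bochner_Integration.integral_diff) (auto simp: cauchy_def)
  finally show ?thesis .
qed

lemma pois_nonneg: "norm z < 1 \<Longrightarrow> 0 \<le> pois z"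
  by (auto simp: pois_def pk_nonneg)

lemma pois_continuous:
  assumes "0 \<le> r" "r < 1"
  shows "continuous_on UNIV (\<lambda>t. pois (of_real r * cis t))"
proof -
  have "continuous_on UNIV (\<lambda>t. 2 * Re (\<Phi> (of_real r * cis t)) - 1)"
    using circle_continuous[OF cauchy_holo[OF bdm_const] assms] by (intro continuous_intros)
  then show ?thesis
    using assms by (subst pois_eq) (auto simp: norm_mult)
qed

text \<open>On the circle, \<open>cnj \<zeta> / (1 - z * cnj \<zeta>) + cnj z / (1 - cnj z *
  \<zeta>)\<close> equals \<open>cnj \<zeta>\<close> times the Poisson kernel. The sum inside the
  norm is therefore the Poisson integral of the reflected density.\<close>

lemma cauchy_reflect:
  assumes \<gamma>: "bdm \<gamma>" and B: "\<And>\<zeta>. norm \<zeta> = 1 \<Longrightarrow> norm (\<gamma> \<zeta>) \<le> B" and z: "norm z < 1"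
  shows "norm (cauchy (\<lambda>\<zeta>. cnj \<zeta> * cnj (\<gamma> \<zeta>)) z + cnj z * cnj (cauchy \<gamma> z)) \<le> B * pois z"
proof -
  note [measurable] = bdm_measurable[OF \<gamma>]
  have b': "bdm (\<lambda>\<zeta>. cnj \<zeta> * cnj (\<gamma> \<zeta>))"
    using bdm_cnj[OF bdm_mult[OF bdm_continuous[OF continuous_on_id] \<gamma>]] by simp
  have i1: "integrable \<mu> (\<lambda>\<zeta>. cnj \<zeta> * cnj (\<gamma> \<zeta>) / (1 - z * cnj \<zeta>))"
    by (rule kernel_integrable[OF b' z])
  have i2: "integrable \<mu> (\<lambda>\<zeta>. cnj z * cnj (\<gamma> \<zeta> / (1 - z * cnj \<zeta>)))"
    using kernel_integrable[OF \<gamma> z] by (intro integrable_mult_right integrable_cnj)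
  let ?h = "\<lambda>\<zeta>. cnj \<zeta> * cnj (\<gamma> \<zeta>) / (1 - z * cnj \<zeta>) + cnj z * cnj (\<gamma> \<zeta> / (1 - z * cnj \<zeta>))"
  have h: "norm (?h \<zeta>) \<le> B * pk z \<zeta>" if \<zeta>: "norm \<zeta> = 1" for \<zeta>
  proof -
    define D where "D = 1 - z * cnj \<zeta>"
    have D: "D \<noteq> 0" using denom_nz[OF \<zeta> z] by (simp add: D_def)
    have u: "\<zeta> * cnj \<zeta> = 1" using \<zeta> by (simp add: complex_norm_square[symmetric])
    \<comment> \<open>In the expansion two terms cancel because \<open>\<zeta> * cnj \<zeta>\<close>
      is 1; what is left carries 1 - |z|^2, the numerator of the kernel.\<close>
    have n: "cnj \<zeta> * cnj D + cnj z * D = cnj \<zeta> * of_real (1 - (norm z)\<^sup>2)"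
    proof -
      have "cnj \<zeta> * cnj D + cnj z * D = cnj \<zeta> - cnj z * (\<zeta> * cnj \<zeta>) + cnj z - (z * cnj z) * cnj \<zeta>"
        by (simp add: D_def ring_distribs mult_ac)
      moreover have "complex_of_real (1 - (norm z)\<^sup>2) = 1 - z * cnj z"
        by (simp only: of_real_diff of_real_1 complex_norm_square)
      ultimately show ?thesis
        unfolding u by (simp add: ring_distribs mult_ac)
    qed
    have "?h \<zeta> = cnj (\<gamma> \<zeta>) * (cnj \<zeta> * cnj D + cnj z * D) / (D * cnj D)"
      using D unfolding D_def[symmetric] by (simp add: divide_simps ring_distribs mult_ac)
    also have "\<dots> = cnj (\<gamma> \<zeta>) * cnj \<zeta> * of_real (pk z \<zeta>)"
      unfolding n complex_norm_square[symmetric] by (simp add: pk_def D_def)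
    finally have "norm (?h \<zeta>) = norm (\<gamma> \<zeta>) * pk z \<zeta>"
      using \<zeta> pk_nonneg[OF z, of \<zeta>] by (simp add: norm_mult)
    then show ?thesis
      using B[OF \<zeta>] pk_nonneg[OF z, of \<zeta>] by (auto intro!: mult_right_mono)
  qed
  have I: "integrable \<mu> ?h"
    by (rule Bochner_Integration.integrable_add[OF i1 i2])
  have "cauchy (\<lambda>\<zeta>. cnj \<zeta> * cnj (\<gamma> \<zeta>)) z + cnj z * cnj (cauchy \<gamma> z) = (LINT \<zeta>|\<mu>. ?h \<zeta>)"
    using i1 i2 by (simp add: cauchy_def del: complex_cnj_divide)
  then have "norm (cauchy (\<lambda>\<zeta>. cnj \<zeta> * cnj (\<gamma> \<zeta>)) z + cnj z * cnj (cauchy \<gamma> z)) \<le> (LINT \<zeta>|\<mu>. norm (?h \<zeta>))"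
    using integral_norm_bound[of \<mu> ?h] by (simp only:)
  also have "(LINT \<zeta>|\<mu>. norm (?h \<zeta>)) \<le> (LINT \<zeta>|\<mu>. B * pk z \<zeta>)"
  proof (rule integral_mono_AE)
    show "AE \<zeta> in \<mu>. norm (?h \<zeta>) \<le> B * pk z \<zeta>"
      by (rule AE_circleI) (rule h)
  qed (use I pk_integrable[OF z] in \<open>auto simp del: complex_cnj_divide\<close>)
  finally show ?thesis by (simp add: pois_def)
qed

text \<open>The kernel is (1 - r^2) |f|^2 for a geometric series f whose coefficients all have
  modulus 1, and Parseval gives |f|^2 the mean 1 / (1 - r^2). The nonnegative integral is the form
  in which the order of integration will be exchanged.\<close>

lemma pk_mean:
  assumes "norm \<zeta> = 1" "0 \<le> r" "r < 1"
  shows "(\<integral>\<^sup>+ t. ennreal (pk (of_real r * cis t) \<zeta>) \<partial>angle_measure) = 1"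
proof -
  define f where "f = (\<lambda>z. 1 / (1 - z * cnj \<zeta>))"
  have s: "(\<lambda>n. cnj \<zeta> ^ n * z ^ n) sums f z" if "norm z < 1" for z
    using geometric_sums[of "z * cnj \<zeta>"] that assms
    by (simp add: f_def norm_mult power_mult_distrib mult.commute[of z])
  have hf: "f holomorphic_on ball 0 1"
    by (rule power_series_holomorphic[where a = "\<lambda>n. cnj \<zeta> ^ n"]) (use s in auto)
  have r2: "r\<^sup>2 < 1" using assms by (simp add: power_less_one_iff abs_square_less_1)
  have "(\<lambda>n. (r\<^sup>2) ^ n) sums mean2 f r"
    using mean2_sums[OF hf assms(2,3)] assms(1) by (simp add: coef_unique[OF s] norm_power power_mult)
  moreover have "(\<lambda>n. (r\<^sup>2) ^ n) sums (1 / (1 - r\<^sup>2))"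
    using r2 by (intro geometric_sums) auto
  ultimately have m: "mean2 f r = 1 / (1 - r\<^sup>2)"
    by (rule sums_unique2)
  have pk: "pk (of_real r * cis t) \<zeta> = (1 - r\<^sup>2) * (cmod (f (of_real r * cis t)))\<^sup>2" for t
    using assms by (simp add: pk_def f_def norm_mult norm_divide power_divide)
  have "(\<integral>\<^sup>+ t. ennreal (pk (of_real r * cis t) \<zeta>) \<partial>angle_measure) = ennreal (LINT t|angle_measure. pk (of_real r * cis t) \<zeta>)"
  proof (rule nn_integral_eq_integral)
    show "integrable angle_measure (\<lambda>t. pk (of_real r * cis t) \<zeta>)"
      unfolding pk using assms by (intro integral_angle continuous_intros circle_continuous hf) auto
  qed (use assms in \<open>auto intro!: pk_nonneg simp: norm_mult\<close>)
  also have "(LINT t|angle_measure. pk (of_real r * cis t) \<zeta>) = (1 - r\<^sup>2) * mean2 f r"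
    unfolding pk mean2_def by simp
  finally show ?thesis using m r2 by simp
qed

text \<open>Since \<open>\<mu>\<close> is singular, \<open>\<mu>\<close> is carried up to \<open>e\<close> by a compact null set \<open>K\<close>,
  whose Poisson integral is small off a neighbourhood \<open>U\<close> of small measure.\<close>

lemma min_pois_tendsto_0:
  "((\<lambda>r. LINT t|angle_measure. min 1 (pois (of_real r * cis t))) \<longlongrightarrow> 0) (at_left 1)"
proof (rule tendstoI)
  fix e0 :: real assume e0: "e0 > 0"
  define e where "e = e0 / 4"
  have e: "e > 0" using e0 by (simp add: e_def)
  obtain A where A: "A \<in> sets borel" "emeasure circle_m A = 0" "emeasure \<mu> (UNIV - A) = 0"
    using mu_singular by blast
  interpret pair_sigma_finite angle_measure \<mu>
    by standard
  have A1: "emeasure \<mu> A = 1"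
  proof -
    have "emeasure \<mu> UNIV = emeasure \<mu> A"
      by (rule emeasure_eq_AE)
         (use A in \<open>auto simp: mu_borel intro!: AE_I[of _ _ "UNIV - A"] sets.Diff\<close>)
    then show ?thesis by (simp add: emeasure_mu_UNIV)
  qed
  have "1 - ennreal e < (SUP K \<in> {K. K \<subseteq> A \<and> compact K}. emeasure \<mu> K)"
    using inner_regular[OF mu_borel _ A(1)] A1 e ennreal_between[of "ennreal e" 1]
    by (simp add: emeasure_mu_UNIV)
  then obtain K0 where K0: "K0 \<subseteq> A" "compact K0" "1 - ennreal e < emeasure \<mu> K0"
    by (auto simp: less_SUP_iff)
  \<comment> \<open>Cutting down to the circle loses no mass, and the points of K then have modulus
    1, as the distance estimate for the kernel requires.\<close>
  define K where "K = K0 \<inter> sphere 0 1"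
  have K: "compact K" "K \<subseteq> A" "K \<subseteq> sphere 0 1"
    using K0 by (auto simp: K_def intro: compact_Int)
  have Kb [measurable]: "K \<in> sets borel"
    using K by (intro borel_compact)
  have K0b: "K0 \<in> sets borel"
    using K0 by (intro borel_compact)
  have "emeasure \<mu> K = emeasure \<mu> K0"
    by (rule emeasure_eq_AE) (use AE_circle K0b Kb in \<open>auto simp: K_def mu_borel\<close>)
  then have muK: "emeasure \<mu> (UNIV - K) \<le> ennreal e"
    using K0(3) e
    by (subst emeasure_Diff) (auto simp: mu_borel emeasure_mu_UNIV emeasure_eq_measure ennreal_minus_if ennreal_less_iff simp flip: ennreal_1 split: if_splits)
  have cis_m [measurable]: "cis \<in> borel_measurable borel"
    by (intro borel_measurable_continuous_onI continuous_intros)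
  have fc: "emeasure circle_m (space circle_m) \<noteq> \<infinity>"
    unfolding circle_m_angle by (subst emeasure_distr) (auto simp: emeasure_angle_UNIV)
  have "emeasure circle_m K = 0"
    using A K(2) emeasure_mono[of K A circle_m] by (auto simp: circle_m_def)
  then have "(INF U \<in> {U. K \<subseteq> U \<and> open U}. emeasure circle_m U) < ennreal e"
    using outer_regular[OF _ fc Kb] e by (simp add: circle_m_def)
  then obtain U where U: "K \<subseteq> U" "open U" "emeasure circle_m U < ennreal e"
    by (auto simp: INF_less_iff)
  have [measurable]: "U \<in> sets borel" using U by simp
  have "\<exists>d>0. \<forall>x\<in>K. \<forall>y\<in>- U. d \<le> dist x y"
    by (rule separate_compact_closed) (use K U in auto)
  then obtain d where d: "d > 0" "\<And>x y. x \<in> K \<Longrightarrow> y \<notin> U \<Longrightarrow> d \<le> dist x y"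
    by blast
  \<comment> \<open>The bound (1 - r^2) / (d / 2)^2 for the kernel when its denominator is at least
    (d / 2)^2.\<close>
  define a where "a = (\<lambda>r::real. (1 - r\<^sup>2) * (4 / d\<^sup>2))"
  \<comment> \<open>The summands come from U, from the kernel of K away from U, and from the mass
    outside K. The condition 1 - d / 2 < r keeps the dilated point within d / 2 of the circle
    point.\<close>
  have bound: "(LINT t|angle_measure. min 1 (pois (of_real r * cis t))) \<le> e + a r + e"
    if r: "0 < r" "r < 1" "1 - d / 2 < r" for r
  proof -
    have r2: "r\<^sup>2 < 1" using r by (simp add: abs_square_less_1)
    have a: "0 \<le> a r" using r2 by (auto simp: a_def)
    have zr: "norm (of_real r * cis t) < 1" for t using r by (simp add: norm_mult)
    define pt where "pt = (\<lambda>t \<zeta>. ennreal (pk (of_real r * cis t) \<zeta>))"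
    have ptm [measurable]: "(\<lambda>(t, \<zeta>). pt t \<zeta>) \<in> borel_measurable (angle_measure \<Otimes>\<^sub>M \<mu>)"
      unfolding pt_def pk_def by measurable
    have ptm1 [measurable]: "pt t \<in> borel_measurable \<mu>" for t
      unfolding pt_def by measurable
    define J where "J = (\<lambda>\<zeta>. indicator (UNIV - K) \<zeta> :: ennreal)"
    have Jm [measurable]: "J \<in> borel_measurable \<mu>" unfolding J_def by measurable
    \<comment> \<open>On U the cap by 1 is essential: the uncapped Poisson integral has mean 1 on
      every circle and may concentrate on U, however small U is.\<close>
    have pointwise: "ennreal (min 1 (pois (of_real r * cis t)))
       \<le> indicator U (cis t) + ennreal (a r) + (\<integral>\<^sup>+ \<zeta>. J \<zeta> * pt t \<zeta> \<partial>\<mu>)" for t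
    proof (cases "cis t \<in> U")
      case True
      have "ennreal (min 1 (pois (of_real r * cis t))) \<le> 1 + 0 + 0"
        by (simp add: ennreal_leI flip: ennreal_1)
      also have "\<dots> \<le> indicator U (cis t) + ennreal (a r) + (\<integral>\<^sup>+ \<zeta>. J \<zeta> * pt t \<zeta> \<partial>\<mu>)"
        using True by (intro add_mono) auto
      finally show ?thesis .
    next
      case False
      have "ennreal (min 1 (pois (of_real r * cis t))) \<le> ennreal (pois (of_real r * cis t))"
        by (intro ennreal_leI) simp
      also have "\<dots> = (\<integral>\<^sup>+ \<zeta>. pt t \<zeta> \<partial>\<mu>)"
        unfolding pois_def pt_def
        by (rule nn_integral_eq_integral[symmetric]) (auto intro!: pk_integrable zr pk_nonneg)
      also have "\<dots> \<le> (\<integral>\<^sup>+ \<zeta>. ennreal (a r) + J \<zeta> * pt t \<zeta> \<partial>\<mu>)"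
      proof (rule nn_integral_mono)
        fix \<zeta>
        show "pt t \<zeta> \<le> ennreal (a r) + J \<zeta> * pt t \<zeta>"
        proof (cases "\<zeta> \<in> K")
          case True
          then have \<zeta>: "norm \<zeta> = 1" using K by auto
          have u: "cnj \<zeta> * \<zeta> = 1" using \<zeta> by (simp add: complex_norm_square[symmetric] mult.commute)
          have "d \<le> dist \<zeta> (cis t)" using d True False by blast
          also have "\<dots> \<le> dist \<zeta> (of_real r * cis t) + dist (of_real r * cis t) (cis t)"
            by (rule dist_triangle)
          also have "dist (of_real r * cis t) (cis t) = 1 - r"
          proof -
            have "of_real r * cis t - cis t = of_real (r - 1) * cis t" by (simp add: algebra_simps)
            then show ?thesis using r by (simp add: dist_norm norm_mult del: of_real_diff)
          qed
          also have "dist \<zeta> (of_real r * cis t) = norm (1 - of_real r * cis t * cnj \<zeta>)"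
          proof -
            have "1 - of_real r * cis t * cnj \<zeta> = cnj \<zeta> * (\<zeta> - of_real r * cis t)"
              using u by (simp add: algebra_simps)
            then show ?thesis using \<zeta> by (simp add: dist_norm norm_mult)
          qed
          finally have "d / 2 \<le> norm (1 - of_real r * cis t * cnj \<zeta>)"
            using r by simp
          then have "(d / 2)\<^sup>2 \<le> (norm (1 - of_real r * cis t * cnj \<zeta>))\<^sup>2"
            using d by (intro power_mono) auto
          then have "pk (of_real r * cis t) \<zeta> \<le> (1 - r\<^sup>2) / (d / 2)\<^sup>2"
            using r r2 d by (auto simp: pk_def norm_mult intro!: frac_le)
          then have "pk (of_real r * cis t) \<zeta> \<le> a r"
            by (simp add: a_def power_divide)
          then show ?thesis
            using True by (simp add: pt_def J_def ennreal_leI)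
        qed (simp add: J_def)
      qed
      also have "\<dots> = ennreal (a r) + (\<integral>\<^sup>+ \<zeta>. J \<zeta> * pt t \<zeta> \<partial>\<mu>)"
        by (subst nn_integral_add) (auto simp: emeasure_mu_UNIV)
      finally show ?thesis using False by simp
    qed
    have "ennreal (LINT t|angle_measure. min 1 (pois (of_real r * cis t))) = (\<integral>\<^sup>+ t. ennreal (min 1 (pois (of_real r * cis t))) \<partial>angle_measure)"
      by (rule nn_integral_eq_integral[symmetric])
         (use r in \<open>auto intro!: integral_angle continuous_intros pois_continuous pois_nonneg zr\<close>)
    also have "\<dots> \<le> (\<integral>\<^sup>+ t. indicator U (cis t) + ennreal (a r) + (\<integral>\<^sup>+ \<zeta>. J \<zeta> * pt t \<zeta> \<partial>\<mu>) \<partial>angle_measure)"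
      by (intro nn_integral_mono pointwise)
    also have "\<dots> = (\<integral>\<^sup>+ t. indicator U (cis t) \<partial>angle_measure) + ennreal (a r) + (\<integral>\<^sup>+ t. (\<integral>\<^sup>+ \<zeta>. J \<zeta> * pt t \<zeta> \<partial>\<mu>) \<partial>angle_measure)"
      by (subst nn_integral_add; (measurable)?)+ (simp add: emeasure_angle_UNIV)
    also have "(\<integral>\<^sup>+ t. indicator U (cis t) \<partial>angle_measure) = emeasure circle_m U"
    proof -
      have "(\<integral>\<^sup>+ t. indicator U (cis t) \<partial>angle_measure) = (\<integral>\<^sup>+ t. indicator (cis -` U) t \<partial>angle_measure)"
        by (simp add: indicator_vimage)
      also have "\<dots> = emeasure angle_measure (cis -` U)"
        using measurable_sets[OF cis_m \<open>U \<in> sets borel\<close>] by (intro nn_integral_indicator) (simp add: sets_angle)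
      also have "\<dots> = emeasure circle_m U"
        unfolding circle_m_angle by (subst emeasure_distr) auto
      finally show ?thesis .
    qed
    also have "(\<integral>\<^sup>+ t. (\<integral>\<^sup>+ \<zeta>. J \<zeta> * pt t \<zeta> \<partial>\<mu>) \<partial>angle_measure) = (\<integral>\<^sup>+ \<zeta>. (\<integral>\<^sup>+ t. J \<zeta> * pt t \<zeta> \<partial>angle_measure) \<partial>\<mu>)"
      by (rule Fubini'[symmetric]) measurable
    also have "\<dots> = (\<integral>\<^sup>+ \<zeta>. J \<zeta> \<partial>\<mu>)"
    \<comment> \<open>After the exchange the inner integral is a circle mean of the kernel, which is
      1 by \<open>pk_mean\<close>; only the \<mu>-mass outside K survives.\<close>
    proof (rule nn_integral_cong_AE, rule AE_circleI)
      fix \<zeta> :: complex assume \<zeta>: "norm \<zeta> = 1"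
      have "(\<lambda>t. pt t \<zeta>) \<in> borel_measurable angle_measure"
        unfolding pt_def pk_def by measurable
      then show "(\<integral>\<^sup>+ t. J \<zeta> * pt t \<zeta> \<partial>angle_measure) = J \<zeta>"
        using pk_mean[OF \<zeta>, of r] r by (subst nn_integral_cmult) (auto simp: pt_def)
    qed
    also have "\<dots> = emeasure \<mu> (UNIV - K)"
      unfolding J_def by (subst nn_integral_indicator) (auto simp: mu_borel)
    also have "emeasure circle_m U + ennreal (a r) + emeasure \<mu> (UNIV - K) \<le> ennreal e + ennreal (a r) + ennreal e"
      using U muK by (intro add_mono) auto
    also have "\<dots> = ennreal (e + a r + e)"
      using e a by (simp flip: ennreal_plus)
    finally show ?thesis
      using e a by (subst (asm) ennreal_le_iff) auto
  qed
  have "(a \<longlongrightarrow> (1 - 1\<^sup>2) * (4 / d\<^sup>2)) (at_left 1)"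
    unfolding a_def by (intro tendsto_intros)
  then have "eventually (\<lambda>r. a r < e) (at_left 1)"
    by (rule order_tendstoD) (use e in auto)
  moreover have "eventually (\<lambda>r::real. 0 < r \<and> r < 1) (at_left 1)"
    by (rule eventually_at_left_1) auto
  moreover have "eventually (\<lambda>r::real. 1 - d / 2 < r) (at_left 1)"
    by (rule order_tendstoD(1)[OF tendsto_ident_at]) (use d in auto)
  ultimately show "\<forall>\<^sub>F r in at_left 1. dist (LINT t|angle_measure. min 1 (pois (of_real r * cis t))) 0 < e0"
  proof eventually_elim
    case (elim r)
    have "0 \<le> (LINT t|angle_measure. min 1 (pois (of_real r * cis t)))"
      using elim by (intro integral_nonneg_AE AE_I2) (auto intro!: pois_nonneg simp: norm_mult)
    then show ?case using bound[of r] elim e by (simp add: e_def)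
  qed
qed

end

section \<open>The model space of a Clark measure\<close>

lemma model_spaceI:
  assumes "f \<in> H2" "\<And>h. hardy h \<Longrightarrow> h2_inner f (\<lambda>z. w z * h z) = 0"
  shows "f \<in> model_space w"
  using assms by (auto simp: model_space_def hardy_H2)

lemma model_space_H2: "f \<in> model_space w \<Longrightarrow> f \<in> H2"
  by (simp add: model_space_def)

lemma model_space_hardy: "f \<in> model_space w \<Longrightarrow> hardy f"
  by (simp add: model_space_def hardy_H2)

lemma hardy_bounded_mult:
  assumes "w holomorphic_on ball 0 1" "bounded (w ` ball 0 1)" "hardy h"
  shows "hardy (\<lambda>z. w z * h z)"
proof -
  from assms(2) obtain B where "\<And>z. norm z < 1 \<Longrightarrow> norm (w z) \<le> B"
    by (force simp: bounded_iff)
  then show ?thesis by (rule hardy_mult[OF assms(1) _ assms(3)])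
qed

text \<open>The definition tests against members of \<open>H2\<close>, which vanish off the disk.
  Cutting h off there changes no inner product, so that polynomials may serve as test
  functions.\<close>

lemma model_space_ortho:
  assumes w: "w holomorphic_on ball 0 1" "bounded (w ` ball 0 1)"
    and f: "f \<in> model_space w" and h: "hardy h"
  shows "h2_inner f (\<lambda>z. w z * h z) = 0"
proof -
  define h' where "h' = (\<lambda>z. if z \<in> ball 0 1 then h z else 0)"
  have h': "hardy h'"
    by (rule hardy_cong[OF _ h]) (simp add: h'_def)
  then have "h' \<in> H2"
    by (simp add: H2_iff h'_def)
  then have "h2_inner f (\<lambda>z. w z * h' z) = 0"
    using f by (simp add: model_space_def)
  moreover have "h2_inner f (\<lambda>z. w z * h' z) = h2_inner f (\<lambda>z. w z * h z)"
    by (rule h2_inner_cong) (use hardy_bounded_mult[OF w h'] model_space_hardy[OF f] in \<open>auto simp: h'_def\<close>)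
  ultimately show ?thesis by simp
qed

lemma H2_add: "f \<in> H2 \<Longrightarrow> g \<in> H2 \<Longrightarrow> (\<lambda>z. f z + g z) \<in> H2"
  by (simp add: H2_iff hardy_add)

lemma H2_cmult: "f \<in> H2 \<Longrightarrow> (\<lambda>z. c * f z) \<in> H2"
  by (simp add: H2_iff hardy_cmult)

lemma model_space_add:
  assumes w: "w holomorphic_on ball 0 1" "bounded (w ` ball 0 1)"
    and "f \<in> model_space w" "g \<in> model_space w"
  shows "(\<lambda>z. f z + g z) \<in> model_space w"
proof (rule model_spaceI)
  fix h assume "hardy h"
  then show "h2_inner (\<lambda>z. f z + g z) (\<lambda>z. w z * h z) = 0"
    using assms by (simp add: h2_inner_add model_space_hardy hardy_bounded_mult[OF w] model_space_ortho[OF w])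
qed (use assms in \<open>auto intro: H2_add model_space_H2\<close>)

lemma model_space_cmult:
  assumes w: "w holomorphic_on ball 0 1" "bounded (w ` ball 0 1)"
    and "f \<in> model_space w"
  shows "(\<lambda>z. c * f z) \<in> model_space w"
proof (rule model_spaceI)
  fix h assume "hardy h"
  then show "h2_inner (\<lambda>z. c * f z) (\<lambda>z. w z * h z) = 0"
    using assms by (simp add: h2_inner_cmult model_space_hardy hardy_bounded_mult[OF w] model_space_ortho[OF w])
qed (use assms in \<open>auto intro: H2_cmult model_space_H2\<close>)

text \<open>On the circle of radius r the two integrals differ by the factor r^2, which tends to
  1.\<close>

lemma h2_inner_shift:
  assumes f: "hardy f" and g: "hardy g"
  shows "h2_inner (\<lambda>z. z * f z) (\<lambda>z. z * g z) = h2_inner f g"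
proof -
  let ?I = "\<lambda>f g r. LINT t|angle_measure. f (complex_of_real r * cis t) * cnj (g (of_real r * cis t))"
  have "?I (\<lambda>z. z * f z) (\<lambda>z. z * g z) r = of_real (r\<^sup>2) * ?I f g r" for r
  proof -
    have "(of_real r * cis t) * f (of_real r * cis t) * cnj ((of_real r * cis t) * g (of_real r * cis t))
       = of_real (r\<^sup>2) * (f (of_real r * cis t) * cnj (g (of_real r * cis t)))" for t
    proof -
      have "cis t * cnj (cis t) = 1" by (simp add: complex_norm_square[symmetric])
      then have "of_real r * cis t * cnj (of_real r * cis t) = complex_of_real (r\<^sup>2)"
        by (simp add: power2_eq_square mult_ac)
      then show ?thesis by (simp add: mult_ac)
    qed
    then show ?thesis by (simp only: integral_mult_right_zero)
  qed
  moreover have "((\<lambda>r. of_real (r\<^sup>2) * ?I f g r) \<longlongrightarrow> of_real (1\<^sup>2) * h2_inner f g) (at_left 1)"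
    by (intro tendsto_intros h2_inner_tendsto f g)
  ultimately have "((\<lambda>r. ?I (\<lambda>z. z * f z) (\<lambda>z. z * g z) r) \<longlongrightarrow> h2_inner f g) (at_left 1)"
    by simp
  moreover have "((\<lambda>r. ?I (\<lambda>z. z * f z) (\<lambda>z. z * g z) r) \<longlongrightarrow> h2_inner (\<lambda>z. z * f z) (\<lambda>z. z * g z)) (at_left 1)"
    by (intro h2_inner_tendsto hardy_id_mult f g)
  ultimately show ?thesis
    by (intro tendsto_unique[of "at_left (1::real)"]) auto
qed

context clark
begin

abbreviation "\<theta> \<equiv> clark_theta \<mu>"

lemma theta_eq: "norm z < 1 \<Longrightarrow> \<theta> z = 1 - 1 / \<Phi> z"
  by (simp add: clark_theta_def cauchy_def)

text \<open>Nonnegativity of the Poisson integral says that \<open>\<Phi>\<close> has real part at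
  least 1/2.\<close>

lemma Phi_nz:
  assumes "norm z < 1"
  shows "\<Phi> z \<noteq> 0"
  using pois_eq[OF assms] pois_nonneg[OF assms] by auto

lemma theta_Phi: "norm z < 1 \<Longrightarrow> (1 - \<theta> z) * \<Phi> z = 1"
  using Phi_nz by (simp add: theta_eq)

lemma theta_holo: "\<theta> holomorphic_on ball 0 1"
proof -
  have "(\<lambda>z. 1 - 1 / \<Phi> z) holomorphic_on ball 0 1"
    by (intro holomorphic_on_diff holomorphic_on_divide holomorphic_on_const cauchy_holo) (auto simp: Phi_nz)
  then show ?thesis
    by (rule holomorphic_transform) (simp add: theta_eq)
qed

text \<open>With P = \<open>\<Phi> z\<close> one has \<theta> = (P - 1) / P, and |P|^2 - |P - 1|^2 =
  2 Re P - 1 is the Poisson integral. This identity yields both |\<theta>| \<le> 1 and the smallness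
  of 1 - |\<theta>|^2 near the circle.\<close>

lemma one_minus_norm_theta:
  assumes z: "norm z < 1"
  shows "1 - (norm (\<theta> z))\<^sup>2 = (norm (1 - \<theta> z))\<^sup>2 * pois z"
proof -
  define P where "P = \<Phi> z"
  have P: "P \<noteq> 0" using Phi_nz[OF z] by (simp add: P_def)
  then have n: "(norm P)\<^sup>2 \<noteq> 0" by simp
  have t: "\<theta> z = (P - 1) / P" using P theta_eq[OF z] by (simp add: P_def field_simps)
  have "(norm P)\<^sup>2 - (norm (P - 1))\<^sup>2 = 2 * Re P - 1"
    by (simp add: cmod_power2) (simp add: power2_eq_square algebra_simps)
  then have "1 - (norm (P - 1))\<^sup>2 / (norm P)\<^sup>2 = (2 * Re P - 1) / (norm P)\<^sup>2"
    using n by (simp add: field_simps)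
  moreover have "1 - \<theta> z = 1 / P" using P t by (simp add: field_simps)
  ultimately show ?thesis
    using pois_eq[OF z] by (simp add: t norm_divide power_divide P_def)
qed

lemma theta_bound:
  assumes "norm z < 1"
  shows "norm (\<theta> z) \<le> 1"
proof -
  have "(norm (\<theta> z))\<^sup>2 \<le> 1"
    using one_minus_norm_theta[OF assms] mult_nonneg_nonneg[OF zero_le_power2[of "norm (1 - \<theta> z)"] pois_nonneg[OF assms]] by linarith
  then show ?thesis by (simp add: abs_square_le_1)
qed

lemma norm_one_minus_theta: "norm z < 1 \<Longrightarrow> norm (1 - \<theta> z) \<le> 2"
  using norm_triangle_ineq4[of 1 "\<theta> z"] theta_bound[of z] by simp

lemma theta_bounded: "bounded (\<theta> ` ball 0 1)"
  using theta_bound by (auto simp: bounded_iff intro!: exI[of _ 1])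

lemma theta_0: "\<theta> 0 = 0"
  using theta_eq[of 0] by (simp add: cauchy_def)

lemma hardy_theta_mult: "hardy h \<Longrightarrow> hardy (\<lambda>z. \<theta> z * h z)"
  by (rule hardy_bounded_mult[OF theta_holo theta_bounded])

text \<open>This is the form in which \<theta> is shown to be inner. The defect 1 - |\<theta>|^2 is
  at most 1 and at most 4 times the Poisson integral, so its means vanish in the limit; its
  boundedness lets the weight |g|^2 be inserted.\<close>

lemma theta_defect_tendsto:
  assumes g: "hardy g"
  shows "((\<lambda>r. LINT t|angle_measure. (cmod (g (of_real r * cis t)))\<^sup>2 * (1 - (norm (\<theta> (of_real r * cis t)))\<^sup>2)) \<longlongrightarrow> 0) (at_left 1)"
proof (rule uniformly_integrable_dilates[OF g, where C = 1])
  fix r :: real assume r: "0 < r" "r < 1"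
  show c: "continuous_on UNIV (\<lambda>t. 1 - (norm (\<theta> (of_real r * cis t)))\<^sup>2)"
    using circle_continuous[OF theta_holo, of r] r by (intro continuous_intros) auto
  fix t
  show "0 \<le> 1 - (norm (\<theta> (of_real r * cis t)))\<^sup>2 \<and> 1 - (norm (\<theta> (of_real r * cis t)))\<^sup>2 \<le> 1"
    using theta_bound[of "of_real r * cis t"] r by (auto simp: norm_mult power_le_one)
next
  show "((\<lambda>r. LINT t|angle_measure. 1 - (norm (\<theta> (of_real r * cis t)))\<^sup>2) \<longlongrightarrow> 0) (at_left 1)"
  proof (rule tendsto_sandwich[where f = "\<lambda>_. 0" and h = "\<lambda>r. 4 * (LINT t|angle_measure. min 1 (pois (of_real r * cis t)))"])
    show "\<forall>\<^sub>F r in at_left 1. 0 \<le> (LINT t|angle_measure. 1 - (norm (\<theta> (of_real r * cis t)))\<^sup>2)"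
    proof (rule eventually_at_left_1)
      fix r :: real assume r: "0 < r" "r < 1"
      then show "0 \<le> (LINT t|angle_measure. 1 - (norm (\<theta> (of_real r * cis t)))\<^sup>2)"
        by (intro integral_nonneg_AE AE_I2) (auto intro!: power_le_one theta_bound simp: norm_mult)
    qed
    show "\<forall>\<^sub>F r in at_left 1. (LINT t|angle_measure. 1 - (norm (\<theta> (of_real r * cis t)))\<^sup>2) \<le> 4 * (LINT t|angle_measure. min 1 (pois (of_real r * cis t)))"
    proof (rule eventually_at_left_1)
      fix r :: real assume r: "0 < r" "r < 1"
      have "(LINT t|angle_measure. 1 - (norm (\<theta> (of_real r * cis t)))\<^sup>2) \<le> (LINT t|angle_measure. 4 * min 1 (pois (of_real r * cis t)))"
      proof (rule integral_angle_mono)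
        show "continuous_on UNIV (\<lambda>t. 1 - (norm (\<theta> (of_real r * cis t)))\<^sup>2)"
          using circle_continuous[OF theta_holo, of r] r by (intro continuous_intros) auto
        show "continuous_on UNIV (\<lambda>t. 4 * min 1 (pois (of_real r * cis t)))"
          using pois_continuous[of r] r by (intro continuous_intros) auto
        fix t
        let ?z = "of_real r * cis t"
        have z: "norm ?z < 1" using r by (simp add: norm_mult)
        have "(norm (1 - \<theta> ?z))\<^sup>2 \<le> 2\<^sup>2"
          by (intro power_mono norm_one_minus_theta z) auto
        then have "(norm (1 - \<theta> ?z))\<^sup>2 * pois ?z \<le> 4 * pois ?z"
          by (intro mult_right_mono pois_nonneg z) auto
        then show "1 - (norm (\<theta> ?z))\<^sup>2 \<le> 4 * min 1 (pois ?z)"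
          using one_minus_norm_theta[OF z] zero_le_power2[of "norm (\<theta> ?z)"]
          by linarith
      qed
      then show "(LINT t|angle_measure. 1 - (norm (\<theta> (of_real r * cis t)))\<^sup>2) \<le> 4 * (LINT t|angle_measure. min 1 (pois (of_real r * cis t)))"
        by simp
    qed
    show "((\<lambda>r. 4 * (LINT t|angle_measure. min 1 (pois (of_real r * cis t)))) \<longlongrightarrow> 0) (at_left 1)"
      using tendsto_mult_left[OF min_pois_tendsto_0, of 4] by simp
  qed auto
qed

text \<open>The integrands differ by \<open>u * cnj h\<close> times the defect 1 - |\<theta>|^2. The
  estimate |u h| \<le> |u|^2 + |h|^2 reduces this to two weighted defects that tend to 0.\<close>

lemma theta_isometry:
  assumes u: "hardy u" and h: "hardy h"
  shows "h2_inner (\<lambda>z. \<theta> z * u z) (\<lambda>z. \<theta> z * h z) = h2_inner u h"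
proof -
  let ?I = "\<lambda>f g r. LINT t|angle_measure. f (complex_of_real r * cis t) * cnj (g (of_real r * cis t))"
  let ?D = "\<lambda>g r. LINT t|angle_measure. (cmod (g (of_real r * cis t)))\<^sup>2 * (1 - (norm (\<theta> (of_real r * cis t)))\<^sup>2)"
  have bd: "norm (?I u h r - ?I (\<lambda>z. \<theta> z * u z) (\<lambda>z. \<theta> z * h z) r) \<le> ?D u r + ?D h r"
    if r: "0 < r" "r < 1" for r
  proof -
    have c [continuous_intros]: "continuous_on UNIV (\<lambda>t. u (of_real r * cis t))" "continuous_on UNIV (\<lambda>t. h (of_real r * cis t))"
      "continuous_on UNIV (\<lambda>t. \<theta> (of_real r * cis t))"
      using r by (auto intro!: circle_continuous hardy_holo u h theta_holo)
    let ?e = "\<lambda>t. u (of_real r * cis t) * cnj (h (of_real r * cis t)) - \<theta> (of_real r * cis t) * u (of_real r * cis t) * cnj (\<theta> (of_real r * cis t) * h (of_real r * cis t))"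
    have "?I u h r - ?I (\<lambda>z. \<theta> z * u z) (\<lambda>z. \<theta> z * h z) r = (LINT t|angle_measure. ?e t)"
      by (rule Bochner_Integration.integral_diff[symmetric]) (intro integral_angle continuous_intros)+
    then have "norm (?I u h r - ?I (\<lambda>z. \<theta> z * u z) (\<lambda>z. \<theta> z * h z) r) \<le> (LINT t|angle_measure. norm (?e t))"
      using integral_norm_bound[of angle_measure ?e] by (simp only:)
    also have "\<dots> \<le> (LINT t|angle_measure. (cmod (u (of_real r * cis t)))\<^sup>2 * (1 - (norm (\<theta> (of_real r * cis t)))\<^sup>2)
         + (cmod (h (of_real r * cis t)))\<^sup>2 * (1 - (norm (\<theta> (of_real r * cis t)))\<^sup>2))"
    proof (rule integral_angle_mono)
      fix t
      let ?z = "of_real r * cis t"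
      have z: "norm ?z < 1" using r by (simp add: norm_mult)
      have nn: "0 \<le> 1 - (norm (\<theta> ?z))\<^sup>2"
        using theta_bound[OF z] by (simp add: power_le_one)
      have "?e t = u ?z * cnj (h ?z) * of_real (1 - (norm (\<theta> ?z))\<^sup>2)"
        unfolding of_real_diff complex_norm_square by (simp add: algebra_simps)
      then have e: "norm (?e t) = norm (u ?z) * norm (h ?z) * (1 - (norm (\<theta> ?z))\<^sup>2)"
        using nn by (simp only: norm_mult norm_of_real complex_mod_cnj abs_of_nonneg)
      have "norm (u ?z) * norm (h ?z) \<le> (norm (u ?z))\<^sup>2 + (norm (h ?z))\<^sup>2"
      proof -
        have "0 \<le> norm (u ?z) * norm (h ?z)" by simp
        then show ?thesis
          using sum_squares_bound[of "norm (u ?z)" "norm (h ?z)"] by linarith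
      qed
      from mult_right_mono[OF this nn] e show "norm (?e t) \<le> (cmod (u ?z))\<^sup>2 * (1 - (norm (\<theta> ?z))\<^sup>2) + (cmod (h ?z))\<^sup>2 * (1 - (norm (\<theta> ?z))\<^sup>2)"
        by (simp only: distrib_right)
    qed (intro continuous_intros)+
    also have "\<dots> = ?D u r + ?D h r"
      by (rule Bochner_Integration.integral_add) (intro integral_angle continuous_intros)+
    finally show ?thesis .
  qed
  have "((\<lambda>r. ?I u h r - ?I (\<lambda>z. \<theta> z * u z) (\<lambda>z. \<theta> z * h z) r) \<longlongrightarrow> 0) (at_left 1)"
  proof (rule Lim_null_comparison)
    show "\<forall>\<^sub>F r in at_left 1. norm (?I u h r - ?I (\<lambda>z. \<theta> z * u z) (\<lambda>z. \<theta> z * h z) r) \<le> ?D u r + ?D h r"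
      by (rule eventually_at_left_1) (rule bd)
    show "((\<lambda>r. ?D u r + ?D h r) \<longlongrightarrow> 0) (at_left 1)"
      using tendsto_add[OF theta_defect_tendsto[OF u] theta_defect_tendsto[OF h]] by simp
  qed
  moreover have "((\<lambda>r. ?I u h r - ?I (\<lambda>z. \<theta> z * u z) (\<lambda>z. \<theta> z * h z) r)
      \<longlongrightarrow> h2_inner u h - h2_inner (\<lambda>z. \<theta> z * u z) (\<lambda>z. \<theta> z * h z)) (at_left 1)"
    by (intro tendsto_diff h2_inner_tendsto hardy_theta_mult u h)
  ultimately have "h2_inner u h - h2_inner (\<lambda>z. \<theta> z * u z) (\<lambda>z. \<theta> z * h z) = 0"
    by (intro tendsto_unique[of "at_left (1::real)"]) auto
  then show ?thesis by simp
qed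

lemma theta_isometry_norm: "hardy u \<Longrightarrow> h2_norm (\<lambda>z. \<theta> z * u z) = h2_norm u"
  by (simp add: h2_norm_def theta_isometry)

section \<open>The operator \<open>clark_Jinv\<close> on bounded densities\<close>

lemma Jinv_eq: "norm z < 1 \<Longrightarrow> clark_Jinv \<mu> \<gamma> z = (1 - \<theta> z) * cauchy \<gamma> z"
  by (simp add: clark_Jinv_def cauchy_def)

lemma Jinv_outside: "\<not> norm z < 1 \<Longrightarrow> clark_Jinv \<mu> \<gamma> z = 0"
  by (simp add: clark_Jinv_def)

lemma Jinv_holo:
  assumes "bdm \<gamma>"
  shows "clark_Jinv \<mu> \<gamma> holomorphic_on ball 0 1"
proof -
  have "(\<lambda>z. (1 - \<theta> z) * cauchy \<gamma> z) holomorphic_on ball 0 1"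
    by (intro holomorphic_on_mult holomorphic_on_diff holomorphic_on_const theta_holo cauchy_holo assms)
  then show ?thesis
    by (rule holomorphic_transform) (simp add: Jinv_eq)
qed

lemma cauchy_cong:
  assumes "bdm \<gamma>" "bdm \<delta>" "\<And>\<zeta>. norm \<zeta> = 1 \<Longrightarrow> \<gamma> \<zeta> = \<delta> \<zeta>"
  shows "cauchy \<gamma> z = cauchy \<delta> z"
proof -
  note [measurable] = assms(1,2)[THEN bdm_measurable]
  show ?thesis
    unfolding cauchy_def
  proof (rule integral_cong_AE)
    show "AE \<zeta> in \<mu>. \<gamma> \<zeta> / (1 - z * cnj \<zeta>) = \<delta> \<zeta> / (1 - z * cnj \<zeta>)"
      by (rule AE_circleI) (simp add: assms(3))
  qed measurable
qed

lemma Jinv_cong: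
  assumes "bdm \<gamma>" "bdm \<delta>" "\<And>\<zeta>. norm \<zeta> = 1 \<Longrightarrow> \<gamma> \<zeta> = \<delta> \<zeta>"
  shows "clark_Jinv \<mu> \<gamma> = clark_Jinv \<mu> \<delta>"
proof
  fix z
  show "clark_Jinv \<mu> \<gamma> z = clark_Jinv \<mu> \<delta> z"
    using cauchy_cong[OF assms, of z] by (cases "norm z < 1") (auto simp: Jinv_eq Jinv_outside)
qed

lemma cauchy_add:
  assumes "bdm \<gamma>" "bdm \<delta>" "norm z < 1"
  shows "cauchy (\<lambda>\<zeta>. \<gamma> \<zeta> + \<delta> \<zeta>) z = cauchy \<gamma> z + cauchy \<delta> z"
  unfolding cauchy_def add_divide_distrib
  by (rule Bochner_Integration.integral_add) (intro kernel_integrable assms)+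

lemma cauchy_cmult: "cauchy (\<lambda>\<zeta>. c * \<gamma> \<zeta>) z = c * cauchy \<gamma> z"
  unfolding cauchy_def by (simp flip: times_divide_eq_right)

lemma Jinv_add:
  assumes "bdm \<gamma>" "bdm \<delta>"
  shows "clark_Jinv \<mu> (\<lambda>\<zeta>. \<gamma> \<zeta> + \<delta> \<zeta>) = (\<lambda>z. clark_Jinv \<mu> \<gamma> z + clark_Jinv \<mu> \<delta> z)"
proof
  fix z
  show "clark_Jinv \<mu> (\<lambda>\<zeta>. \<gamma> \<zeta> + \<delta> \<zeta>) z = clark_Jinv \<mu> \<gamma> z + clark_Jinv \<mu> \<delta> z"
    using cauchy_add[OF assms, of z]
    by (cases "norm z < 1") (auto simp: Jinv_eq Jinv_outside distrib_left)
qed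

lemma Jinv_cmult: "clark_Jinv \<mu> (\<lambda>\<zeta>. c * \<gamma> \<zeta>) = (\<lambda>z. c * clark_Jinv \<mu> \<gamma> z)"
proof
  fix z
  show "clark_Jinv \<mu> (\<lambda>\<zeta>. c * \<gamma> \<zeta>) z = c * clark_Jinv \<mu> \<gamma> z"
    using cauchy_cmult[of c \<gamma> z]
    by (cases "norm z < 1") (auto simp: Jinv_eq Jinv_outside)
qed

text \<open>On the circle, \<open>\<zeta> / (1 - z * cnj \<zeta>) = z / (1 - z * cnj \<zeta>) +
  \<zeta>\<close>. Multiplying the density by \<zeta> thus multiplies the Cauchy integral by z, up
  to a constant that is a moment.\<close>

lemma cauchy_shift:
  assumes \<gamma>: "bdm \<gamma>" and z: "norm z < 1"
  shows "cauchy (\<lambda>\<zeta>. \<zeta> * \<gamma> \<zeta>) z = z * cauchy \<gamma> z + (LINT \<zeta>|\<mu>. \<zeta> * \<gamma> \<zeta>)"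
proof -
  note [measurable] = bdm_measurable[OF \<gamma>]
  have b: "bdm (\<lambda>\<zeta>. \<zeta> * \<gamma> \<zeta>)"
    by (rule bdm_mult[OF bdm_continuous \<gamma>]) (rule continuous_on_id)
  have "cauchy (\<lambda>\<zeta>. \<zeta> * \<gamma> \<zeta>) z = (LINT \<zeta>|\<mu>. z * (\<gamma> \<zeta> / (1 - z * cnj \<zeta>)) + \<zeta> * \<gamma> \<zeta>)"
    unfolding cauchy_def
  proof (rule integral_cong_AE)
    show "AE \<zeta> in \<mu>. \<zeta> * \<gamma> \<zeta> / (1 - z * cnj \<zeta>) = z * (\<gamma> \<zeta> / (1 - z * cnj \<zeta>)) + \<zeta> * \<gamma> \<zeta>"
    proof (rule AE_circleI)
      fix \<zeta> :: complex assume \<zeta>: "norm \<zeta> = 1"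
      have u: "\<zeta> * cnj \<zeta> = 1" using \<zeta> by (simp add: complex_norm_square[symmetric])
      have "\<zeta> * \<gamma> \<zeta> = z * \<gamma> \<zeta> + \<zeta> * \<gamma> \<zeta> * (1 - z * cnj \<zeta>)"
      proof -
        have "\<zeta> * \<gamma> \<zeta> * (1 - z * cnj \<zeta>) = \<zeta> * \<gamma> \<zeta> - z * \<gamma> \<zeta> * (\<zeta> * cnj \<zeta>)"
          by (simp add: ring_distribs mult_ac)
        then show ?thesis by (simp add: u)
      qed
      then show "\<zeta> * \<gamma> \<zeta> / (1 - z * cnj \<zeta>) = z * (\<gamma> \<zeta> / (1 - z * cnj \<zeta>)) + \<zeta> * \<gamma> \<zeta>"
        using denom_nz[OF \<zeta> z] by (simp add: divide_simps)
    qed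
  qed measurable
  also have "\<dots> = z * cauchy \<gamma> z + (LINT \<zeta>|\<mu>. \<zeta> * \<gamma> \<zeta>)"
    unfolding cauchy_def
    using Bochner_Integration.integral_add[OF integrable_mult_right[OF kernel_integrable[OF \<gamma> z], of z] bdm_integrable[OF b]]
    by (simp only: integral_mult_right_zero)
  finally show ?thesis .
qed

text \<open>Multiplying the density by \<open>cnj \<zeta>\<close> moves the Taylor coefficients of
  the Cauchy integral down by one place: the backward shift, stated without division by z.\<close>

lemma cauchy_backshift:
  assumes \<gamma>: "bdm \<gamma>" and z: "norm z < 1"
  shows "z * cauchy (\<lambda>\<zeta>. cnj \<zeta> * \<gamma> \<zeta>) z = cauchy \<gamma> z - cauchy \<gamma> 0"
proof -
  note [measurable] = bdm_measurable[OF \<gamma>]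
  have "cauchy \<gamma> z - cauchy \<gamma> 0 = (LINT \<zeta>|\<mu>. \<gamma> \<zeta> / (1 - z * cnj \<zeta>) - \<gamma> \<zeta> / (1 - 0 * cnj \<zeta>))"
    unfolding cauchy_def
    by (rule Bochner_Integration.integral_diff[symmetric]) (rule kernel_integrable[OF \<gamma>], use z in simp)+
  also have "\<dots> = (LINT \<zeta>|\<mu>. z * (cnj \<zeta> * \<gamma> \<zeta> / (1 - z * cnj \<zeta>)))"
  proof (rule integral_cong_AE)
    show "AE \<zeta> in \<mu>. \<gamma> \<zeta> / (1 - z * cnj \<zeta>) - \<gamma> \<zeta> / (1 - 0 * cnj \<zeta>) = z * (cnj \<zeta> * \<gamma> \<zeta> / (1 - z * cnj \<zeta>))"
    proof (rule AE_circleI)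
      fix \<zeta> :: complex assume \<zeta>: "norm \<zeta> = 1"
      show "\<gamma> \<zeta> / (1 - z * cnj \<zeta>) - \<gamma> \<zeta> / (1 - 0 * cnj \<zeta>) = z * (cnj \<zeta> * \<gamma> \<zeta> / (1 - z * cnj \<zeta>))"
        using denom_nz[OF \<zeta> z] by (simp add: divide_simps) (simp add: ring_distribs mult_ac)
    qed
  qed measurable
  also have "\<dots> = z * cauchy (\<lambda>\<zeta>. cnj \<zeta> * \<gamma> \<zeta>) z"
    unfolding cauchy_def by (rule integral_mult_right_zero)
  finally show ?thesis by simp
qed

text \<open>Boundedness of the image is part of the notion: it keeps products with an arbitrary g in
  \<open>H2\<close> in the Hardy space and supplies the constant for
  \<open>uniformly_integrable_dilates\<close>.\<close>

definition good :: "(complex \<Rightarrow> complex) \<Rightarrow> bool" where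
  "good \<gamma> \<longleftrightarrow> bdm \<gamma> \<and> clark_Jinv \<mu> \<gamma> \<in> model_space \<theta> \<and>
     (\<exists>B. \<forall>z. norm z < 1 \<longrightarrow> norm (clark_Jinv \<mu> \<gamma> z) \<le> B)"

lemma good_bdm: "good \<gamma> \<Longrightarrow> bdm \<gamma>"
  and good_model_space: "good \<gamma> \<Longrightarrow> clark_Jinv \<mu> \<gamma> \<in> model_space \<theta>"
  by (auto simp: good_def)

lemma goodI:
  assumes \<gamma>: "bdm \<gamma>" and B: "\<And>z. norm z < 1 \<Longrightarrow> norm (clark_Jinv \<mu> \<gamma> z) \<le> B"
    and ortho: "\<And>h. hardy h \<Longrightarrow> h2_inner (clark_Jinv \<mu> \<gamma>) (\<lambda>z. \<theta> z * h z) = 0"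
  shows "good \<gamma>"
proof -
  have "hardy (clark_Jinv \<mu> \<gamma>)"
    by (rule hardy_bounded[OF Jinv_holo[OF \<gamma>] B])
  then have "clark_Jinv \<mu> \<gamma> \<in> H2"
    by (simp add: H2_iff Jinv_outside)
  then show ?thesis
    using assms by (auto simp: good_def intro: model_spaceI)
qed

lemma good_add:
  assumes "good \<gamma>" "good \<delta>"
  shows "good (\<lambda>\<zeta>. \<gamma> \<zeta> + \<delta> \<zeta>)"
proof -
  obtain B where B: "\<And>z. norm z < 1 \<Longrightarrow> norm (clark_Jinv \<mu> \<gamma> z) \<le> B"
    using assms(1) by (auto simp: good_def)
  obtain C where C: "\<And>z. norm z < 1 \<Longrightarrow> norm (clark_Jinv \<mu> \<delta> z) \<le> C"
    using assms(2) by (auto simp: good_def)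
  have "norm (clark_Jinv \<mu> \<gamma> z + clark_Jinv \<mu> \<delta> z) \<le> B + C" if "norm z < 1" for z
    using B[OF that] C[OF that] norm_triangle_ineq[of "clark_Jinv \<mu> \<gamma> z" "clark_Jinv \<mu> \<delta> z"] by linarith
  then show ?thesis
    using assms model_space_add[OF theta_holo theta_bounded] bdm_add
    by (auto simp: good_def Jinv_add)
qed

lemma good_cmult:
  assumes "good \<gamma>"
  shows "good (\<lambda>\<zeta>. c * \<gamma> \<zeta>)"
proof -
  obtain B where B: "\<And>z. norm z < 1 \<Longrightarrow> norm (clark_Jinv \<mu> \<gamma> z) \<le> B"
    using assms(1) by (auto simp: good_def)
  have "norm (c * clark_Jinv \<mu> \<gamma> z) \<le> norm c * B" if "norm z < 1" for z
    using B[OF that] by (auto simp: norm_mult intro!: mult_left_mono)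
  then show ?thesis
    using assms model_space_cmult[OF theta_holo theta_bounded] bdm_mult[OF bdm_const[of c]]
    by (auto simp: good_def Jinv_cmult)
qed

lemma good_0: "good (\<lambda>_. 0)"
proof -
  have J: "clark_Jinv \<mu> (\<lambda>_. 0) = (\<lambda>_. 0)"
    by (simp add: clark_Jinv_def fun_eq_iff)
  show ?thesis
  proof (rule goodI[where B = 0])
    fix h assume "hardy h"
    then show "h2_inner (clark_Jinv \<mu> (\<lambda>_. 0)) (\<lambda>z. \<theta> z * h z) = 0"
      using h2_inner_cmult[of "\<lambda>_. 0" "\<lambda>z. \<theta> z * h z" 0] hardy_const hardy_theta_mult by (simp add: J)
  qed (simp_all add: J)
qed

lemma good_sum: "(\<And>i. i \<in> A \<Longrightarrow> good (f i)) \<Longrightarrow> good (\<lambda>\<zeta>. \<Sum>i\<in>A. f i \<zeta>)"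
  by (induction A rule: infinite_finite_induct) (auto intro: good_0 good_add)

subsection \<open>Images of analytic polynomials\<close>

text \<open>\<open>qpol n\<close> is the image of \<open>z^n\<close> under the Toeplitz operator with symbol the conjugate
  of \<open>\<theta>\<close>, so that \<open>z^n - \<theta> * qpol n\<close> is the projection of \<open>z^n\<close> to the model space.\<close>

definition qpol :: "nat \<Rightarrow> complex \<Rightarrow> complex" where
  "qpol n z = (\<Sum>j\<le>n. cnj (coef \<theta> j) * z ^ (n - j))"

lemma qpol_0: "qpol 0 z = 0"
  by (simp add: qpol_def coef_0 theta_0)

lemma qpol_Suc: "qpol (Suc n) z = z * qpol n z + cnj (coef \<theta> (Suc n))"
proof -
  have "(\<Sum>j\<le>n. cnj (coef \<theta> j) * z ^ (Suc n - j)) = z * qpol n z"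
    unfolding qpol_def sum_distrib_left by (intro sum.cong refl) (simp add: Suc_diff_le mult_ac)
  then show ?thesis by (simp add: qpol_def)
qed

lemma qpol_continuous: "continuous_on S (qpol n)"
  unfolding qpol_def by (intro continuous_intros)

lemma qpol_bound: "norm z < 1 \<Longrightarrow> norm (qpol n z) \<le> (\<Sum>j\<le>n. norm (coef \<theta> j))"
  unfolding qpol_def
  by (rule sum_norm_le) (auto simp: norm_mult norm_power intro!: mult_left_le power_le_one)

lemma hardy_qpol: "hardy (qpol n)"
proof (rule hardy_bounded[OF _ qpol_bound])
  show "qpol n holomorphic_on ball 0 1"
    unfolding qpol_def by (intro holomorphic_intros)
qed

lemma hardy_power: "hardy (\<lambda>z. z ^ n)"
  using hardy_power_mult[OF hardy_const[of 1]] by simp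

text \<open>By the Cauchy product both sides are the conjugate of the n-th coefficient of \<theta>
  h. This is the adjoint relation for multiplication by \<theta>.\<close>

lemma h2_inner_qpol:
  assumes h: "hardy h"
  shows "h2_inner (qpol n) h = h2_inner (\<lambda>z. z ^ n) (\<lambda>z. \<theta> z * h z)"
proof -
  have "h2_inner (qpol n) h = (\<Sum>j\<le>n. cnj (coef \<theta> j) * cnj (coef h (n - j)))"
    unfolding qpol_def
    by (simp add: h2_inner_sum h2_inner_cmult h2_inner_power h hardy_power hardy_cmult)
  also have "\<dots> = cnj (coef (\<lambda>z. \<theta> z * h z) n)"
    by (simp add: coef_mult[OF theta_holo hardy_holo[OF h]])
  finally show ?thesis
    by (simp add: h2_inner_power hardy_theta_mult h)
qed

text \<open>The recursion for the moments of \<open>\<mu>\<close> is \<open>\<theta> \<Phi> = \<Phi> - 1\<close> in Taylor coefficients.\<close>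

lemma moment_recursion:
  "(LINT \<zeta>|\<mu>. \<zeta> * (\<zeta> ^ n - qpol n \<zeta>)) = cnj (coef \<theta> (Suc n))"
proof -
  define m where "m k = (LINT \<zeta>|\<mu>. \<zeta> ^ k)" for k
  have int: "integrable \<mu> (\<lambda>\<zeta>. \<zeta> ^ k)" for k
    by (intro bdm_integrable bdm_continuous continuous_intros)
  have m: "cnj (m k) = coef \<Phi> k" for k
    by (simp add: coef_cauchy m_def flip: complex_cnj_power integral_cnj)
  have m0: "m 0 = 1" by (simp add: m_def)
  have "coef (\<lambda>z. \<theta> z * \<Phi> z) (Suc n) = coef (\<lambda>z. \<Phi> z + (- 1)) (Suc n)"
    using theta_Phi by (intro fun_cong[OF coef_cong]) (auto simp: algebra_simps)
  also have "\<dots> = coef \<Phi> (Suc n)"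
    by (subst coef_add) (auto simp: coef_const cauchy_holo)
  finally have "(\<Sum>i\<le>Suc n. coef \<theta> i * coef \<Phi> (Suc n - i)) = coef \<Phi> (Suc n)"
    by (simp only: coef_mult[OF theta_holo cauchy_holo[OF bdm_const]])
  then have "cnj (\<Sum>i\<le>Suc n. coef \<theta> i * cnj (m (Suc n - i))) = m (Suc n)"
    by (simp only: m[symmetric] complex_cnj_cnj)
  \<comment> \<open>The summand i = n + 1 carries the zeroth moment, which is 1; it becomes the
    isolated coefficient on the right.\<close>
  then have rec: "m (Suc n) - (\<Sum>i\<le>n. cnj (coef \<theta> i) * m (Suc n - i)) = cnj (coef \<theta> (Suc n))"
    by (simp add: m0 algebra_simps)
  have "(LINT \<zeta>|\<mu>. \<zeta> * (\<zeta> ^ n - qpol n \<zeta>)) = (LINT \<zeta>|\<mu>. \<zeta> ^ Suc n - (\<Sum>i\<le>n. cnj (coef \<theta> i) * \<zeta> ^ (Suc n - i)))"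
  proof (intro Bochner_Integration.integral_cong refl)
    fix \<zeta>
    have "\<zeta> * qpol n \<zeta> = (\<Sum>i\<le>n. cnj (coef \<theta> i) * \<zeta> ^ (Suc n - i))"
      unfolding qpol_def sum_distrib_left by (intro sum.cong refl) (simp add: Suc_diff_le mult_ac)
    then show "\<zeta> * (\<zeta> ^ n - qpol n \<zeta>) = \<zeta> ^ Suc n - (\<Sum>i\<le>n. cnj (coef \<theta> i) * \<zeta> ^ (Suc n - i))"
      by (simp add: right_diff_distrib)
  qed
  also have "\<dots> = m (Suc n) - (\<Sum>i\<le>n. cnj (coef \<theta> i) * m (Suc n - i))"
    unfolding m_def by (simp add: int Bochner_Integration.integral_diff del: power_Suc)
  finally show ?thesis by (simp only: rec)
qed

lemma bdm_gam: "bdm (\<lambda>\<zeta>. \<zeta> ^ n - qpol n \<zeta>)"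
  by (intro bdm_continuous continuous_intros qpol_continuous)

text \<open>From n to n + 1 the density is multiplied by \<zeta> and loses the constant c of
  \<open>qpol_Suc\<close>. By \<open>moment_recursion\<close> the moment arising in
  \<open>cauchy_shift\<close> is the same c, so the constants contribute (1 - \<theta>) c - c = -
  \<theta> c to the image.\<close>

lemma Jinv_gam:
  assumes z: "norm z < 1"
  shows "clark_Jinv \<mu> (\<lambda>\<zeta>. \<zeta> ^ n - qpol n \<zeta>) z = z ^ n - \<theta> z * qpol n z"
proof (induction n)
  case 0
  then show ?case
    using theta_Phi[OF z] by (simp add: Jinv_eq[OF z] qpol_0)
next
  case (Suc n)
  let ?c = "cnj (coef \<theta> (Suc n))"
  let ?\<gamma> = "\<lambda>\<zeta>. \<zeta> ^ n - qpol n \<zeta>"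
  have b: "bdm (\<lambda>\<zeta>. \<zeta> * ?\<gamma> \<zeta>)"
    by (rule bdm_mult[OF bdm_continuous bdm_gam]) (rule continuous_on_id)
  have "cauchy (\<lambda>\<zeta>. \<zeta> ^ Suc n - qpol (Suc n) \<zeta>) z = cauchy (\<lambda>\<zeta>. \<zeta> * ?\<gamma> \<zeta> + (- ?c) * 1) z"
    by (simp add: qpol_Suc algebra_simps)
  also have "\<dots> = cauchy (\<lambda>\<zeta>. \<zeta> * ?\<gamma> \<zeta>) z + (- ?c) * \<Phi> z"
    by (subst cauchy_add[OF b bdm_const z]) (simp only: cauchy_cmult)
  also have "cauchy (\<lambda>\<zeta>. \<zeta> * ?\<gamma> \<zeta>) z = z * cauchy ?\<gamma> z + ?c"
    unfolding cauchy_shift[OF bdm_gam z] moment_recursion ..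
  finally have "clark_Jinv \<mu> (\<lambda>\<zeta>. \<zeta> ^ Suc n - qpol (Suc n) \<zeta>) z
      = (1 - \<theta> z) * (z * cauchy ?\<gamma> z + ?c + (- ?c) * \<Phi> z)"
    by (simp only: Jinv_eq[OF z])
  also have "\<dots> = z * ((1 - \<theta> z) * cauchy ?\<gamma> z) + (1 - \<theta> z) * ?c - ?c * ((1 - \<theta> z) * \<Phi> z)"
    by (simp add: algebra_simps)
  also have "(1 - \<theta> z) * cauchy ?\<gamma> z = z ^ n - \<theta> z * qpol n z"
    using Suc by (simp add: Jinv_eq[OF z])
  also have "z * (z ^ n - \<theta> z * qpol n z) + (1 - \<theta> z) * ?c - ?c * ((1 - \<theta> z) * \<Phi> z) = z ^ Suc n - \<theta> z * qpol (Suc n) z"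
    unfolding theta_Phi[OF z] by (simp add: qpol_Suc algebra_simps)
  finally show ?case .
qed

text \<open>Isometry of \<theta> turns the inner product of \<theta> \<open>qpol n\<close> with
  \<theta> h into that of \<open>qpol n\<close> with h, which by \<open>h2_inner_qpol\<close>
  cancels the contribution of z^n.\<close>

lemma good_gam: "good (\<lambda>\<zeta>. \<zeta> ^ n - qpol n \<zeta>)"
proof (rule goodI[OF bdm_gam])
  fix z :: complex assume z: "norm z < 1"
  have "norm (\<theta> z * qpol n z) \<le> 1 * (\<Sum>j\<le>n. norm (coef \<theta> j))"
    unfolding norm_mult by (intro mult_mono theta_bound qpol_bound z) auto
  moreover have "norm (z ^ n) \<le> 1"
    using z by (simp add: norm_power power_le_one)
  ultimately show "norm (clark_Jinv \<mu> (\<lambda>\<zeta>. \<zeta> ^ n - qpol n \<zeta>) z) \<le> 1 + (\<Sum>j\<le>n. norm (coef \<theta> j))"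
    unfolding Jinv_gam[OF z] using norm_triangle_ineq4[of "z ^ n" "\<theta> z * qpol n z"] by linarith
next
  fix h assume h: "hardy h"
  have t: "hardy (\<lambda>z. \<theta> z * h z)" "hardy (\<lambda>z. \<theta> z * qpol n z)"
    by (intro hardy_theta_mult h hardy_qpol)+
  have H: "hardy (\<lambda>z. z ^ n + (- 1) * (\<theta> z * qpol n z))"
    by (intro hardy_add hardy_power hardy_cmult t)
  have "h2_inner (clark_Jinv \<mu> (\<lambda>\<zeta>. \<zeta> ^ n - qpol n \<zeta>)) (\<lambda>z. \<theta> z * h z)
     = h2_inner (\<lambda>z. z ^ n + (- 1) * (\<theta> z * qpol n z)) (\<lambda>z. \<theta> z * h z)"
    by (rule h2_inner_cong[symmetric]) (use H t in \<open>auto simp: Jinv_gam\<close>)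
  also have "\<dots> = h2_inner (\<lambda>z. z ^ n) (\<lambda>z. \<theta> z * h z) + (- 1) * h2_inner (\<lambda>z. \<theta> z * qpol n z) (\<lambda>z. \<theta> z * h z)"
    by (simp only: h2_inner_add h2_inner_cmult hardy_power hardy_cmult t)
  also have "h2_inner (\<lambda>z. \<theta> z * qpol n z) (\<lambda>z. \<theta> z * h z) = h2_inner (\<lambda>z. z ^ n) (\<lambda>z. \<theta> z * h z)"
    by (simp only: theta_isometry hardy_qpol h h2_inner_qpol)
  finally show "h2_inner (clark_Jinv \<mu> (\<lambda>\<zeta>. \<zeta> ^ n - qpol n \<zeta>)) (\<lambda>z. \<theta> z * h z) = 0"
    by simp
qed

text \<open>As \<theta> vanishes at 0, \<open>qpol n\<close> has degree below n. Hence \<zeta>^n is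
  the density of \<open>good_gam\<close> plus lower powers.\<close>

lemma good_power: "good (\<lambda>\<zeta>. \<zeta> ^ n)"
proof (induction n rule: less_induct)
  case (less n)
  have "good (\<lambda>\<zeta>. cnj (coef \<theta> j) * \<zeta> ^ (n - j))" if "j \<le> n" for j
  proof (cases "j = 0")
    case True
    then show ?thesis using good_0 by (simp add: coef_0 theta_0)
  next
    case False
    then show ?thesis using that by (intro good_cmult less) auto
  qed
  then have "good (qpol n)"
    unfolding qpol_def by (intro good_sum) auto
  from good_add[OF good_gam this, of n] show ?case by simp
qed

subsection \<open>Images of trigonometric polynomials\<close>

text \<open>Multiplying the backward shift identity by 1 - \<theta> gives z f' = f - f(0) (1 -
  \<theta>), because \<theta>(0) = 0. Orthogonality of f' is read off z f', and so is boundedness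
  away from 0; near 0 the Cauchy integral is bounded directly.\<close>

lemma good_backshift:
  assumes \<gamma>: "good \<gamma>"
  shows "good (\<lambda>\<zeta>. cnj \<zeta> * \<gamma> \<zeta>)"
proof -
  let ?f = "clark_Jinv \<mu> \<gamma>" and ?f' = "clark_Jinv \<mu> (\<lambda>\<zeta>. cnj \<zeta> * \<gamma> \<zeta>)"
  note b = good_bdm[OF \<gamma>]
  have b': "bdm (\<lambda>\<zeta>. cnj \<zeta> * \<gamma> \<zeta>)"
    by (rule bdm_mult[OF bdm_continuous b]) (intro continuous_intros)
  have zf: "z * ?f' z = ?f z + (- ?f 0) * (1 + (- 1) * \<theta> z)" if z: "norm z < 1" for z
  proof -
    have "?f 0 = cauchy \<gamma> 0" by (simp add: Jinv_eq theta_0)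
    then show ?thesis
      using cauchy_backshift[OF b z] by (simp add: Jinv_eq[OF z]) (metis (no_types, lifting) mult.left_commute mult.commute right_diff_distrib)
  qed
  obtain B where B: "\<And>z. norm z < 1 \<Longrightarrow> norm (?f z) \<le> B"
    using \<gamma> by (auto simp: good_def)
  obtain C where C: "\<And>\<zeta>. norm \<zeta> = 1 \<Longrightarrow> norm (cnj \<zeta> * \<gamma> \<zeta>) \<le> C"
    using bdmE[OF b'] by metis
  have C0: "0 \<le> C" using C[of 1] by (metis norm_ge_zero norm_one order_trans)
  have B0: "0 \<le> B" using B[of 0] by (metis norm_ge_zero norm_zero order_trans zero_less_one)
  \<comment> \<open>For |z| \<le> 1/2 the Cauchy integral is at most 2 C and |1 - \<theta>| at most
    2, which gives 4 C. Elsewhere |z f'| \<le> B + 2 B is divided by 1/2, which gives 6 B.\<close>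
  have bound: "norm (?f' z) \<le> 6 * B + 4 * C" if z: "norm z < 1" for z
  proof (cases "norm z \<le> 1 / 2")
    case True
    have "norm (cauchy (\<lambda>\<zeta>. cnj \<zeta> * \<gamma> \<zeta>) z) \<le> C / (1 - norm z)"
      by (rule cauchy_bound[OF C b' z])
    also have "\<dots> \<le> C / (1 / 2)"
      using True C0 by (intro divide_left_mono) auto
    finally have "norm (1 - \<theta> z) * norm (cauchy (\<lambda>\<zeta>. cnj \<zeta> * \<gamma> \<zeta>) z) \<le> 2 * (C / (1 / 2))"
      by (intro mult_mono norm_one_minus_theta z) auto
    then show ?thesis
      using B0 by (simp add: Jinv_eq[OF z] norm_mult)
  next
    case False
    have "norm (?f 0) * norm (1 - \<theta> z) \<le> B * 2"
      using B[of 0] norm_one_minus_theta[OF z] B0 by (intro mult_mono) auto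
    then have "norm (z * ?f' z) \<le> B + B * 2"
      unfolding zf[OF z] using B[OF z] norm_triangle_ineq[of "?f z" "(- ?f 0) * (1 + (- 1) * \<theta> z)"]
      by (simp add: norm_mult)
    moreover have "(1 / 2) * norm (?f' z) \<le> norm z * norm (?f' z)"
      using False by (intro mult_right_mono) auto
    ultimately show ?thesis
      using C0 by (simp add: norm_mult)
  qed
  show ?thesis
  proof (rule goodI[OF b' bound])
    fix h assume h: "hardy h"
    have hf: "hardy ?f" using model_space_hardy[OF good_model_space[OF \<gamma>]] .
    have hf': "hardy ?f'" by (rule hardy_bounded[OF Jinv_holo[OF b'] bound])
    have h1: "hardy (\<lambda>z. \<theta> z * h z)" "hardy (\<lambda>z. \<theta> z * (z * h z))" "hardy (\<lambda>z. z * h z)" "hardy (\<lambda>z. 1)" "hardy (\<lambda>z. \<theta> z * 1)"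
      by (intro hardy_theta_mult hardy_id_mult h hardy_const)+
    have h2: "hardy (\<lambda>z. - 1 * (\<theta> z * 1))" "hardy (\<lambda>z. 1 + - 1 * (\<theta> z * 1))" "hardy (\<lambda>z. - ?f 0 * (1 + - 1 * (\<theta> z * 1)))"
      by (intro hardy_cmult hardy_add h1)+
    have o: "h2_inner (\<lambda>z. 1) g = cnj (g 0)" if "hardy g" for g
      using h2_inner_power[OF that, of 0] by (simp add: coef_0)
    \<comment> \<open>Shifting both arguments replaces f' by z f'. The inner products with 1 that
      then appear vanish, since \<theta> z h and z h are 0 at the origin.\<close>
    have "h2_inner ?f' (\<lambda>z. \<theta> z * h z) = h2_inner (\<lambda>z. z * ?f' z) (\<lambda>z. z * (\<theta> z * h z))"
      by (rule h2_inner_shift[symmetric]) (intro hf' h1)+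
    also have "\<dots> = h2_inner (\<lambda>z. ?f z + - ?f 0 * (1 + - 1 * (\<theta> z * 1))) (\<lambda>z. \<theta> z * (z * h z))"
      by (rule h2_inner_cong) (use hf' h1 hardy_id_mult in \<open>auto simp: zf\<close>)
    also have "\<dots> = h2_inner ?f (\<lambda>z. \<theta> z * (z * h z))
        + - ?f 0 * (h2_inner (\<lambda>z. 1) (\<lambda>z. \<theta> z * (z * h z)) + - 1 * h2_inner (\<lambda>z. \<theta> z * 1) (\<lambda>z. \<theta> z * (z * h z)))"
      by (simp only: h2_inner_add h2_inner_cmult h1 h2 hf)
    also have "h2_inner ?f (\<lambda>z. \<theta> z * (z * h z)) = 0"
      by (rule model_space_ortho[OF theta_holo theta_bounded good_model_space[OF \<gamma>] h1(3)])
    also have "h2_inner (\<lambda>z. \<theta> z * 1) (\<lambda>z. \<theta> z * (z * h z)) = h2_inner (\<lambda>z. 1) (\<lambda>z. z * h z)"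
      by (rule theta_isometry) (intro h1)+
    finally show "h2_inner ?f' (\<lambda>z. \<theta> z * h z) = 0"
      by (simp add: o h1)
  qed
qed

lemma good_monomial: "good (\<lambda>\<zeta>. cnj \<zeta> ^ m * \<zeta> ^ n)"
proof (induction m)
  case 0
  then show ?case using good_power[of n] by simp
next
  case (Suc m)
  from good_backshift[OF this] show ?case by (simp add: mult_ac)
qed

subsection \<open>Density and boundary moduli\<close>

text \<open>The error is d + \<theta> Q, with d the Taylor remainder and Q the combination of the
  \<open>qpol n\<close>. The adjoint relation and orthogonality of f to \<theta> Q make the squared
  norm of Q minus the inner product of d with \<theta> Q. So Q is no larger than d, and the error is
  at most twice the remainder.\<close>

lemma model_space_approx:
  assumes f: "f \<in> model_space \<theta>" and e: "e > 0"
  shows "\<exists>N. h2_norm (\<lambda>z. f z - clark_Jinv \<mu> (\<lambda>\<zeta>. \<Sum>n<N. coef f n * (\<zeta> ^ n - qpol n \<zeta>)) z) < e"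
proof -
  have hf: "hardy f" by (rule model_space_hardy[OF f])
  have "eventually (\<lambda>N. h2_norm (\<lambda>z. f z - taylor f N z) < e / 2) sequentially"
    by (rule order_tendstoD(2)[OF taylor_tendsto[OF hf]]) (use e in auto)
  then obtain N where N: "h2_norm (\<lambda>z. f z - taylor f N z) < e / 2"
    by (auto simp: eventually_sequentially)
  define d where "d = (\<lambda>z. f z - taylor f N z)"
  define Q where "Q = (\<lambda>z. \<Sum>n<N. coef f n * qpol n z)"
  have hd: "hardy d"
    using hardy_add[OF hf hardy_cmult[OF hardy_taylor, of "-1" f N]] by (simp add: d_def)
  have hQ: "hardy Q"
    unfolding Q_def by (intro hardy_sum hardy_cmult hardy_qpol)
  note hQt = hardy_theta_mult[OF hQ]
  have "h2_inner Q Q = (\<Sum>n<N. coef f n * h2_inner (qpol n) Q)"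
    using h2_inner_sum[of "{..<N}" "\<lambda>n z. coef f n * qpol n z" Q]
    by (simp add: Q_def[symmetric] hQ hardy_qpol hardy_cmult h2_inner_cmult)
  also have "\<dots> = (\<Sum>n<N. coef f n * h2_inner (\<lambda>z. z ^ n) (\<lambda>z. \<theta> z * Q z))"
    by (simp only: h2_inner_qpol hQ)
  also have "\<dots> = h2_inner (taylor f N) (\<lambda>z. \<theta> z * Q z)"
    unfolding taylor_def[abs_def]
    by (simp add: h2_inner_sum h2_inner_cmult hardy_power hardy_cmult hQt)
  also have "\<dots> = h2_inner (\<lambda>z. f z + (- 1) * d z) (\<lambda>z. \<theta> z * Q z)"
    by (simp add: d_def)
  also have "\<dots> = h2_inner f (\<lambda>z. \<theta> z * Q z) + (- 1) * h2_inner d (\<lambda>z. \<theta> z * Q z)"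
    by (simp only: h2_inner_add h2_inner_cmult hf hd hardy_cmult hQt)
  also have "h2_inner f (\<lambda>z. \<theta> z * Q z) = 0"
    by (rule model_space_ortho[OF theta_holo theta_bounded f hQ])
  finally have "cmod (h2_inner Q Q) \<le> h2_norm d * h2_norm (\<lambda>z. \<theta> z * Q z)"
    using h2_cauchy_schwarz[OF hd hQt] by simp
  moreover have "(h2_norm Q)\<^sup>2 \<le> cmod (h2_inner Q Q)"
  proof -
    have "0 \<le> Re (h2_inner Q Q)"
      using h2_norm_nonneg[OF hQ] by (simp add: h2_norm_def)
    then show ?thesis
      using complex_Re_le_cmod[of "h2_inner Q Q"] by (simp add: h2_norm_def)
  qed
  ultimately have "h2_norm Q * h2_norm Q \<le> h2_norm d * h2_norm Q"
    by (simp add: theta_isometry_norm[OF hQ] power2_eq_square)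
  then have Qd: "h2_norm Q \<le> h2_norm d"
    using h2_norm_nonneg[OF hQ] h2_norm_nonneg[OF hd] by (cases "h2_norm Q = 0") auto
  have J: "clark_Jinv \<mu> (\<lambda>\<zeta>. \<Sum>n<M. coef f n * (\<zeta> ^ n - qpol n \<zeta>)) z = (\<Sum>n<M. coef f n * (z ^ n - \<theta> z * qpol n z))"
    if z: "norm z < 1" for M z
  proof (induction M)
    case 0
    then show ?case by (simp add: clark_Jinv_def)
  next
    case (Suc M)
    have "bdm (\<lambda>\<zeta>. \<Sum>n<M. coef f n * (\<zeta> ^ n - qpol n \<zeta>))"
      by (intro bdm_continuous continuous_intros qpol_continuous)
    from Jinv_add[OF this bdm_mult[OF bdm_const bdm_gam]] show ?case
      by (simp add: Suc Jinv_cmult Jinv_gam[OF z])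
  qed
  have eq: "d z + \<theta> z * Q z = f z - clark_Jinv \<mu> (\<lambda>\<zeta>. \<Sum>n<N. coef f n * (\<zeta> ^ n - qpol n \<zeta>)) z"
    if z: "norm z < 1" for z
  proof -
    have "(\<Sum>n<N. coef f n * (z ^ n - \<theta> z * qpol n z)) = taylor f N z - \<theta> z * Q z"
      by (simp add: taylor_def Q_def right_diff_distrib sum_subtractf sum_distrib_left mult_ac)
    then show ?thesis by (simp add: J[OF z] d_def)
  qed
  have "h2_norm (\<lambda>z. f z - clark_Jinv \<mu> (\<lambda>\<zeta>. \<Sum>n<N. coef f n * (\<zeta> ^ n - qpol n \<zeta>)) z) = h2_norm (\<lambda>z. d z + \<theta> z * Q z)"
    by (rule h2_norm_cong[symmetric]) (use eq hardy_add[OF hd hQt] in auto)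
  also have "\<dots> \<le> h2_norm d + h2_norm (\<lambda>z. \<theta> z * Q z)"
    by (rule h2_norm_triangle[OF hd hQt])
  also have "\<dots> < e"
    using Qd N by (simp add: theta_isometry_norm[OF hQ]) (simp add: d_def)
  finally show ?thesis by blast
qed

text \<open>By \<open>cauchy_reflect\<close> the moduli of the Cauchy integrals differ, up to the
  factor r, by at most B times the Poisson integral, and the common factor 1 - \<theta> has modulus
  at most 2. Hence the difference of the squared moduli of f and f' is bounded with means tending to
  0, and the weight |g|^2 may be inserted.\<close>

lemma h2_norm_reflect:
  assumes g: "hardy g" and \<gamma>: "good \<gamma>" and \<gamma>': "good (\<lambda>\<zeta>. cnj \<zeta> * cnj (\<gamma> \<zeta>))"
  shows "h2_norm (\<lambda>z. g z * clark_Jinv \<mu> (\<lambda>\<zeta>. cnj \<zeta> * cnj (\<gamma> \<zeta>)) z) = h2_norm (\<lambda>z. g z * clark_Jinv \<mu> \<gamma> z)"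
proof -
  define f where "f = clark_Jinv \<mu> \<gamma>"
  define f' where "f' = clark_Jinv \<mu> (\<lambda>\<zeta>. cnj \<zeta> * cnj (\<gamma> \<zeta>))"
  obtain B1 where B1: "\<And>z. norm z < 1 \<Longrightarrow> norm (f z) \<le> B1"
    using \<gamma> by (auto simp: good_def f_def)
  obtain B2 where B2: "\<And>z. norm z < 1 \<Longrightarrow> norm (f' z) \<le> B2"
    using \<gamma>' by (auto simp: good_def f'_def)
  obtain B where B: "B \<ge> 0" "\<And>\<zeta>. norm \<zeta> = 1 \<Longrightarrow> norm (\<gamma> \<zeta>) \<le> B"
    using bdmE[OF good_bdm[OF \<gamma>]] by metis
  \<comment> \<open>L bounds the sum of |f| and |f'| as well as their difference, so
    \<open>L\<^sup>2\<close> bounds the difference of squares.\<close>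
  define L where "L = B1 + B2"
  have B10: "0 \<le> B1" using B1[of 0] by (metis norm_ge_zero norm_zero order_trans zero_less_one)
  have B20: "0 \<le> B2" using B2[of 0] by (metis norm_ge_zero norm_zero order_trans zero_less_one)
  have L: "0 \<le> L" using B10 B20 by (simp add: L_def)
  have fh: "f holomorphic_on ball 0 1" "f' holomorphic_on ball 0 1"
    unfolding f_def f'_def using \<gamma> \<gamma>' by (auto intro!: Jinv_holo good_bdm)
  have hgf: "hardy (\<lambda>z. g z * f z)" "hardy (\<lambda>z. g z * f' z)"
    using hardy_mult[OF fh(1) B1 g] hardy_mult[OF fh(2) B2 g] by (simp_all add: mult.commute)
  define d where "d = (\<lambda>r t. \<bar>(norm (f' (of_real r * cis t)))\<^sup>2 - (norm (f (of_real r * cis t)))\<^sup>2\<bar>)"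
  have d_cont: "continuous_on UNIV (d r)" if "0 < r" "r < 1" for r
    unfolding d_def using that circle_continuous[OF fh(1), of r] circle_continuous[OF fh(2), of r]
    by (intro continuous_intros) auto
  \<comment> \<open>The last bound joins two regimes. Where the Poisson integral P is at most 1, d
    is at most (2 B P + (1 - r) L) L, the second term being the price of replacing r |f| by |f|.
    Where P exceeds 1, the summand \<open>L\<^sup>2\<close> of the coefficient alone dominates
    d.\<close>
  have d_bounds: "0 \<le> d r t" "d r t \<le> L\<^sup>2"
    "d r t \<le> (4 * B * L + L\<^sup>2) * min 1 (pois (of_real r * cis t)) + L\<^sup>2 * (1 - r)"
    if r: "0 < r" "r < 1" for r t
  proof -
    let ?z = "of_real r * cis t"
    have z: "norm ?z < 1" and nz: "norm ?z = r" using r by (auto simp: norm_mult)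
    let ?a = "norm (f ?z)" and ?b = "norm (f' ?z)"
    have ab: "?a \<le> B1" "?b \<le> B2" using B1[OF z] B2[OF z] by auto
    show "0 \<le> d r t" by (simp add: d_def)
    have "?b\<^sup>2 - ?a\<^sup>2 = (?b - ?a) * (?b + ?a)" by (simp add: power2_eq_square algebra_simps)
    then have d: "d r t = \<bar>?b - ?a\<bar> * (?b + ?a)" by (simp add: d_def abs_mult)
    have s: "?b + ?a \<le> L" using ab by (simp add: L_def)
    have "\<bar>?b - ?a\<bar> \<le> L" using ab B10 B20 norm_ge_zero[of "f ?z"] norm_ge_zero[of "f' ?z"]
      unfolding L_def by linarith
    then show d1: "d r t \<le> L\<^sup>2"
      unfolding d power2_eq_square using s L by (intro mult_mono) auto
    define c where "c = norm (cauchy \<gamma> ?z)"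
    define c' where "c' = norm (cauchy (\<lambda>\<zeta>. cnj \<zeta> * cnj (\<gamma> \<zeta>)) ?z)"
    let ?t = "norm (1 - \<theta> ?z)"
    have p: "0 \<le> pois ?z" by (rule pois_nonneg[OF z])
    have "\<bar>c' - r * c\<bar> \<le> norm (cauchy (\<lambda>\<zeta>. cnj \<zeta> * cnj (\<gamma> \<zeta>)) ?z + cnj ?z * cnj (cauchy \<gamma> ?z))"
    proof -
      have "r * c = norm (- (cnj ?z * cnj (cauchy \<gamma> ?z)))"
        unfolding norm_minus_cancel norm_mult complex_mod_cnj c_def using r by simp
      then show ?thesis
        using norm_triangle_ineq3[of "cauchy (\<lambda>\<zeta>. cnj \<zeta> * cnj (\<gamma> \<zeta>)) ?z" "- (cnj ?z * cnj (cauchy \<gamma> ?z))"]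
        by (simp add: c'_def)
    qed
    also have "\<dots> \<le> B * pois ?z"
      by (rule cauchy_reflect[OF good_bdm[OF \<gamma>] B(2) z])
    finally have "?t * \<bar>c' - r * c\<bar> \<le> 2 * (B * pois ?z)"
      using norm_one_minus_theta[OF z] by (intro mult_mono) auto
    moreover have "?t * \<bar>c' - r * c\<bar> = \<bar>?b - r * ?a\<bar>"
    proof -
      have "?b = ?t * c'" "?a = ?t * c"
        by (simp_all only: f_def f'_def Jinv_eq[OF z] norm_mult c_def c'_def)
      then have "?b - r * ?a = ?t * (c' - r * c)"
        by (simp add: right_diff_distrib)
      then show ?thesis by (simp add: abs_mult)
    qed
    ultimately have "\<bar>?b - r * ?a\<bar> \<le> 2 * (B * pois ?z)" by simp
    moreover have "(1 - r) * ?a \<le> (1 - r) * L"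
      using r s norm_ge_zero[of "f' ?z"] by (intro mult_left_mono) linarith+
    moreover have "0 \<le> (1 - r) * ?a" using r by simp
    ultimately have "\<bar>?b - ?a\<bar> \<le> 2 * (B * pois ?z) + (1 - r) * L"
      by (simp add: left_diff_distrib abs_le_iff)
    then have d2: "d r t \<le> (2 * (B * pois ?z) + (1 - r) * L) * L"
      unfolding d using s r p B L by (intro mult_mono) auto
    show "d r t \<le> (4 * B * L + L\<^sup>2) * min 1 (pois ?z) + L\<^sup>2 * (1 - r)"
    proof (cases "pois ?z \<le> 1")
      case True
      have "0 \<le> B * L * pois ?z" "0 \<le> L\<^sup>2 * pois ?z" using B L p by auto
      moreover have "(2 * (B * pois ?z) + (1 - r) * L) * L = 2 * (B * L * pois ?z) + L\<^sup>2 * (1 - r)"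
        by (simp add: power2_eq_square algebra_simps)
      moreover have "(4 * B * L + L\<^sup>2) * pois ?z = 4 * (B * L * pois ?z) + L\<^sup>2 * pois ?z"
        by (simp add: algebra_simps)
      ultimately have "d r t \<le> (4 * B * L + L\<^sup>2) * pois ?z + L\<^sup>2 * (1 - r)"
        using d2 by linarith
      then show ?thesis using True by (simp add: min_def)
    next
      case False
      have "0 \<le> B * L" "0 \<le> L\<^sup>2 * (1 - r)" using B L r by auto
      then show ?thesis using False d1 by (simp add: min_def)
    qed
  qed
  have d_lim: "((\<lambda>r. LINT t|angle_measure. d r t) \<longlongrightarrow> 0) (at_left 1)"
  proof (rule tendsto_sandwich[where f = "\<lambda>_. 0"
        and h = "\<lambda>r. (4 * B * L + L\<^sup>2) * (LINT t|angle_measure. min 1 (pois (of_real r * cis t))) + L\<^sup>2 * (1 - r)"])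
    show "\<forall>\<^sub>F r in at_left 1. 0 \<le> (LINT t|angle_measure. d r t)"
      by (rule eventually_at_left_1) (auto intro!: integral_nonneg_AE d_bounds)
    show "\<forall>\<^sub>F r in at_left 1. (LINT t|angle_measure. d r t) \<le> (4 * B * L + L\<^sup>2) * (LINT t|angle_measure. min 1 (pois (of_real r * cis t))) + L\<^sup>2 * (1 - r)"
    proof (rule eventually_at_left_1)
      fix r :: real assume r: "0 < r" "r < 1"
      have pc: "continuous_on UNIV (\<lambda>t. (4 * B * L + L\<^sup>2) * min 1 (pois (of_real r * cis t)))"
        using pois_continuous[of r] r by (intro continuous_intros) auto
      have "(LINT t|angle_measure. d r t) \<le> (LINT t|angle_measure. (4 * B * L + L\<^sup>2) * min 1 (pois (of_real r * cis t)) + L\<^sup>2 * (1 - r))"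
        by (rule integral_angle_mono[OF d_cont[OF r] continuous_on_add[OF pc continuous_on_const] d_bounds(3)[OF r]])
      also have "\<dots> = (4 * B * L + L\<^sup>2) * (LINT t|angle_measure. min 1 (pois (of_real r * cis t))) + L\<^sup>2 * (1 - r)"
        by (subst Bochner_Integration.integral_add[OF integral_angle(1)[OF pc]]) auto
      finally show "(LINT t|angle_measure. d r t) \<le> (4 * B * L + L\<^sup>2) * (LINT t|angle_measure. min 1 (pois (of_real r * cis t))) + L\<^sup>2 * (1 - r)" .
    qed
    have "((\<lambda>r. (4 * B * L + L\<^sup>2) * (LINT t|angle_measure. min 1 (pois (of_real r * cis t))) + L\<^sup>2 * (1 - r)) \<longlongrightarrow> (4 * B * L + L\<^sup>2) * 0 + L\<^sup>2 * (1 - 1)) (at_left 1)"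
      by (intro tendsto_intros min_pois_tendsto_0)
    then show "((\<lambda>r. (4 * B * L + L\<^sup>2) * (LINT t|angle_measure. min 1 (pois (of_real r * cis t))) + L\<^sup>2 * (1 - r)) \<longlongrightarrow> 0) (at_left 1)"
      by simp
  qed simp
  have "((\<lambda>r. LINT t|angle_measure. (cmod (g (of_real r * cis t)))\<^sup>2 * d r t) \<longlongrightarrow> 0) (at_left 1)"
    by (rule uniformly_integrable_dilates[OF g d_cont _ d_lim]) (use d_bounds in auto)
  moreover have "\<forall>\<^sub>F r in at_left 1. norm (mean2 (\<lambda>z. g z * f' z) r - mean2 (\<lambda>z. g z * f z) r)
      \<le> (LINT t|angle_measure. (cmod (g (of_real r * cis t)))\<^sup>2 * d r t)"
  proof (rule eventually_at_left_1)
    fix r :: real assume r: "0 < r" "r < 1"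
    have c: "continuous_on UNIV (\<lambda>t. (cmod (g (of_real r * cis t) * f' (of_real r * cis t)))\<^sup>2)"
      "continuous_on UNIV (\<lambda>t. (cmod (g (of_real r * cis t) * f (of_real r * cis t)))\<^sup>2)"
      using circle_continuous[OF hardy_holo[OF hgf(1)], of r] circle_continuous[OF hardy_holo[OF hgf(2)], of r] r
      by (auto intro!: continuous_on_power continuous_on_norm)
    have "mean2 (\<lambda>z. g z * f' z) r - mean2 (\<lambda>z. g z * f z) r
      = (LINT t|angle_measure. (cmod (g (of_real r * cis t) * f' (of_real r * cis t)))\<^sup>2 - (cmod (g (of_real r * cis t) * f (of_real r * cis t)))\<^sup>2)"
      unfolding mean2_def by (rule Bochner_Integration.integral_diff[OF integral_angle(1)[OF c(1)] integral_angle(1)[OF c(2)], symmetric])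
    then have "norm (mean2 (\<lambda>z. g z * f' z) r - mean2 (\<lambda>z. g z * f z) r)
      \<le> (LINT t|angle_measure. norm ((cmod (g (of_real r * cis t) * f' (of_real r * cis t)))\<^sup>2 - (cmod (g (of_real r * cis t) * f (of_real r * cis t)))\<^sup>2))"
      by (simp only: integral_norm_bound)
    also have "(\<lambda>t. norm ((cmod (g (of_real r * cis t) * f' (of_real r * cis t)))\<^sup>2 - (cmod (g (of_real r * cis t) * f (of_real r * cis t)))\<^sup>2))
      = (\<lambda>t. (cmod (g (of_real r * cis t)))\<^sup>2 * d r t)"
      by (auto simp: d_def norm_mult power_mult_distrib abs_mult simp flip: right_diff_distrib)
    finally show "norm (mean2 (\<lambda>z. g z * f' z) r - mean2 (\<lambda>z. g z * f z) r) \<le> (LINT t|angle_measure. (cmod (g (of_real r * cis t)))\<^sup>2 * d r t)" .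
  qed
  ultimately have "((\<lambda>r. mean2 (\<lambda>z. g z * f' z) r - mean2 (\<lambda>z. g z * f z) r) \<longlongrightarrow> 0) (at_left 1)"
    by (rule Lim_null_comparison[rotated])
  moreover have "((\<lambda>r. mean2 (\<lambda>z. g z * f' z) r - mean2 (\<lambda>z. g z * f z) r) \<longlongrightarrow> (h2_norm (\<lambda>z. g z * f' z))\<^sup>2 - (h2_norm (\<lambda>z. g z * f z))\<^sup>2) (at_left 1)"
    by (intro tendsto_diff h2_norm_tendsto hgf)
  ultimately have "(h2_norm (\<lambda>z. g z * f' z))\<^sup>2 - (h2_norm (\<lambda>z. g z * f z))\<^sup>2 = 0"
    by (intro tendsto_unique[of "at_left (1::real)"]) auto
  then have "h2_norm (\<lambda>z. g z * f' z) = h2_norm (\<lambda>z. g z * f z)"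
    using h2_norm_nonneg[OF hgf(1)] h2_norm_nonneg[OF hgf(2)] by (simp add: power2_eq_iff_nonneg)
  then show ?thesis by (simp add: f_def f'_def)
qed

end

section \<open>Transfer to the intertwined operator\<close>

lemma bounded_op_onE:
  assumes "bounded_op_on W V S"
  obtains C where "\<And>f. f \<in> W \<Longrightarrow> h2_norm (S f) \<le> C * h2_norm f"
  using assms unfolding bounded_op_on_def by blast

lemma bounded_op_on_power:
  assumes S: "bounded_op_on W W S" and W: "\<And>f. f \<in> W \<Longrightarrow> 0 \<le> h2_norm f"
  shows "bounded_op_on W W (S ^^ n)"
proof (induction n)
  case 0
  show ?case by (auto simp: bounded_op_on_def intro!: exI[of _ 1])
next
  case (Suc n)
  obtain C where C: "\<And>f. f \<in> W \<Longrightarrow> h2_norm (S f) \<le> C * h2_norm f"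
    using bounded_op_onE[OF S] by metis
  obtain D where D: "\<And>f. f \<in> W \<Longrightarrow> h2_norm ((S ^^ n) f) \<le> D * h2_norm f"
    using bounded_op_onE[OF Suc] by metis
  have SW: "f \<in> W \<Longrightarrow> (S ^^ n) f \<in> W" for f
    using Suc by (simp add: bounded_op_on_def)
  have "h2_norm (S ((S ^^ n) f)) \<le> \<bar>C\<bar> * D * h2_norm f" if f: "f \<in> W" for f
  proof -
    have "h2_norm (S ((S ^^ n) f)) \<le> C * h2_norm ((S ^^ n) f)"
      by (rule C[OF SW[OF f]])
    also have "\<dots> \<le> \<bar>C\<bar> * h2_norm ((S ^^ n) f)"
      by (intro mult_right_mono W SW f) auto
    also have "\<dots> \<le> \<bar>C\<bar> * (D * h2_norm f)"
      by (intro mult_left_mono D f) auto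
    finally show ?thesis by simp
  qed
  then show ?case
    unfolding bounded_op_on_def funpow.simps o_apply
  proof (intro conjI ballI allI exI[of _ "\<bar>C\<bar> * D"])
    fix f assume f: "f \<in> W"
    show "S ((S ^^ n) f) \<in> W"
      using S SW[OF f] by (simp add: bounded_op_on_def)
    show "S ((S ^^ n) (\<lambda>z. c * f z)) = (\<lambda>z. c * S ((S ^^ n) f) z)" for c
      using S Suc SW[OF f] f by (simp add: bounded_op_on_def)
    show "S ((S ^^ n) (\<lambda>z. f z + h z)) = (\<lambda>z. S ((S ^^ n) f) z + S ((S ^^ n) h) z)" if "h \<in> W" for h
      using S Suc SW[OF f] SW[OF that] f that by (simp add: bounded_op_on_def)
  qed
qed

context clark
begin

text \<open>The first family is the orbit of \<gamma> under division by \<zeta>, the second the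
  orbit of its reflection under multiplication by \<zeta>. Every m is included because the
  intertwining relation is iterated one step at a time along both orbits.\<close>

definition vgood :: "(complex \<Rightarrow> complex) \<Rightarrow> bool" where
  "vgood \<gamma> \<longleftrightarrow> (\<forall>m. good (\<lambda>\<zeta>. cnj \<zeta> ^ m * \<gamma> \<zeta>) \<and> good (\<lambda>\<zeta>. \<zeta> ^ m * (cnj \<zeta> * cnj (\<gamma> \<zeta>))))"

lemma vgood_power: "vgood (\<lambda>\<zeta>. \<zeta> ^ n)"
  unfolding vgood_def
proof (intro allI conjI)
  fix m
  show "good (\<lambda>\<zeta>. cnj \<zeta> ^ m * \<zeta> ^ n)" by (rule good_monomial)
  have "(\<lambda>\<zeta>. \<zeta> ^ m * (cnj \<zeta> * cnj (\<zeta> ^ n))) = (\<lambda>\<zeta>. cnj \<zeta> ^ Suc n * \<zeta> ^ m)"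
    by (simp add: fun_eq_iff mult_ac)
  then show "good (\<lambda>\<zeta>. \<zeta> ^ m * (cnj \<zeta> * cnj (\<zeta> ^ n)))"
    by (simp only: good_monomial)
qed

lemma vgood_cmult:
  assumes "vgood \<gamma>"
  shows "vgood (\<lambda>\<zeta>. c * \<gamma> \<zeta>)"
  unfolding vgood_def
proof (intro allI conjI)
  fix m
  have g: "good (\<lambda>\<zeta>. cnj \<zeta> ^ m * \<gamma> \<zeta>)" "good (\<lambda>\<zeta>. \<zeta> ^ m * (cnj \<zeta> * cnj (\<gamma> \<zeta>)))"
    using assms by (auto simp: vgood_def)
  show "good (\<lambda>\<zeta>. cnj \<zeta> ^ m * (c * \<gamma> \<zeta>))"
    using good_cmult[OF g(1), of c] by (simp add: mult_ac)
  show "good (\<lambda>\<zeta>. \<zeta> ^ m * (cnj \<zeta> * cnj (c * \<gamma> \<zeta>)))"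
    using good_cmult[OF g(2), of "cnj c"] by (simp add: mult_ac)
qed

lemma vgood_add:
  assumes "vgood \<gamma>" "vgood \<delta>"
  shows "vgood (\<lambda>\<zeta>. \<gamma> \<zeta> + \<delta> \<zeta>)"
  using assms unfolding vgood_def by (auto simp: distrib_left intro: good_add)

lemma vgood_sum:
  assumes "\<And>i. i \<in> A \<Longrightarrow> vgood (f i)"
  shows "vgood (\<lambda>\<zeta>. \<Sum>i\<in>A. f i \<zeta>)"
  using assms
proof (induction A rule: infinite_finite_induct)
  case (insert x A)
  then show ?case by (auto intro: vgood_add)
qed (use vgood_cmult[OF vgood_power, of 0] in auto)

lemma vgood_gam: "vgood (\<lambda>\<zeta>. \<zeta> ^ n - qpol n \<zeta>)"
proof -
  have "vgood (\<lambda>\<zeta>. \<zeta> ^ n + (- 1) * (\<Sum>j\<le>n. cnj (coef \<theta> j) * \<zeta> ^ (n - j)))"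
    by (intro vgood_add vgood_cmult vgood_sum vgood_power)
  then show ?thesis by (simp add: qpol_def)
qed

text \<open>Good densities thereby fall under the intertwining relation, which is stated on
  \<open>L2 \<mu>\<close>.\<close>

lemma good_L2:
  assumes "good \<gamma>"
  shows "\<gamma> \<in> L2 \<mu>"
proof -
  note b = good_bdm[OF assms]
  have "integrable \<mu> (\<lambda>\<zeta>. Re (\<gamma> \<zeta> * cnj (\<gamma> \<zeta>)))"
    by (intro integrable_Re bdm_integrable bdm_mult b bdm_cnj)
  then have "integrable \<mu> (\<lambda>\<zeta>. (cmod (\<gamma> \<zeta>))\<^sup>2)"
    by (simp only: complex_norm_square[symmetric] Re_complex_of_real)
  moreover have "\<gamma> \<in> borel_measurable \<mu>"
    using bdm_measurable[OF b] by measurable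
  ultimately show ?thesis by (simp add: L2_def)
qed

text \<open>The bound is proved on the images of trigonometric polynomials, which are dense. The
  extension uses some bound D for the n-th power of S; it may grow with n, but it only multiplies an
  error that is sent to 0 while n is fixed.\<close>

lemma h2_norm_inverse_powers:
  assumes w: "w holomorphic_on ball 0 1" "bounded (w ` ball 0 1)"
    and g: "g \<in> H2"
    and X: "bounded_op_on (model_space \<theta>) (model_space w) (\<lambda>f z. g z * f z)"
    and X_dense: "\<forall>h \<in> model_space w. \<forall>\<epsilon>>0. \<exists>f \<in> model_space \<theta>. h2_norm (\<lambda>z. h z - g z * f z) < \<epsilon>"
    and S: "bounded_op_on (model_space w) (model_space w) S"
    and S_left_inv: "\<forall>f \<in> model_space w. S (T f) = f"
    and intertwine: "\<forall>\<gamma> \<in> L2 \<mu>.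
        (\<lambda>z. g z * clark_Jinv \<mu> (\<lambda>\<zeta>. \<zeta> * \<gamma> \<zeta>) z) = T (\<lambda>z. g z * clark_Jinv \<mu> \<gamma> z)"
    and M: "\<And>n f. f \<in> model_space w \<Longrightarrow> h2_norm ((T ^^ n) f) \<le> M * h2_norm f" and M0: "0 \<le> M"
    and F: "F \<in> model_space w"
  shows "h2_norm ((S ^^ n) F) \<le> M * h2_norm F"
proof -
  let ?W = "model_space w"
  define Y where "Y = (\<lambda>\<gamma> z. g z * clark_Jinv \<mu> \<gamma> z)"
  have nn: "\<And>f. f \<in> ?W \<Longrightarrow> 0 \<le> h2_norm f"
    by (intro h2_norm_nonneg model_space_hardy)
  have YW: "Y \<gamma> \<in> ?W" if "good \<gamma>" for \<gamma>
    using X good_model_space[OF that] by (auto simp: bounded_op_on_def Y_def)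
  have TY: "T (Y \<gamma>) = Y (\<lambda>\<zeta>. \<zeta> * \<gamma> \<zeta>)" if "good \<gamma>" for \<gamma>
    using intertwine good_L2[OF that] by (simp add: Y_def)
  have trig: "h2_norm ((S ^^ n) (Y \<gamma>)) \<le> M * h2_norm (Y \<gamma>)" if \<gamma>: "vgood \<gamma>" for \<gamma>
  proof -
    define p where "p = (\<lambda>m \<zeta>. cnj \<zeta> ^ m * \<gamma> \<zeta>)"
    define q where "q = (\<lambda>m \<zeta>. \<zeta> ^ m * (cnj \<zeta> * cnj (\<gamma> \<zeta>)))"
    have p: "good (p m)" and q: "good (q m)" for m
      using \<gamma> by (auto simp: vgood_def p_def q_def)
    have "(S ^^ n) (Y (p 0)) = Y (p n)"
    proof (induction n)
      case (Suc n)
      \<comment> \<open>The two densities agree only where |\<zeta>| = 1, so the equality is one of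
        images rather than of functions on the plane.\<close>
      have "clark_Jinv \<mu> (p n) = clark_Jinv \<mu> (\<lambda>\<zeta>. \<zeta> * p (Suc n) \<zeta>)"
      proof (rule Jinv_cong)
        show "bdm (\<lambda>\<zeta>. \<zeta> * p (Suc n) \<zeta>)"
          by (rule bdm_mult[OF bdm_continuous good_bdm[OF p]]) (rule continuous_on_id)
        fix \<zeta> :: complex assume "norm \<zeta> = 1"
        then have "\<zeta> * cnj \<zeta> = 1" by (simp add: complex_norm_square[symmetric])
        then show "p n \<zeta> = \<zeta> * p (Suc n) \<zeta>"
          by (simp add: p_def mult.assoc[symmetric])
      qed (rule good_bdm[OF p])
      then have "Y (p n) = T (Y (p (Suc n)))"
        by (simp add: TY[OF p]) (simp add: Y_def)
      then show ?case
        using S_left_inv YW[OF p] Suc by simp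
    qed simp
    moreover have "(T ^^ n) (Y (q 0)) = Y (q n)"
    proof (induction n)
      case (Suc n)
      have "(\<lambda>\<zeta>. \<zeta> * q n \<zeta>) = q (Suc n)"
        by (simp add: q_def fun_eq_iff mult_ac)
      then show ?case using Suc TY[OF q, of n] by simp
    qed simp
    \<comment> \<open>Reflection turns the factor \<open>cnj \<zeta> ^ m\<close> into
      \<open>\<zeta> ^ m\<close>, so it exchanges the two orbits at every m. The equality is used at
      m = n and at m = 0.\<close>
    moreover have "h2_norm (Y (q m)) = h2_norm (Y (p m))" for m
    proof -
      have eq: "(\<lambda>\<zeta>. cnj \<zeta> * cnj (p m \<zeta>)) = q m"
        by (simp add: p_def q_def fun_eq_iff mult_ac)
      show ?thesis
        using h2_norm_reflect[OF hardy_H2[OF g] p[of m]] q[of m] unfolding eq Y_def by blast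
    qed
    moreover have "p 0 = \<gamma>" by (simp add: p_def)
    ultimately show ?thesis
      using M[OF YW[OF q[of 0]], of n] by simp
  qed
  note Sn = bounded_op_on_power[OF S nn, of n]
  obtain D where D: "\<And>f. f \<in> ?W \<Longrightarrow> h2_norm ((S ^^ n) f) \<le> D * h2_norm f"
    using bounded_op_onE[OF Sn] by metis
  obtain C where C: "\<And>f. f \<in> model_space \<theta> \<Longrightarrow> h2_norm (\<lambda>z. g z * f z) \<le> C * h2_norm f"
    using bounded_op_onE[OF X] by metis
  show ?thesis
  proof (rule field_le_epsilon)
    fix e :: real assume e: "e > 0"
    \<comment> \<open>Two approximations within \<epsilon> are made: one of F in
      \<open>model_space w\<close>, and one in \<open>model_space \<theta>\<close> that X enlarges
      by C. Their total (|C| + 1) \<epsilon> enters with the factor D through S and with the factor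
      M through the trigonometric bound.\<close>
    define \<epsilon> where "\<epsilon> = e / ((\<bar>D\<bar> + M + 1) * (\<bar>C\<bar> + 1))"
    have \<epsilon>: "\<epsilon> > 0" "(\<bar>D\<bar> + M) * ((\<bar>C\<bar> + 1) * \<epsilon>) \<le> e"
    proof -
      have pos: "0 < (\<bar>D\<bar> + M + 1) * (\<bar>C\<bar> + 1)" using M0 by (intro mult_pos_pos) auto
      then show e0: "\<epsilon> > 0" using e by (simp add: \<epsilon>_def)
      have "(\<bar>D\<bar> + M) * ((\<bar>C\<bar> + 1) * \<epsilon>) \<le> (\<bar>D\<bar> + M + 1) * ((\<bar>C\<bar> + 1) * \<epsilon>)"
        using e0 by (intro mult_right_mono) auto
      also have "\<dots> = (\<bar>D\<bar> + M + 1) * (\<bar>C\<bar> + 1) * \<epsilon>" by simp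
      also have "\<dots> = e"
        unfolding \<epsilon>_def times_divide_eq_right
        by (rule nonzero_mult_div_cancel_left[OF less_imp_neq[OF pos, symmetric]])
      finally show "(\<bar>D\<bar> + M) * ((\<bar>C\<bar> + 1) * \<epsilon>) \<le> e" .
    qed
    obtain f where f: "f \<in> model_space \<theta>" "h2_norm (\<lambda>z. F z - g z * f z) < \<epsilon>"
      using X_dense F \<epsilon>(1) by blast
    obtain N where N: "h2_norm (\<lambda>z. f z - clark_Jinv \<mu> (\<lambda>\<zeta>. \<Sum>n<N. coef f n * (\<zeta> ^ n - qpol n \<zeta>)) z) < \<epsilon>"
      using model_space_approx[OF f(1) \<epsilon>(1)] by blast
    define \<gamma> where "\<gamma> = (\<lambda>\<zeta>. \<Sum>n<N. coef f n * (\<zeta> ^ n - qpol n \<zeta>))"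
    have \<gamma>: "vgood \<gamma>"
      unfolding \<gamma>_def by (intro vgood_sum vgood_cmult vgood_gam)
    have "good \<gamma>"
      using \<gamma>[unfolded vgood_def, rule_format, of 0] by simp
    define k where "k = (\<lambda>z. f z - clark_Jinv \<mu> \<gamma> z)"
    have k: "k \<in> model_space \<theta>" "h2_norm k < \<epsilon>"
      using model_space_add[OF theta_holo theta_bounded f(1) model_space_cmult[OF theta_holo theta_bounded good_model_space[OF \<open>good \<gamma>\<close>], of "-1"]] N
      by (simp_all add: k_def \<gamma>_def)
    have gf: "(\<lambda>z. g z * f z) \<in> ?W" "(\<lambda>z. g z * k z) \<in> ?W"
      using X f k by (auto simp: bounded_op_on_def)
    define G where "G = (\<lambda>z. F z + (- 1) * Y \<gamma> z)"
    have G: "G \<in> ?W"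
      unfolding G_def by (intro model_space_add model_space_cmult w F YW \<open>good \<gamma>\<close>)
    have gfh: "hardy (\<lambda>z. F z - g z * f z)"
      using hardy_add[OF model_space_hardy[OF F] hardy_cmult[OF model_space_hardy[OF gf(1)], of "-1"]] by simp
    have "G = (\<lambda>z. (F z - g z * f z) + g z * k z)"
      by (simp add: G_def Y_def k_def fun_eq_iff algebra_simps)
    then have "h2_norm G \<le> h2_norm (\<lambda>z. F z - g z * f z) + h2_norm (\<lambda>z. g z * k z)"
      using h2_norm_triangle[OF gfh model_space_hardy[OF gf(2)]] by simp
    also have "h2_norm (\<lambda>z. g z * k z) \<le> \<bar>C\<bar> * \<epsilon>"
    proof -
      have "h2_norm (\<lambda>z. g z * k z) \<le> C * h2_norm k" by (rule C[OF k(1)])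
      also have "\<dots> \<le> \<bar>C\<bar> * h2_norm k"
        by (intro mult_right_mono h2_norm_nonneg model_space_hardy[OF k(1)]) auto
      also have "\<dots> \<le> \<bar>C\<bar> * \<epsilon>"
        using k by (intro mult_left_mono) auto
      finally show ?thesis .
    qed
    finally have G\<epsilon>: "h2_norm G \<le> (\<bar>C\<bar> + 1) * \<epsilon>"
      using f(2) by (simp add: distrib_right)
    have YG: "h2_norm (Y \<gamma>) \<le> h2_norm F + h2_norm G"
    proof -
      have "Y \<gamma> = (\<lambda>z. F z + (- 1) * G z)" by (simp add: G_def)
      then have "h2_norm (Y \<gamma>) \<le> h2_norm F + h2_norm (\<lambda>z. (- 1) * G z)"
        using h2_norm_triangle[OF model_space_hardy[OF F] hardy_cmult[OF model_space_hardy[OF G], of "-1"]] by simp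
      then show ?thesis using h2_norm_cmult[OF model_space_hardy[OF G], of "-1"] by simp
    qed
    have "F = (\<lambda>z. G z + Y \<gamma> z)" by (simp add: G_def)
    then have "(S ^^ n) F = (\<lambda>z. (S ^^ n) G z + (S ^^ n) (Y \<gamma>) z)"
      using Sn G YW[OF \<open>good \<gamma>\<close>] unfolding bounded_op_on_def by metis
    moreover have "(S ^^ n) G \<in> ?W" "(S ^^ n) (Y \<gamma>) \<in> ?W"
      using Sn G YW[OF \<open>good \<gamma>\<close>] by (auto simp: bounded_op_on_def)
    ultimately have "h2_norm ((S ^^ n) F) \<le> h2_norm ((S ^^ n) G) + h2_norm ((S ^^ n) (Y \<gamma>))"
      using h2_norm_triangle[of "(S ^^ n) G" "(S ^^ n) (Y \<gamma>)"] model_space_hardy by metis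
    also have "h2_norm ((S ^^ n) G) \<le> \<bar>D\<bar> * h2_norm G"
      using D[OF G] mult_right_mono[OF abs_ge_self[of D] nn[OF G]] by linarith
    also have "h2_norm ((S ^^ n) (Y \<gamma>)) \<le> M * (h2_norm F + h2_norm G)"
      using trig[OF \<gamma>] mult_left_mono[OF YG M0] by linarith
    also have "\<bar>D\<bar> * h2_norm G + M * (h2_norm F + h2_norm G) = M * h2_norm F + (\<bar>D\<bar> + M) * h2_norm G"
      by (simp add: algebra_simps)
    also have "(\<bar>D\<bar> + M) * h2_norm G \<le> (\<bar>D\<bar> + M) * ((\<bar>C\<bar> + 1) * \<epsilon>)"
      using G\<epsilon> M0 by (intro mult_left_mono) auto
    finally show "h2_norm ((S ^^ n) F) \<le> M * h2_norm F + e"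
      using \<epsilon>(2) by linarith
  qed
qed

end

section \<open>Operator norms and the final estimate\<close>

text \<open>Homogeneity reduces to norm 1, where the supremum applies. A vector of norm 0 cannot be
  normalized; there boundedness of T makes the norm of the image at most 0.\<close>

lemma op_norm_bound:
  assumes W: "\<And>f. f \<in> W \<Longrightarrow> hardy f" "\<And>f c. f \<in> W \<Longrightarrow> (\<lambda>z. c * f z) \<in> W"
    and T: "bounded_op_on W W T" and M: "op_norm W T \<le> ennreal M" "0 \<le> M" and f: "f \<in> W"
  shows "h2_norm (T f) \<le> M * h2_norm f"
proof (cases "h2_norm f = 0")
  case True
  obtain C where "h2_norm (T f) \<le> C * h2_norm f"
    using T f by (auto simp: bounded_op_on_def)
  then show ?thesis using True by simp
next
  case False
  then have pos: "0 < h2_norm f" using h2_norm_nonneg[OF W(1)[OF f]] by simp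
  let ?c = "complex_of_real (1 / h2_norm f)"
  have c: "cmod ?c = 1 / h2_norm f" using pos by (simp only: norm_of_real abs_of_nonneg) simp
  have n1: "h2_norm (\<lambda>z. ?c * f z) = 1"
    unfolding h2_norm_cmult[OF W(1)[OF f]] c using pos by simp
  have "ennreal (h2_norm (T (\<lambda>z. ?c * f z))) \<le> op_norm W T"
    unfolding op_norm_def
    by (rule SUP_upper) (simp only: mem_Collect_eq n1 W(2)[OF f] order_refl simp_thms)
  then have "ennreal (h2_norm (T (\<lambda>z. ?c * f z))) \<le> ennreal M"
    using M(1) by (rule order_trans)
  moreover have "T (\<lambda>z. ?c * f z) = (\<lambda>z. ?c * T f z)" "T f \<in> W"
    using T f by (auto simp only: bounded_op_on_def)
  ultimately have "1 / h2_norm f * h2_norm (T f) \<le> M"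
    using M(2) h2_norm_cmult[OF W(1)[OF \<open>T f \<in> W\<close>], of ?c] by (simp only: c ennreal_le_iff)
  then show ?thesis using pos by (simp add: field_simps)
qed

theorem theorem5p3:
  fixes \<mu> :: "complex measure"
    and \<omega> g :: "complex \<Rightarrow> complex"
    and T S :: "(complex \<Rightarrow> complex) \<Rightarrow> (complex \<Rightarrow> complex)"
  assumes mu_borel: "sets \<mu> = sets borel"
    and mu_on_circle: "emeasure \<mu> (UNIV - sphere 0 1) = 0"
    and mu_prob: "emeasure \<mu> (sphere 0 1) = 1"
    and mu_singular: "\<exists>A \<in> sets borel. emeasure circle_m A = 0 \<and> emeasure \<mu> (UNIV - A) = 0"
    and omega_inner: "inner_fun \<omega>"
    and g_H2: "g \<in> H2"
    and X_bounded: "bounded_op_on (model_space (clark_theta \<mu>)) (model_space \<omega>) (\<lambda>f z. g z * f z)"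
    and X_dense: "\<forall>h \<in> model_space \<omega>. \<forall>\<epsilon>>0. \<exists>f \<in> model_space (clark_theta \<mu>).
                    h2_norm (\<lambda>z. h z - g z * f z) < \<epsilon>"
    and T_bounded: "bounded_op_on (model_space \<omega>) (model_space \<omega>) T"
    and S_bounded: "bounded_op_on (model_space \<omega>) (model_space \<omega>) S"
    and S_left_inv: "\<forall>f \<in> model_space \<omega>. S (T f) = f"
    and S_right_inv: "\<forall>f \<in> model_space \<omega>. T (S f) = f"
    and intertwine: "\<forall>\<gamma> \<in> L2 \<mu>.
        (\<lambda>z. g z * clark_Jinv \<mu> (\<lambda>\<zeta>. \<zeta> * \<gamma> \<zeta>) z) = T (\<lambda>z. g z * clark_Jinv \<mu> \<gamma> z)"
  shows "(SUP n. op_norm (model_space \<omega>) (S ^^ n))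
           \<le> (SUP n. op_norm (model_space \<omega>) (T ^^ n)) ^ 5"
proof -
  interpret clark \<mu>
    by standard (fact mu_borel mu_on_circle mu_prob mu_singular)+
  let ?W = "model_space \<omega>"
  have w: "\<omega> holomorphic_on ball 0 1" "bounded (\<omega> ` ball 0 1)"
    using omega_inner by (auto simp: inner_fun_def)
  define M where "M = (SUP n. op_norm ?W (T ^^ n))"
  have hW: "\<And>f. f \<in> ?W \<Longrightarrow> hardy f" by (rule model_space_hardy)
  have nn: "\<And>f. f \<in> ?W \<Longrightarrow> 0 \<le> h2_norm f" by (intro h2_norm_nonneg hW)
  have Tn: "bounded_op_on ?W ?W (T ^^ n)" and Sn: "bounded_op_on ?W ?W (S ^^ n)" for n
    by (intro bounded_op_on_power T_bounded S_bounded nn; assumption)+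
  show ?thesis
  proof (cases "M = top")
    \<comment> \<open>The fifth power of an infinite supremum is infinite, so the estimate is
      trivial; otherwise M is a nonnegative real number m.\<close>
    case True
    then show ?thesis by (simp add: M_def[symmetric] power_eq_top_ennreal)
  next
    case False
    then obtain m where m: "M = ennreal m" "0 \<le> m"
      by (cases M) auto
    have opT: "op_norm ?W (T ^^ n) \<le> ennreal m" for n
      unfolding m(1)[symmetric] M_def by (rule SUP_upper) simp
    have bd: "h2_norm ((T ^^ n) f) \<le> m * h2_norm f" if "f \<in> ?W" for n f
      using hW model_space_cmult[OF w] Tn[of n] opT[of n] m(2) that by (rule op_norm_bound)
    have Sbd: "h2_norm ((S ^^ n) f) \<le> m * h2_norm f" if "f \<in> ?W" for n f
      using h2_norm_inverse_powers[OF w g_H2 X_bounded X_dense S_bounded S_left_inv intertwine bd m(2) that] .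
    show ?thesis
    proof (cases "\<exists>f\<in>?W. h2_norm f \<noteq> 0")
      case True
      then obtain f where f: "f \<in> ?W" "h2_norm f > 0"
        using nn by force
      \<comment> \<open>The power n = 0 is the identity, and its bound on a vector of positive norm
        forces this.\<close>
      have "1 \<le> m"
        using bd[OF f(1), of 0] f(2) by simp
      have "op_norm ?W (S ^^ n) \<le> ennreal m" for n
        unfolding op_norm_def
      proof (rule SUP_least)
        fix h assume h: "h \<in> {h \<in> ?W. h2_norm h \<le> 1}"
        then have "h2_norm ((S ^^ n) h) \<le> m * h2_norm h" by (intro Sbd) auto
        also have "\<dots> \<le> m" using h m(2) by (intro mult_left_le) auto
        finally show "ennreal (h2_norm ((S ^^ n) h)) \<le> ennreal m" by (rule ennreal_leI)
      qed
      then have "(SUP n. op_norm ?W (S ^^ n)) \<le> ennreal m"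
        by (rule SUP_least)
      \<comment> \<open>The reflection argument yields the first power of the supremum; as m is at
        least 1, the fifth power is no smaller.\<close>
      also have "\<dots> \<le> ennreal (m ^ 5)"
        using \<open>1 \<le> m\<close> by (intro ennreal_leI self_le_power) auto
      finally show ?thesis
        using m by (simp add: M_def[symmetric] ennreal_power)
    next
      case False
      have "op_norm ?W (S ^^ n) \<le> 0" for n
        unfolding op_norm_def
      proof (rule SUP_least)
        fix h assume "h \<in> {h \<in> ?W. h2_norm h \<le> 1}"
        then have "(S ^^ n) h \<in> ?W" using Sn[of n] by (auto simp: bounded_op_on_def)
        then show "ennreal (h2_norm ((S ^^ n) h)) \<le> 0" using False by simp
      qed
      then have "(SUP n. op_norm ?W (S ^^ n)) \<le> 0"
        by (rule SUP_least)
      then show ?thesis by (rule order_trans) simp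
    qed
  qed
qed

end
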